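(* Let $f\in L^2(0,T;V')$ and $u_0\in H$. The weak solution of the Navier–Stokes problem for a Bingham fluid $$\partial_t u+(u\cdot\nabla)u-\nabla\cdot(\tau(Du))+\nabla p=f,\quad \nabla\cdot u=0\ \text{ in }\Omega_T,\qquad u(\cdot,0)=u_0\ \text{ in }\Omega,\qquad u=0\ \text{ on }\partial\Omega\times(0,T),$$ with the Bingham law for $\tau(Du)$, is unique: if $(u_1,\tau(Du_1))$ and $(u_2,\tau(Du_2))$ are two weak solutions (in the sense defined in the context) with the same data $f,u_0$, then $u_1=u_2$.
   Context: $\Omega\subset\mathbb{R}^2$ is a bounded domain with Lipschitz boundary, $T>0$, $\Omega_T=\Omega\times(0,T)$; $\mu>0$ (viscosity) and $\tau_y>0$ (yield stress) are constants. For real $2\times2$ matrices, $A:B=\sum_{i,j}A_{ij}B_{ij}$ and $|A|^2=A:A$. $Du=\frac12(\nabla u+\nabla u^t)$. $H=\{v\in L^2(\Omega)^2:\ \nabla\cdot v=0,\ v\cdot n|_{\partial\Omega}=0\}$ with the $L^2$ norm; $V=\{v\in H^1_0(\Omega)^2:\ \nabla\cdot v=0\}$ with norm $\|v\|_V^2=\int_\Omega|\nabla v|^2dx$. $V'$ is the dual of $V$, $\langle\cdot,\cdot\rangle$ the duality bracket between $V'$ and $V$, and $H$ is identified with its dual so that $V\subset H\subset V'$. $L^p(0,T;X)$ are the usual Bochner spaces. $E_{2,2}=\{v\in L^2(0,T;V):\ \partial_t v\in L^2(0,T;V')\}$; its elements have a representative continuous from $[0,T]$ to $H$, which gives meaning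 to the initial condition. Bingham law: a matrix-valued function $\tau(Du)$ on $\Omega_T$ satisfies the Bingham law if, almost everywhere in $\Omega_T$, $\tau(Du)=\left(2\mu+\frac{\tau_y}{|Du|}\right)Du$ where $Du\neq0$, and $|\tau(Du)|\le\tau_y$ where $Du=0$ (so $\tau(Du)$ is not determined by $Du$ where $Du=0$). Weak solution: a pair $(u,\tau(Du))\in E_{2,2}\times L^2(\Omega_T)$, where $\tau(Du)$ satisfies the Bingham law, such that $u(\cdot,0)=u_0$ and, for all $\varphi\in L^2(0,T;V)$, $$\int_0^T\langle\partial_tu,\varphi\rangle+\int_{\Omega_T}\tau(Du):D\varphi+\int_{\Omega_T}(u\cdot\nabla)u\cdot\varphi=\int_0^T\langle f,\varphi\rangle .$$ *)

theory Defs
  imports "HOL-Analysis.Analysis"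
begin

text \<open>
  Elements of Lebesgue, Sobolev and Bochner spaces are represented by functions; two functions
  represent the same element iff they agree almost everywhere. Functionals in $V'$ are represented
  by functions on representatives, of which only the values on $V$ matter.
\<close>

section \<open>Lipschitz domains\<close>

definition lipschitz_boundary :: "(real^2) set \<Rightarrow> bool" where
  "lipschitz_boundary \<Omega> \<longleftrightarrow>
     (\<forall>p \<in> frontier \<Omega>. \<exists>(R :: real^2 \<Rightarrow> real^2) (\<gamma> :: real \<Rightarrow> real) L r.
        orthogonal_transformation R \<and> L-lipschitz_on UNIV \<gamma> \<and> r > 0 \<and>
        (\<forall>x \<in> ball p r. x \<in> \<Omega> \<longleftrightarrow> R x $ 2 > \<gamma> (R x $ 1)))"

definition lipschitz_domain :: "(real^2) set \<Rightarrow> bool" where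
  "lipschitz_domain \<Omega> \<longleftrightarrow>
     open \<Omega> \<and> connected \<Omega> \<and> \<Omega> \<noteq> {} \<and> bounded \<Omega> \<and> lipschitz_boundary \<Omega>"

section \<open>Square integrable functions and test functions\<close>

definition square_integrable :: "'a measure \<Rightarrow> ('a \<Rightarrow> 'b::euclidean_space) \<Rightarrow> bool" where
  "square_integrable M f \<longleftrightarrow> f \<in> borel_measurable M \<and> integrable M (\<lambda>x. (norm (f x))\<^sup>2)"

definition L2norm :: "'a measure \<Rightarrow> ('a \<Rightarrow> 'b::euclidean_space) \<Rightarrow> real" where
  "L2norm M f = sqrt (LINT x|M. (norm (f x))\<^sup>2)"

primrec Ck :: "nat \<Rightarrow> ('a::euclidean_space \<Rightarrow> 'b::real_normed_vector) \<Rightarrow> bool" where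
  "Ck 0 f \<longleftrightarrow> continuous_on UNIV f"
| "Ck (Suc k) f \<longleftrightarrow>
     (\<forall>x. f differentiable (at x)) \<and> (\<forall>h. Ck k (\<lambda>x. frechet_derivative f (at x) h))"

definition test_functions :: "'a::euclidean_space set \<Rightarrow> ('a \<Rightarrow> real) set" where
  "test_functions S =
     {\<psi>. (\<forall>k. Ck k \<psi>) \<and> compact (closure {x. \<psi> x \<noteq> 0}) \<and> closure {x. \<psi> x \<noteq> 0} \<subseteq> S}"

section \<open>Sobolev spaces\<close>

definition weak_gradient :: "(real^2) set \<Rightarrow> (real^2 \<Rightarrow> real) \<Rightarrow> (real^2 \<Rightarrow> real^2) \<Rightarrow> bool" where
  "weak_gradient \<Omega> v g \<longleftrightarrow>
     square_integrable (lebesgue_on \<Omega>) v \<and> square_integrable (lebesgue_on \<Omega>) g \<and>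
     (\<forall>\<psi> \<in> test_functions \<Omega>. \<forall>j.
        (LINT x|lebesgue_on \<Omega>. v x * frechet_derivative \<psi> (at x) (axis j 1)) =
        - (LINT x|lebesgue_on \<Omega>. g x $ j * \<psi> x))"

definition sobolev_H1 :: "(real^2) set \<Rightarrow> (real^2 \<Rightarrow> real) set" where
  "sobolev_H1 \<Omega> = {v. \<exists>g. weak_gradient \<Omega> v g}"

definition wgrad :: "(real^2) set \<Rightarrow> (real^2 \<Rightarrow> real) \<Rightarrow> real^2 \<Rightarrow> real^2" where
  "wgrad \<Omega> v = (SOME g. weak_gradient \<Omega> v g)"

definition H1norm :: "(real^2) set \<Rightarrow> (real^2 \<Rightarrow> real) \<Rightarrow> real" where
  "H1norm \<Omega> v =
     sqrt ((L2norm (lebesgue_on \<Omega>) v)\<^sup>2 + (L2norm (lebesgue_on \<Omega>) (wgrad \<Omega> v))\<^sup>2)"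

definition sobolev_H10 :: "(real^2) set \<Rightarrow> (real^2 \<Rightarrow> real) set" where
  "sobolev_H10 \<Omega> =
     {v \<in> sobolev_H1 \<Omega>. \<forall>\<epsilon>>0. \<exists>\<psi> \<in> test_functions \<Omega>. H1norm \<Omega> (\<lambda>x. v x - \<psi> x) < \<epsilon>}"

text \<open>For vector fields the rows are the gradients of the components:
  \<open>jacobian_weak \<Omega> v x $ i $ j\<close> is $\partial_j v_i (x)$.\<close>

definition jacobian_weak :: "(real^2) set \<Rightarrow> (real^2 \<Rightarrow> real^2) \<Rightarrow> real^2 \<Rightarrow> real^2^2" where
  "jacobian_weak \<Omega> v x = (\<chi> i. wgrad \<Omega> (\<lambda>y. v y $ i) x)"

section \<open>The spaces $H$, $V$ and $V'$\<close>

text \<open>For $v \in L^2$ with $\nabla \cdot v = 0$ the normal trace $v \cdot n$ is the functional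
  $\psi \mapsto \int_\Omega v \cdot \nabla \psi$, $\psi \in H^1(\Omega)$ (Green's formula).\<close>

definition space_H :: "(real^2) set \<Rightarrow> (real^2 \<Rightarrow> real^2) set" where
  "space_H \<Omega> =
     {v. square_integrable (lebesgue_on \<Omega>) v \<and>
         (\<forall>\<psi> \<in> test_functions \<Omega>.
            (LINT x|lebesgue_on \<Omega>. (\<Sum>j\<in>UNIV. v x $ j * frechet_derivative \<psi> (at x) (axis j 1))) = 0) \<and>
         (\<forall>\<psi> \<in> sobolev_H1 \<Omega>. (LINT x|lebesgue_on \<Omega>. v x \<bullet> wgrad \<Omega> \<psi> x) = 0)}"

definition space_V :: "(real^2) set \<Rightarrow> (real^2 \<Rightarrow> real^2) set" where
  "space_V \<Omega> =
     {v. (\<forall>i. (\<lambda>x. v x $ i) \<in> sobolev_H10 \<Omega>) \<and>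
         (AE x in lebesgue_on \<Omega>. trace (jacobian_weak \<Omega> v x) = 0)}"

definition Vnorm :: "(real^2) set \<Rightarrow> (real^2 \<Rightarrow> real^2) \<Rightarrow> real" where
  "Vnorm \<Omega> v = L2norm (lebesgue_on \<Omega>) (jacobian_weak \<Omega> v)"

definition dual_V :: "(real^2) set \<Rightarrow> ((real^2 \<Rightarrow> real^2) \<Rightarrow> real) set" where
  "dual_V \<Omega> =
     {l. (\<forall>v \<in> space_V \<Omega>. \<forall>w \<in> space_V \<Omega>. \<forall>a b.
            l (\<lambda>x. a *\<^sub>R v x + b *\<^sub>R w x) = a * l v + b * l w) \<and>
         (\<exists>C. \<forall>v \<in> space_V \<Omega>. \<bar>l v\<bar> \<le> C * Vnorm \<Omega> v)}"

definition dual_norm :: "(real^2) set \<Rightarrow> ((real^2 \<Rightarrow> real^2) \<Rightarrow> real) \<Rightarrow> real" where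
  "dual_norm \<Omega> l = (SUP v \<in> {v \<in> space_V \<Omega>. Vnorm \<Omega> v \<le> 1}. \<bar>l v\<bar>)"

section \<open>Bochner spaces\<close>

definition simple_on :: "real \<Rightarrow> ('z \<Rightarrow> 'c) set \<Rightarrow> (real \<Rightarrow> 'z \<Rightarrow> 'c) \<Rightarrow> bool" where
  "simple_on T X s \<longleftrightarrow>
     finite (s ` {0<..<T}) \<and> s ` {0<..<T} \<subseteq> X \<and>
     (\<forall>e. {t \<in> {0<..<T}. s t = e} \<in> sets lebesgue)"

text \<open>$L^2(0,T;X)$ for a space \<open>X\<close> of functions normed by \<open>N\<close>; the second conjunct is
  strong measurability.\<close>

definition bochner_L2 ::
    "real \<Rightarrow> ('z \<Rightarrow> 'c::real_normed_vector) set \<Rightarrow> (('z \<Rightarrow> 'c) \<Rightarrow> real) \<Rightarrow> (real \<Rightarrow> 'z \<Rightarrow> 'c) set" where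
  "bochner_L2 T X N =
     {u. (AE t in lebesgue_on {0<..<T}. u t \<in> X) \<and>
         (\<exists>s. (\<forall>n::nat. simple_on T X (s n)) \<and>
              (AE t in lebesgue_on {0<..<T}. (\<lambda>n. N (\<lambda>z. s n t z - u t z)) \<longlonglongrightarrow> 0)) \<and>
         integrable (lebesgue_on {0<..<T}) (\<lambda>t. (N (u t))\<^sup>2)}"

definition spacetime :: "(real^2) set \<Rightarrow> real \<Rightarrow> ((real^2) \<times> real) measure" where
  "spacetime \<Omega> T = lebesgue_on (\<Omega> \<times> {0<..<T})"

text \<open>Every element of $L^2(0,T;V)$ has a representative, and a representative of its spatial
  gradient, that is measurable on $\Omega_T$. Only such representatives are used, so that integrals
  over $\Omega_T$ and ``almost everywhere in $\Omega_T$'' make sense.\<close>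

definition L2V :: "(real^2) set \<Rightarrow> real \<Rightarrow> (real \<Rightarrow> real^2 \<Rightarrow> real^2) set" where
  "L2V \<Omega> T =
     {u \<in> bochner_L2 T (space_V \<Omega>) (Vnorm \<Omega>).
        (\<lambda>(x, t). u t x) \<in> borel_measurable (spacetime \<Omega> T)}"

definition L2V' :: "(real^2) set \<Rightarrow> real \<Rightarrow> (real \<Rightarrow> (real^2 \<Rightarrow> real^2) \<Rightarrow> real) set" where
  "L2V' \<Omega> T = bochner_L2 T (dual_V \<Omega>) (dual_norm \<Omega>)"

definition space_gradient ::
    "(real^2) set \<Rightarrow> real \<Rightarrow> (real \<Rightarrow> real^2 \<Rightarrow> real^2) \<Rightarrow> (real \<Rightarrow> real^2 \<Rightarrow> real^2^2) \<Rightarrow> bool" where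
  "space_gradient \<Omega> T u G \<longleftrightarrow>
     (\<lambda>(x, t). G t x) \<in> borel_measurable (spacetime \<Omega> T) \<and>
     (AE t in lebesgue_on {0<..<T}. \<forall>i. weak_gradient \<Omega> (\<lambda>x. u t x $ i) (\<lambda>x. G t x $ i))"

text \<open>The distributional derivative of $u$ as a $V'$-valued function: the identity
  $\int_0^T \theta' u \, dt = - \int_0^T \theta g \, dt$ in $V'$, evaluated at $w \in V$, where
  $h \in H$ is identified with $w \mapsto \int_\Omega h \cdot w$.\<close>

definition time_derivative ::
    "(real^2) set \<Rightarrow> real \<Rightarrow> (real \<Rightarrow> real^2 \<Rightarrow> real^2) \<Rightarrow>
      (real \<Rightarrow> (real^2 \<Rightarrow> real^2) \<Rightarrow> real) \<Rightarrow> bool" where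
  "time_derivative \<Omega> T u g \<longleftrightarrow>
     g \<in> L2V' \<Omega> T \<and>
     (\<forall>\<theta> \<in> test_functions {0<..<T}. \<forall>w \<in> space_V \<Omega>.
        (LINT t|lebesgue_on {0<..<T}. deriv \<theta> t * (LINT x|lebesgue_on \<Omega>. u t x \<bullet> w x)) =
        - (LINT t|lebesgue_on {0<..<T}. \<theta> t * g t w))"

definition E22 :: "(real^2) set \<Rightarrow> real \<Rightarrow> (real \<Rightarrow> real^2 \<Rightarrow> real^2) set" where
  "E22 \<Omega> T = {u \<in> L2V \<Omega> T. \<exists>g. time_derivative \<Omega> T u g}"

definition continuous_into_H :: "(real^2) set \<Rightarrow> real \<Rightarrow> (real \<Rightarrow> real^2 \<Rightarrow> real^2) \<Rightarrow> bool" where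
  "continuous_into_H \<Omega> T U \<longleftrightarrow>
     (\<forall>t \<in> {0..T}. U t \<in> space_H \<Omega>) \<and>
     (\<forall>s \<in> {0..T}.
        ((\<lambda>t. L2norm (lebesgue_on \<Omega>) (\<lambda>x. U t x - U s x)) \<longlongrightarrow> 0) (at s within {0..T}))"

definition initial_value ::
    "(real^2) set \<Rightarrow> real \<Rightarrow> (real \<Rightarrow> real^2 \<Rightarrow> real^2) \<Rightarrow> (real^2 \<Rightarrow> real^2) \<Rightarrow> bool" where
  "initial_value \<Omega> T u u0 \<longleftrightarrow>
     (\<exists>U. continuous_into_H \<Omega> T U \<and>
          (AE t in lebesgue_on {0<..<T}. AE x in lebesgue_on \<Omega>. U t x = u t x) \<and>
          (AE x in lebesgue_on \<Omega>. U 0 x = u0 x))"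

section \<open>Bingham fluids\<close>

definition sym_part :: "real^2^2 \<Rightarrow> real^2^2" where
  "sym_part A = (1/2) *\<^sub>R (A + transpose A)"

text \<open>The norm and inner product of the type \<open>real^2^2\<close> are $|A|$ and $A : B$. The argument \<open>G\<close> is
  $\nabla u$, so that $Du$ is \<open>sym_part (G t x)\<close>.\<close>

definition bingham_law ::
    "(real^2) set \<Rightarrow> real \<Rightarrow> real \<Rightarrow> real \<Rightarrow>
      (real \<Rightarrow> real^2 \<Rightarrow> real^2^2) \<Rightarrow> (real \<Rightarrow> real^2 \<Rightarrow> real^2^2) \<Rightarrow> bool" where
  "bingham_law \<Omega> T \<mu> \<tau>y G \<tau> \<longleftrightarrow>
     (AE (x, t) in spacetime \<Omega> T.
        (sym_part (G t x) \<noteq> 0 \<longrightarrow>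
           \<tau> t x = (2 * \<mu> + \<tau>y / norm (sym_part (G t x))) *\<^sub>R sym_part (G t x)) \<and>
        (sym_part (G t x) = 0 \<longrightarrow> norm (\<tau> t x) \<le> \<tau>y))"

text \<open>\<open>g\<close> is $\partial_t u$, \<open>G\<close> is $\nabla u$ and \<open>\<Phi>\<close> is $\nabla \varphi$; each is determined up to
  null sets.

  The convective term is an iterated integral: for $\varphi \in L^2(0,T;V)$ the function
  $(u \cdot \nabla) u \cdot \varphi$ is integrable over $\Omega$ for almost every $t$, and its
  integral over $\Omega$ is integrable over $(0,T)$, but it need not be Lebesgue integrable over
  $\Omega_T$.\<close>

definition weak_solution ::
    "(real^2) set \<Rightarrow> real \<Rightarrow> real \<Rightarrow> real \<Rightarrow> (real \<Rightarrow> (real^2 \<Rightarrow> real^2) \<Rightarrow> real) \<Rightarrow>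
      (real^2 \<Rightarrow> real^2) \<Rightarrow> (real \<Rightarrow> real^2 \<Rightarrow> real^2) \<Rightarrow> (real \<Rightarrow> real^2 \<Rightarrow> real^2^2) \<Rightarrow> bool" where
  "weak_solution \<Omega> T \<mu> \<tau>y f u0 u \<tau> \<longleftrightarrow>
     u \<in> E22 \<Omega> T \<and>
     square_integrable (spacetime \<Omega> T) (\<lambda>(x, t). \<tau> t x) \<and>
     initial_value \<Omega> T u u0 \<and>
     (\<exists>g G. time_derivative \<Omega> T u g \<and> space_gradient \<Omega> T u G \<and> bingham_law \<Omega> T \<mu> \<tau>y G \<tau> \<and>
        (\<forall>\<phi> \<Phi>. \<phi> \<in> L2V \<Omega> T \<and> space_gradient \<Omega> T \<phi> \<Phi> \<longrightarrow>
           (LINT t|lebesgue_on {0<..<T}. g t (\<phi> t))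
           + (LINT z|spacetime \<Omega> T. \<tau> (snd z) (fst z) \<bullet> sym_part (\<Phi> (snd z) (fst z)))
           + (LINT t|lebesgue_on {0<..<T}. (LINT x|lebesgue_on \<Omega>. (G t x *v u t x) \<bullet> \<phi> t x))
           = (LINT t|lebesgue_on {0<..<T}. f t (\<phi> t))))"

end

theory Submission
  imports Defs
begin

text \<open>
  The difference \<open>w = u1 - u2\<close>, cut off at a time \<open>s\<close>, is an admissible test function in both
  equations. Subtracting, the time derivatives contribute $\frac12 \|w(s)\|_H^2$; the Bingham
  law is monotone with constant $2\mu$ because its plastic part is a subgradient of
  $\tau_y |\cdot|$, so that by Korn's identity $\int |Dw|^2 = \frac12 \int |\nabla w|^2$ the stresses
  contribute at least $\mu \int_0^s \|w\|_V^2$; and the convective terms reduce to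
  $\int (w \cdot \nabla) u_1 \cdot w$, which Ladyzhenskaya's inequality
  $\|w\|_{L^4}^2 \le C \|w\|_H \|w\|_V$ bounds by
  $\mu \|w\|_V^2 + C \|u_1\|_V^2 \|w\|_H^2$. The coefficient $\|u_1\|_V^2$ is integrable in time,
  and Gronwall's lemma gives \<open>w = 0\<close>.

  The energy identity is obtained from increments: for almost every \<open>t\<close> and \<open>t + h\<close>,
  $\frac12 \|w(t+h)\|_H^2 - \frac12 \|w(t)\|_H^2
    = \int_t^{t+h} \langle \partial_t w(r), \frac12 (w(t) + w(t+h)) \rangle dr$,
  and replacing the second argument by $w(r)$ costs $o(h)$ on average over \<open>t\<close>, since translations
  are continuous in $L^2(0,T;V)$.
\<close>

section \<open>Smooth functions and test functions\<close>

lemma Ck_SucI: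
  assumes "\<And>x. (f has_derivative f' x) (at x)" "\<And>h. Ck k (\<lambda>x. f' x h)"
  shows "Ck (Suc k) f"
proof -
  have "frechet_derivative f (at x) = f' x" for x
    using frechet_derivative_at[OF assms(1)[of x]] by simp
  then show ?thesis
    using assms by (auto simp: differentiable_def)
qed

lemma Ck_Suc_has_derivative:
  "Ck (Suc k) f \<Longrightarrow> (f has_derivative frechet_derivative f (at x)) (at x)"
  by (simp add: frechet_derivative_works)

text \<open>The product rule multiplies a derivative by an undifferentiated factor; the induction
  for products needs both on the same level of differentiability.\<close>

lemma Ck_mono_Suc: "Ck (Suc k) f \<Longrightarrow> Ck k f"
proof (induction k arbitrary: f)
  case 0
  then show ?case
    by (auto intro!: continuous_at_imp_continuous_on differentiable_imp_continuous_within)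
qed auto

lemma Ck_const: "Ck k (\<lambda>_. c)"
proof (induction k arbitrary: c)
  case (Suc k)
  show ?case by (rule Ck_SucI[where f' = "\<lambda>_ _. 0"]) (auto intro: Suc)
qed auto

lemma Ck_add: "Ck k f \<Longrightarrow> Ck k g \<Longrightarrow> Ck k (\<lambda>x. f x + g x)"
proof (induction k arbitrary: f g)
  case (Suc k)
  show ?case
    by (rule Ck_SucI[OF has_derivative_add[OF Ck_Suc_has_derivative[OF Suc.prems(1)]
          Ck_Suc_has_derivative[OF Suc.prems(2)]]])
       (use Suc in auto)
qed (auto intro: continuous_intros)

lemma Ck_mult:
  fixes f g :: "'a::euclidean_space \<Rightarrow> real"
  shows "Ck k f \<Longrightarrow> Ck k g \<Longrightarrow> Ck k (\<lambda>x. f x * g x)"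
proof (induction k arbitrary: f g)
  case (Suc k)
  show ?case
    by (rule Ck_SucI[OF has_derivative_mult[OF Ck_Suc_has_derivative[OF Suc.prems(1)]
          Ck_Suc_has_derivative[OF Suc.prems(2)]]], intro Ck_add Suc.IH)
       (use Suc.prems in \<open>auto intro: Ck_mono_Suc simp del: Ck.simps(2) simp: Ck.simps(2)[THEN iffD1]\<close>)
qed (auto intro: continuous_intros)

lemma Ck_cmult:
  fixes f :: "'a::euclidean_space \<Rightarrow> real"
  shows "Ck k f \<Longrightarrow> Ck k (\<lambda>x. c * f x)"
  by (intro Ck_mult Ck_const)

lemma Ck_prod:
  fixes f :: "'i \<Rightarrow> 'a::euclidean_space \<Rightarrow> real"
  shows "(\<And>i. i \<in> I \<Longrightarrow> Ck k (f i)) \<Longrightarrow> Ck k (\<lambda>x. \<Prod>i\<in>I. f i x)"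
  by (induction I rule: infinite_finite_induct) (auto intro: Ck_const Ck_mult)

lemma Ck_translate:
  assumes "Ck k f"
  shows "Ck k (\<lambda>x. f (x + a))"
  using assms
proof (induction k arbitrary: f)
  case 0
  then show ?case by (auto intro!: continuous_intros elim: continuous_on_compose2)
next
  case (Suc k)
  have "((\<lambda>x. f (x + a)) has_derivative frechet_derivative f (at (x + a))) (at x)" for x
    by (rule has_derivative_compose[OF _ Ck_Suc_has_derivative[OF Suc.prems], of "\<lambda>x. x + a" "\<lambda>h. h"])
       (auto intro!: derivative_eq_intros)
  then show ?case
    by (rule Ck_SucI) (use Suc in auto)
qed

subsection \<open>Bump functions\<close>

text \<open>The functions p(1/s) e^(-1/s), extended by zero, form a family closed under
  differentiation. Smoothness of the single function e^(-1/s) is then an induction over the whole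
  family, with p as the varying parameter.\<close>

definition expbump :: "real poly \<Rightarrow> real \<Rightarrow> real" where
  "expbump p s = (if s > 0 then poly p (1/s) * exp (-1/s) else 0)"

text \<open>The additional factor \<open>y ^ k\<close> is for the induction on the polynomial:
  passing from p to \<open>pCons a p\<close> multiplies by y, which is absorbed by raising
  k.\<close>

lemma poly_exp_tendsto_0: "((\<lambda>y::real. y ^ k * poly p y * exp (-y)) \<longlongrightarrow> 0) at_top"
proof (induction p arbitrary: k)
  case (pCons a p)
  have "((\<lambda>y. a * (y ^ k / exp y) + y ^ Suc k * poly p y * exp (-y)) \<longlongrightarrow> a * 0 + 0) at_top"
    by (intro tendsto_intros tendsto_power_div_exp_0 pCons.IH)
  then show ?case
    by (simp add: algebra_simps exp_minus divide_inverse)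
qed simp

lemma expbump_tendsto_0: "((\<lambda>s. expbump p s) \<longlongrightarrow> 0) (at 0)"
proof -
  have "((\<lambda>s. poly p (inverse s) * exp (- inverse s)) \<longlongrightarrow> 0) (at_right (0::real))"
    using filterlim_compose[OF poly_exp_tendsto_0[of 0 p] filterlim_inverse_at_top_right] by simp
  then have "(expbump p \<longlongrightarrow> 0) (at_right 0)"
    by (rule Lim_transform_eventually)
       (auto simp: eventually_at_filter expbump_def divide_inverse)
  moreover have "(expbump p \<longlongrightarrow> 0) (at_left 0)"
    by (rule Lim_transform_eventually[of "\<lambda>_. 0"]) (auto simp: eventually_at_filter expbump_def)
  ultimately show ?thesis
    by (simp add: filterlim_at_split)
qed

text \<open>With y = 1/s the derivative of p(y) e^(-y) is y^2 (p - p')(y) e^(-y), and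
  \<open>[:0,0,1:]\<close> is the polynomial y^2. At s = 0 the difference quotient is again a member
  of the family, for the polynomial y p, and members tend to 0 there.\<close>

lemma DERIV_expbump:
  "(expbump p has_real_derivative expbump ([:0,0,1:] * (p - pderiv p)) s) (at s)"
proof (cases s "0::real" rule: linorder_cases)
  case less
  have "((\<lambda>_. 0) has_real_derivative 0) (at s)" by simp
  then have "(expbump p has_real_derivative 0) (at s)"
    by (rule has_field_derivative_transform_within_open[where S="{..<0}"])
       (use less in \<open>auto simp: expbump_def\<close>)
  then show ?thesis using less by (simp add: expbump_def)
next
  case equal
  have "((\<lambda>h. expbump ([:0,1:] * p) h) \<longlongrightarrow> 0) (at 0)"
    by (rule expbump_tendsto_0)
  then have "((\<lambda>h. (expbump p (0 + h) - expbump p 0) / h) \<longlongrightarrow> 0) (at 0)"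
    by (rule Lim_transform_eventually)
       (auto simp: eventually_at_filter expbump_def divide_inverse)
  then show ?thesis using equal by (simp add: DERIV_def expbump_def)
next
  case greater
  have "((\<lambda>s. poly p (1/s) * exp (-1/s)) has_real_derivative
      (expbump ([:0,0,1:] * (p - pderiv p)) s)) (at s)"
    using greater
    by (auto intro!: derivative_eq_intros simp: expbump_def field_simps power2_eq_square)
  then show ?thesis
    by (rule has_field_derivative_transform_within_open[where S="{0<..}"])
       (use greater in \<open>auto simp: expbump_def\<close>)
qed

lemma Ck_expbump: "Ck k (\<lambda>x::'a::euclidean_space. expbump p (c \<bullet> x + d))"
proof (induction k arbitrary: p)
  case 0
  have "continuous_on UNIV (expbump p)"
    using DERIV_expbump by (intro DERIV_continuous_on) (auto intro: has_field_derivative_at_within)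
  then show ?case
    by (auto intro!: continuous_intros elim!: continuous_on_compose2)
next
  case (Suc k)
  have "((\<lambda>x. expbump p (c \<bullet> x + d)) has_derivative
      (\<lambda>h. (c \<bullet> h) * expbump ([:0,0,1:] * (p - pderiv p)) (c \<bullet> x + d))) (at x)" for x
    unfolding mult.commute[of "c \<bullet> _"]
    by (rule has_derivative_compose[of "\<lambda>x. c \<bullet> x + d" "\<lambda>h. c \<bullet> h" x UNIV "expbump p",
        OF _ DERIV_expbump[unfolded has_field_derivative_def]]) (auto intro!: derivative_eq_intros)
  then show ?case
    by (rule Ck_SucI) (intro Ck_cmult Suc.IH)
qed

text \<open>This is e^(-1/s) for positive s. It approaches the value 1 without reaching it; sharp
  transitions are obtained by the scaling s -> n s and a limit in n.\<close>

abbreviation step :: "real \<Rightarrow> real" where "step \<equiv> expbump 1"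

lemma step_nonneg: "0 \<le> step s" and step_le_1: "step s \<le> 1" and step_eq_0: "s \<le> 0 \<Longrightarrow> step s = 0"
  by (auto simp: expbump_def)

lemma step_tendsto_1: "s > 0 \<Longrightarrow> (\<lambda>n. step (real n * s)) \<longlonglongrightarrow> 1"
proof -
  assume s: "s > 0"
  have "(\<lambda>n. exp (- (1/s) * (1 / real n))) \<longlonglongrightarrow> exp (- (1/s) * 0)"
    by (intro tendsto_intros lim_1_over_n)
  moreover have "\<forall>\<^sub>F n in sequentially. exp (- (1/s) * (1 / real n)) = step (real n * s)"
    using eventually_gt_at_top[of 0]
    by eventually_elim (use s in \<open>auto simp: expbump_def field_simps\<close>)
  ultimately show ?thesis by (auto intro: Lim_transform_eventually)
qed

text \<open>One factor for each face of the box, applied to the scaled distance to that face. The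
  result vanishes exactly outside the open box and tends to its indicator pointwise.\<close>

definition box_bump :: "'a::euclidean_space \<Rightarrow> 'a \<Rightarrow> nat \<Rightarrow> 'a \<Rightarrow> real" where
  "box_bump a b n x = (\<Prod>i\<in>Basis. step (real n * ((x - a) \<bullet> i)) * step (real n * ((b - x) \<bullet> i)))"

lemma box_bump_nonneg: "0 \<le> box_bump a b n x"
  unfolding box_bump_def by (intro prod_nonneg) (auto simp: step_nonneg)

lemma box_bump_le_1: "box_bump a b n x \<le> 1"
  unfolding box_bump_def
  by (intro prod_le_1) (auto simp: step_nonneg step_le_1 intro!: mult_le_one)

lemma box_bump_outside: "x \<notin> box a b \<Longrightarrow> box_bump a b n x = 0"
  unfolding box_bump_def mem_box
  by (auto simp: inner_diff_left not_less intro!: prod_zero step_eq_0 mult_nonneg_nonpos)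

lemma box_bump_tendsto: "(\<lambda>n. box_bump a b n x) \<longlonglongrightarrow> indicator (box a b) x"
proof (cases "x \<in> box a b")
  case True
  then have "(\<lambda>n. box_bump a b n x) \<longlonglongrightarrow> (\<Prod>i\<in>(Basis::'a set). 1 * 1)"
    unfolding box_bump_def
    by (intro tendsto_prod tendsto_mult step_tendsto_1) (auto simp: mem_box inner_diff_left)
  then show ?thesis using True by simp
qed (simp add: box_bump_outside)

lemma Ck_box_bump: "Ck k (box_bump a b n)"
proof -
  have *: "box_bump a b n = (\<lambda>x. \<Prod>i\<in>Basis. step ((real n *\<^sub>R i) \<bullet> x + - (real n * (a \<bullet> i)))
        * step ((- real n *\<^sub>R i) \<bullet> x + real n * (b \<bullet> i)))"
    unfolding box_bump_def
    by (intro ext prod.cong refl arg_cong2[where f="(*)"] arg_cong[where f=step])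
       (auto simp: algebra_simps inner_commute)
  show ?thesis unfolding * by (intro Ck_prod Ck_mult Ck_expbump)
qed

lemma box_bump_test_function:
  assumes "cbox a b \<subseteq> S"
  shows "box_bump a b n \<in> test_functions S"
proof -
  have "{x. box_bump a b n x \<noteq> 0} \<subseteq> cbox a b"
    using box_bump_outside box_subset_cbox by blast
  then have *: "closure {x. box_bump a b n x \<noteq> 0} \<subseteq> cbox a b"
    by (rule closure_minimal) (rule closed_cbox)
  have "compact (closure {x. box_bump a b n x \<noteq> 0})"
    using bounded_subset[OF bounded_cbox *] by (simp add: compact_eq_bounded_closed)
  then show ?thesis
    using * assms by (auto simp: test_functions_def Ck_box_bump)
qed

subsection \<open>Closure properties of test functions\<close>

definition dird :: "('a::euclidean_space \<Rightarrow> real) \<Rightarrow> 'a \<Rightarrow> 'a \<Rightarrow> real" where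
  "dird \<psi> h x = frechet_derivative \<psi> (at x) h"

lemma test_Ck: "\<psi> \<in> test_functions S \<Longrightarrow> Ck k \<psi>"
  by (simp add: test_functions_def)

lemma test_has_derivative:
  "\<psi> \<in> test_functions S \<Longrightarrow> (\<psi> has_derivative (\<lambda>h. dird \<psi> h x)) (at x)"
  using Ck_Suc_has_derivative[of 0 \<psi>] test_Ck[of \<psi> S "Suc 0"] unfolding dird_def by (simp add: eta_contract_eq)

lemma dirdI: "(f has_derivative f') (at x) \<Longrightarrow> dird f h x = f' h"
  unfolding dird_def using frechet_derivative_at by metis

lemma test_functionsI:
  assumes "\<And>k. Ck k \<psi>" "\<And>x. x \<notin> K \<Longrightarrow> \<psi> x = 0" "compact K" "K \<subseteq> S"
  shows "\<psi> \<in> test_functions S"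
proof -
  have *: "closure {x. \<psi> x \<noteq> 0} \<subseteq> K"
    using assms by (intro closure_minimal) (auto intro: compact_imp_closed)
  then have "compact (closure {x. \<psi> x \<noteq> 0})"
    using compact_imp_bounded[OF assms(3)] by (auto simp: compact_eq_bounded_closed intro: bounded_subset)
  then show ?thesis using * assms by (auto simp: test_functions_def)
qed

lemma test_functionsE:
  assumes "\<psi> \<in> test_functions S"
  obtains K where "compact K" "K \<subseteq> S" "\<And>x. x \<notin> K \<Longrightarrow> \<psi> x = 0"
proof (rule that[of "closure {x. \<psi> x \<noteq> 0}"])
  show "\<psi> x = 0" if "x \<notin> closure {x. \<psi> x \<noteq> 0}" for x
    using that closure_subset[of "{x. \<psi> x \<noteq> 0}"] by blast
qed (use assms in \<open>auto simp: test_functions_def\<close>)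

lemma test_outside: "\<psi> \<in> test_functions S \<Longrightarrow> x \<notin> S \<Longrightarrow> \<psi> x = 0"
  by (rule test_functionsE) auto

lemma test_mono: "\<psi> \<in> test_functions S \<Longrightarrow> S \<subseteq> S' \<Longrightarrow> \<psi> \<in> test_functions S'"
  by (auto simp: test_functions_def)

lemma test_zero: "(\<lambda>_. 0) \<in> test_functions S"
  by (rule test_functionsI[of _ "{}"]) (auto intro: Ck_const)

lemma test_add:
  assumes "\<psi> \<in> test_functions S" "\<eta> \<in> test_functions S"
  shows "(\<lambda>x. \<psi> x + \<eta> x) \<in> test_functions S"
proof -
  from assms(1) obtain K where "compact K" "K \<subseteq> S" "\<And>x. x \<notin> K \<Longrightarrow> \<psi> x = 0" by (rule test_functionsE) blast
  moreover from assms(2) obtain K' where "compact K'" "K' \<subseteq> S" "\<And>x. x \<notin> K' \<Longrightarrow> \<eta> x = 0" by (rule test_functionsE) blast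
  ultimately show ?thesis
    by (intro test_functionsI[of _ "K \<union> K'"] Ck_add) (auto intro: test_Ck[OF assms(1)] test_Ck[OF assms(2)])
qed

lemma test_Ck_mult:
  assumes "\<psi> \<in> test_functions S" "\<And>k. Ck k f"
  shows "(\<lambda>x. f x * \<psi> x) \<in> test_functions S"
proof -
  from assms(1) obtain K where "compact K" "K \<subseteq> S" "\<And>x. x \<notin> K \<Longrightarrow> \<psi> x = 0" by (rule test_functionsE) blast
  then show ?thesis
    by (intro test_functionsI[of _ K] Ck_mult) (auto intro: test_Ck[OF assms(1)] assms(2))
qed

lemma test_cmult: "\<psi> \<in> test_functions S \<Longrightarrow> (\<lambda>x. c * \<psi> x) \<in> test_functions S"
  by (intro test_Ck_mult Ck_const)

lemma test_mult:
  "\<psi> \<in> test_functions S \<Longrightarrow> \<eta> \<in> test_functions S \<Longrightarrow> (\<lambda>x. \<psi> x * \<eta> x) \<in> test_functions S"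
  by (intro test_Ck_mult test_Ck)

lemma test_translate:
  assumes "\<psi> \<in> test_functions UNIV" shows "(\<lambda>x. \<psi> (x + a)) \<in> test_functions UNIV"
proof -
  from assms obtain K where K: "compact K" "\<And>x. x \<notin> K \<Longrightarrow> \<psi> x = 0" by (rule test_functionsE) blast
  show ?thesis
  proof (rule test_functionsI[of _ "(\<lambda>x. -a + x) ` K"])
    show "\<psi> (x + a) = 0" if "x \<notin> (\<lambda>x. -a + x) ` K" for x
      using that K(2)[of "x + a"] by (force simp: image_iff)
    show "compact ((\<lambda>x. -a + x) ` K)" by (rule compact_translation[OF K(1)])
  qed (auto intro: Ck_translate test_Ck[OF assms])
qed

lemma test_dird:
  assumes "\<psi> \<in> test_functions S"
  shows "dird \<psi> h \<in> test_functions S"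
proof -
  from assms obtain K where K: "compact K" "K \<subseteq> S" "\<And>x. x \<notin> K \<Longrightarrow> \<psi> x = 0" by (rule test_functionsE) blast
  show ?thesis
  proof (rule test_functionsI[of _ K])
    show "Ck k (dird \<psi> h)" for k
      using test_Ck[OF assms, of "Suc k"] by (simp add: dird_def[abs_def])
    show "dird \<psi> h x = 0" if "x \<notin> K" for x
    proof -
      have "open (-K)" using K(1) by (simp add: compact_imp_closed open_Compl)
      have "((\<lambda>_. 0) has_derivative (\<lambda>_. 0)) (at x)" by simp
      then have "(\<psi> has_derivative (\<lambda>_. 0)) (at x)"
        by (rule has_derivative_transform_within_open[OF _ \<open>open (-K)\<close>]) (use that K in auto)
      then show ?thesis by (rule dirdI)
    qed
  qed (use K in auto)
qed

lemma dird_add: "\<psi> \<in> test_functions S \<Longrightarrow> \<eta> \<in> test_functions S \<Longrightarrow>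
    dird (\<lambda>x. \<psi> x + \<eta> x) h x = dird \<psi> h x + dird \<eta> h x"
  by (rule dirdI) (intro has_derivative_add test_has_derivative)

lemma dird_cmult: "\<psi> \<in> test_functions S \<Longrightarrow> dird (\<lambda>x. c * \<psi> x) h x = c * dird \<psi> h x"
  by (rule dirdI) (intro has_derivative_mult_right test_has_derivative)

lemma dird_mult: "\<psi> \<in> test_functions S \<Longrightarrow> \<eta> \<in> test_functions S \<Longrightarrow>
    dird (\<lambda>x. \<psi> x * \<eta> x) h x = \<psi> x * dird \<eta> h x + dird \<psi> h x * \<eta> x"
  by (rule dirdI) (intro has_derivative_mult test_has_derivative)

lemma dird_translate:
  assumes "\<psi> \<in> test_functions S"
  shows "dird (\<lambda>x. \<psi> (x + a)) h x = dird \<psi> h (x + a)"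
proof (rule dirdI)
  show "((\<lambda>x. \<psi> (x + a)) has_derivative (\<lambda>h. dird \<psi> h (x + a))) (at x)"
    by (rule has_derivative_compose[OF _ test_has_derivative[OF assms], of "\<lambda>x. x + a" "\<lambda>h. h"])
       (auto intro!: derivative_eq_intros)
qed

lemma test_continuous: "\<psi> \<in> test_functions S \<Longrightarrow> continuous_on A \<psi>"
  using test_Ck[of \<psi> S 0] by (auto intro: continuous_on_subset)

lemma test_measurable [measurable_dest]: "\<psi> \<in> test_functions S \<Longrightarrow> \<psi> \<in> borel_measurable borel"
  using test_continuous by (rule borel_measurable_continuous_onI)

lemma test_measurable_lebesgue_on: "\<psi> \<in> test_functions S \<Longrightarrow> \<psi> \<in> borel_measurable (lebesgue_on A)"
  using test_measurable[of \<psi> S]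
  by (auto intro!: measurable_restrict_space1 measurable_completion)

lemma test_bounded:
  assumes "\<psi> \<in> test_functions S"
  obtains B where "B > 0" "\<And>x. \<bar>\<psi> x\<bar> \<le> B"
proof -
  from assms obtain K where K: "compact K" "\<And>x. x \<notin> K \<Longrightarrow> \<psi> x = 0" by (rule test_functionsE) blast
  have "bounded (\<psi> ` K)"
    by (intro compact_imp_bounded compact_continuous_image test_continuous[OF assms] K)
  then obtain B where "B > 0" "\<And>x. x \<in> K \<Longrightarrow> \<bar>\<psi> x\<bar> \<le> B" by (auto simp: bounded_pos)
  then show thesis using K by (intro that[of B]) (metis abs_zero less_imp_le)+
qed

lemma test_bounded_support:
  assumes "\<psi> \<in> test_functions S"
  obtains R where "R > 0" "\<And>x. norm x > R \<Longrightarrow> \<psi> x = 0"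
proof -
  from assms obtain K where K: "compact K" "\<And>x. x \<notin> K \<Longrightarrow> \<psi> x = 0" by (rule test_functionsE) blast
  then obtain R where "R > 0" "\<And>x. x \<in> K \<Longrightarrow> norm x \<le> R" using compact_imp_bounded bounded_pos by metis
  then show thesis using K by (intro that[of R]) (auto simp: not_le[symmetric])
qed

lemma integrable_lborel_bounded_support:
  fixes f :: "'a::euclidean_space \<Rightarrow> real"
  assumes "f \<in> borel_measurable borel" "\<And>x. \<bar>f x\<bar> \<le> B" "\<And>x. norm x > R \<Longrightarrow> f x = 0"
  shows "integrable lborel f"
proof (rule Bochner_Integration.integrable_bound)
  show "integrable lborel (\<lambda>x. B * indicator (cball 0 R) x :: real)"
    by (intro integrable_mult_right integrable_real_indicator emeasure_bounded_finite) auto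
  show "AE x in lborel. norm (f x) \<le> norm (B * indicator (cball 0 R) x)"
    using assms(2,3) by (auto simp: indicator_def not_le intro: order_trans[OF _ abs_ge_self])
qed (use assms in auto)

lemma test_integrable:
  assumes "\<psi> \<in> test_functions S" shows "integrable lborel \<psi>"
proof -
  obtain B where "\<And>x. \<bar>\<psi> x\<bar> \<le> B" using test_bounded[OF assms] by metis
  moreover obtain R where "\<And>x. norm x > R \<Longrightarrow> \<psi> x = 0" using test_bounded_support[OF assms] by metis
  ultimately show ?thesis
    by (intro integrable_lborel_bounded_support test_measurable[OF assms]) auto
qed

text \<open>The bridge between the restricted, completed measures of the definitions and Borel
  measure on the whole space, where translation invariance and Fubini's theorem are
  available.\<close>

lemma integral_lebesgue_on_eq_lborel:
  fixes f :: "'a::euclidean_space \<Rightarrow> real"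
  assumes "f \<in> borel_measurable borel" "A \<in> sets lebesgue" "\<And>x. x \<notin> A \<Longrightarrow> f x = 0"
  shows "integral\<^sup>L (lebesgue_on A) f = integral\<^sup>L lborel f"
    and "integrable lborel f \<Longrightarrow> integrable (lebesgue_on A) f"
proof -
  have eq: "(\<lambda>x. indicator A x *\<^sub>R f x) = f" using assms(3) by (auto simp: indicator_def fun_eq_iff)
  show "integral\<^sup>L (lebesgue_on A) f = integral\<^sup>L lborel f"
  proof -
    have "integral\<^sup>L (lebesgue_on A) f = (LINT x|lebesgue. indicator A x *\<^sub>R f x)"
      using assms by (subst integral_restrict_space) auto
    also have "\<dots> = integral\<^sup>L lborel f"
      unfolding eq by (rule integral_completion) (use assms(1) in simp)
    finally show ?thesis .
  qed
  show "integrable (lebesgue_on A) f" if "integrable lborel f"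
  proof -
    have "integrable lebesgue (\<lambda>x. indicator A x *\<^sub>R f x)"
      unfolding eq using that assms(1) by (subst integrable_completion) simp_all
    then show ?thesis using assms by (subst integrable_restrict_space) auto
  qed
qed

section \<open>The space of square integrable functions\<close>

lemma L2_measurable: "square_integrable M f \<Longrightarrow> f \<in> borel_measurable M"
  and L2_integrable: "square_integrable M f \<Longrightarrow> integrable M (\<lambda>x. (norm (f x))\<^sup>2)"
  by (auto simp: square_integrable_def)

lemma L2norm_sq: "(L2norm M f)\<^sup>2 = (LINT x|M. (norm (f x))\<^sup>2)"
  by (simp add: L2norm_def)

lemma L2norm_nonneg: "0 \<le> L2norm M f"
  by (simp add: L2norm_def)

lemma L2_bound:
  assumes "square_integrable M f" "g \<in> borel_measurable M" "\<And>x. x \<in> space M \<Longrightarrow> norm (g x) \<le> C * norm (f x)"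
  shows "square_integrable M g"
  unfolding square_integrable_def
proof
  show "integrable M (\<lambda>x. (norm (g x))\<^sup>2)"
  proof (rule Bochner_Integration.integrable_bound[where f="\<lambda>x. C\<^sup>2 * (norm (f x))\<^sup>2"])
    show "AE x in M. norm ((norm (g x))\<^sup>2) \<le> norm (C\<^sup>2 * (norm (f x))\<^sup>2)"
      using assms(3) power_mono[OF assms(3), of _ 2] by (auto simp: power_mult_distrib)
  qed (use assms in \<open>auto simp: square_integrable_def\<close>)
qed fact

lemma L2_add:
  assumes "square_integrable M f" "square_integrable M g"
  shows "square_integrable M (\<lambda>x. f x + g x)"
  unfolding square_integrable_def
proof
  have m[measurable]: "f \<in> borel_measurable M" "g \<in> borel_measurable M"
    using assms by (auto intro: L2_measurable)
  show "(\<lambda>x. f x + g x) \<in> borel_measurable M" by simp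
  show "integrable M (\<lambda>x. (norm (f x + g x))\<^sup>2)"
  proof (rule Bochner_Integration.integrable_bound[where f="\<lambda>x. 2 * (norm (f x))\<^sup>2 + 2 * (norm (g x))\<^sup>2"])
    have "(norm (f x + g x))\<^sup>2 \<le> 2 * (norm (f x))\<^sup>2 + 2 * (norm (g x))\<^sup>2" for x
    proof -
      have "(norm (f x + g x))\<^sup>2 \<le> (norm (f x) + norm (g x))\<^sup>2"
        by (intro power_mono norm_triangle_ineq) auto
      also have "\<dots> \<le> 2 * (norm (f x))\<^sup>2 + 2 * (norm (g x))\<^sup>2"
        using sum_squares_bound[of "norm (f x)" "norm (g x)"] by (simp add: power2_sum)
      finally show ?thesis .
    qed
    then show "AE x in M. norm ((norm (f x + g x))\<^sup>2) \<le> norm (2 * (norm (f x))\<^sup>2 + 2 * (norm (g x))\<^sup>2)"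
      by simp
  qed (use assms in \<open>auto intro!: Bochner_Integration.integrable_add integrable_mult_right L2_integrable\<close>)
qed

lemma L2_scaleR: "square_integrable M f \<Longrightarrow> square_integrable M (\<lambda>x. c *\<^sub>R f x)"
  by (rule L2_bound[where C="\<bar>c\<bar>"]) (auto dest: L2_measurable)

lemma L2_cmult: "square_integrable M f \<Longrightarrow> square_integrable M (\<lambda>x. c * f x :: real)"
  using L2_scaleR[of M f c] by simp

lemma L2_diff:
  assumes "square_integrable M f" "square_integrable M g"
  shows "square_integrable M (\<lambda>x. f x - g x)"
  using L2_add[OF assms(1) L2_scaleR[OF assms(2), of "-1"]] by simp

lemma L2_zero: "square_integrable M (\<lambda>_. 0)"
  by (simp add: square_integrable_def)

lemma L2_nth: "square_integrable M f \<Longrightarrow> square_integrable M (\<lambda>x. f x $ i)"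
  by (rule L2_bound[where C=1])
     (auto intro: Finite_Cartesian_Product.norm_nth_le dest!: L2_measurable
       intro!: measurable_compose[of f M borel "\<lambda>v. v $ i" borel] borel_measurable_continuous_onI continuous_intros)

lemma L2norm_cong_AE:
  assumes "f \<in> borel_measurable M" "g \<in> borel_measurable M" "AE x in M. f x = g x"
  shows "L2norm M f = L2norm M g"
  unfolding L2norm_def using assms by (auto intro!: integral_cong_AE arg_cong[where f=sqrt])

lemma L2_mult:
  assumes "square_integrable M f" "square_integrable M g"
  shows "integrable M (\<lambda>x. norm (f x) * norm (g x))" (is ?A)
    and "(LINT x|M. norm (f x) * norm (g x)) \<le> L2norm M f * L2norm M g" (is ?B)
proof -
  have m[measurable]: "f \<in> borel_measurable M" "g \<in> borel_measurable M"
    using assms by (auto intro: L2_measurable)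
  show A: ?A
  proof (rule Bochner_Integration.integrable_bound[where f="\<lambda>x. (norm (f x))\<^sup>2 + (norm (g x))\<^sup>2"])
    show "AE x in M. norm (norm (f x) * norm (g x)) \<le> norm ((norm (f x))\<^sup>2 + (norm (g x))\<^sup>2)"
    proof (intro AE_I2)
      fix x
      have "0 \<le> norm (f x) * norm (g x)" by simp
      moreover have "2 * (norm (f x) * norm (g x)) \<le> (norm (f x))\<^sup>2 + (norm (g x))\<^sup>2"
        using sum_squares_bound[of "norm (f x)" "norm (g x)"] by simp
      ultimately show "norm (norm (f x) * norm (g x)) \<le> norm ((norm (f x))\<^sup>2 + (norm (g x))\<^sup>2)"
        using zero_le_power2[of "norm (f x)"] zero_le_power2[of "norm (g x)"] unfolding real_norm_def by linarith
    qed
  qed (use assms in \<open>auto intro: L2_integrable\<close>)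
  let ?I = "LINT x|M. norm (f x) * norm (g x)"
  have "(\<integral>\<^sup>+x. ennreal (norm (f x)) * ennreal (norm (g x)) \<partial>M)\<^sup>2
     \<le> (\<integral>\<^sup>+x. (ennreal (norm (f x)))\<^sup>2 \<partial>M) * (\<integral>\<^sup>+x. (ennreal (norm (g x)))\<^sup>2 \<partial>M)"
    by (rule Cauchy_Schwarz_nn_integral) auto
  also have "(\<integral>\<^sup>+x. ennreal (norm (f x)) * ennreal (norm (g x)) \<partial>M) = ennreal ?I"
    by (subst nn_integral_eq_integral[symmetric, OF A]) (auto simp: ennreal_mult)
  also have "(\<integral>\<^sup>+x. (ennreal (norm (f x)))\<^sup>2 \<partial>M) = ennreal ((L2norm M f)\<^sup>2)"
    unfolding L2norm_sq using assms
    by (subst nn_integral_eq_integral[symmetric]) (auto simp: ennreal_power intro: L2_integrable)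
  also have "(\<integral>\<^sup>+x. (ennreal (norm (g x)))\<^sup>2 \<partial>M) = ennreal ((L2norm M g)\<^sup>2)"
    unfolding L2norm_sq using assms
    by (subst nn_integral_eq_integral[symmetric]) (auto simp: ennreal_power intro: L2_integrable)
  finally have "?I\<^sup>2 \<le> (L2norm M f * L2norm M g)\<^sup>2"
    by (simp add: ennreal_power ennreal_mult[symmetric] power_mult_distrib)
  then show ?B
    by (rule power2_le_imp_le) (simp add: L2norm_nonneg)
qed

lemma L2_inner:
  assumes "square_integrable M f" "square_integrable M g"
  shows "integrable M (\<lambda>x. f x \<bullet> g x)" (is ?A)
    and "\<bar>LINT x|M. f x \<bullet> g x\<bar> \<le> L2norm M f * L2norm M g" (is ?B)
proof -
  have m[measurable]: "f \<in> borel_measurable M" "g \<in> borel_measurable M"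
    using assms by (auto intro: L2_measurable)
  show A: ?A
    by (rule Bochner_Integration.integrable_bound[OF L2_mult(1)[OF assms]])
       (auto simp: Cauchy_Schwarz_ineq2)
  have "\<bar>LINT x|M. f x \<bullet> g x\<bar> \<le> (LINT x|M. norm (f x \<bullet> g x))"
    by (metis integral_norm_bound real_norm_def)
  also have "\<dots> \<le> (LINT x|M. norm (f x) * norm (g x))"
    by (intro integral_mono integrable_norm A L2_mult assms) (simp add: Cauchy_Schwarz_ineq2)
  also note L2_mult(2)[OF assms]
  finally show ?B .
qed

lemma L2_mult_real:
  fixes f g :: "'a \<Rightarrow> real"
  assumes "square_integrable M f" "square_integrable M g"
  shows "integrable M (\<lambda>x. f x * g x)" and "\<bar>LINT x|M. f x * g x\<bar> \<le> L2norm M f * L2norm M g"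
  using L2_inner[OF assms] by simp_all

lemma L2norm_add_sq:
  assumes "square_integrable M f" "square_integrable M g"
  shows "(L2norm M (\<lambda>x. f x + g x))\<^sup>2 = (L2norm M f)\<^sup>2 + 2 * (LINT x|M. f x \<bullet> g x) + (L2norm M g)\<^sup>2"
proof -
  have "(LINT x|M. (norm (f x + g x))\<^sup>2) = (LINT x|M. (norm (f x))\<^sup>2 + 2 * (f x \<bullet> g x) + (norm (g x))\<^sup>2)"
    by (intro Bochner_Integration.integral_cong refl)
       (simp add: power2_norm_eq_inner inner_add_left inner_add_right inner_commute)
  then show ?thesis
    using assms by (simp add: L2norm_sq L2_integrable L2_inner)
qed

lemma L2norm_triangle:
  assumes "square_integrable M f" "square_integrable M g"
  shows "L2norm M (\<lambda>x. f x + g x) \<le> L2norm M f + L2norm M g"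
proof (rule power2_le_imp_le)
  show "(L2norm M (\<lambda>x. f x + g x))\<^sup>2 \<le> (L2norm M f + L2norm M g)\<^sup>2"
    using L2_inner(2)[OF assms] by (simp add: L2norm_add_sq[OF assms] power2_sum)
qed (simp add: L2norm_nonneg)

lemma L2norm_scaleR: "L2norm M (\<lambda>x. c *\<^sub>R f x) = \<bar>c\<bar> * L2norm M f"
  by (simp add: L2norm_def power_mult_distrib real_sqrt_mult)

lemma L2norm_diff_triangle:
  assumes "square_integrable M f" "square_integrable M g"
  shows "L2norm M (\<lambda>x. f x - g x) \<le> L2norm M f + L2norm M g"
  using L2norm_triangle[OF assms(1) L2_scaleR[OF assms(2), of "-1"]] L2norm_scaleR[of M "-1" g] by simp

lemma L2norm_minus_commute: "L2norm M (\<lambda>x. f x - g x) = L2norm M (\<lambda>x. g x - f x)"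
  by (simp add: L2norm_def norm_minus_commute)

lemma L2norm_diff_abs:
  assumes "square_integrable M f" "square_integrable M g"
  shows "\<bar>L2norm M f - L2norm M g\<bar> \<le> L2norm M (\<lambda>x. f x - g x)"
  using L2norm_triangle[OF L2_diff[OF assms] assms(2)] L2norm_triangle[OF L2_diff[OF assms(2,1)] assms(1)]
    L2norm_minus_commute[of M f g] by simp

lemma L2norm_eq_0:
  assumes "square_integrable M f" "L2norm M f = 0"
  shows "AE x in M. f x = 0"
proof -
  have "(LINT x|M. (norm (f x))\<^sup>2) = 0" using assms(2) L2norm_sq[of M f] by simp
  then have "AE x in M. (norm (f x))\<^sup>2 = 0"
    by (subst (asm) integral_nonneg_eq_0_iff_AE) (use assms in \<open>auto intro: L2_integrable\<close>)
  then show ?thesis by simp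
qed

lemma L2norm_AE_0: "AE x in M. f x = 0 \<Longrightarrow> L2norm M f = 0"
  unfolding L2norm_def
  by (subst integral_eq_zero_AE) auto

lemma L2_test:
  assumes "\<psi> \<in> test_functions S" "A \<in> sets lebesgue"
  shows "square_integrable (lebesgue_on A) \<psi>"
proof -
  obtain B where B: "\<And>x. \<bar>\<psi> x\<bar> \<le> B" using test_bounded[OF assms(1)] by metis
  have 1: "integrable lborel (\<lambda>x. \<psi> x * \<psi> x)" by (rule test_integrable[OF test_mult[OF assms(1) assms(1)]])
  then have "integrable lebesgue (\<lambda>x. \<psi> x * \<psi> x)"
    by (subst integrable_completion) (use test_measurable[OF assms(1)] in auto)
  then have "integrable (lebesgue_on A) (\<lambda>x. \<psi> x * \<psi> x)"
    using assms(2) integrable_mult_indicator[OF assms(2), of "\<lambda>x. \<psi> x * \<psi> x"]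
    by (subst integrable_restrict_space) auto
  then show ?thesis
    using test_measurable_lebesgue_on[OF assms(1)] by (simp add: square_integrable_def power2_eq_square)
qed

section \<open>Integration by parts and the fundamental lemma\<close>

lemma DERIV_test_line:
  assumes "\<psi> \<in> test_functions S"
  shows "((\<lambda>t. \<psi> (x + t *\<^sub>R e)) has_real_derivative dird \<psi> e (x + t *\<^sub>R e)) (at t)"
proof -
  have "((\<lambda>t. \<psi> (x + t *\<^sub>R e)) has_derivative (\<lambda>h. dird \<psi> (h *\<^sub>R e) (x + t *\<^sub>R e))) (at t)"
    by (rule has_derivative_compose[OF _ test_has_derivative[OF assms]])
       (auto intro!: derivative_eq_intros)
  moreover have "dird \<psi> (h *\<^sub>R e) y = dird \<psi> e y * h" for h y
    using linear_cmul[OF has_derivative_linear[OF test_has_derivative[OF assms, of y]], of h e] by simp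
  ultimately show ?thesis by (simp add: has_field_derivative_def)
qed

lemma test_lipschitz:
  assumes "\<psi> \<in> test_functions S"
  obtains B where "\<And>x t. \<bar>\<psi> (x + t *\<^sub>R e) - \<psi> x\<bar> \<le> B * \<bar>t\<bar>"
proof -
  obtain B where B: "\<And>x. \<bar>dird \<psi> e x\<bar> \<le> B" using test_bounded[OF test_dird[OF assms]] by metis
  have "\<bar>\<psi> (x + t *\<^sub>R e) - \<psi> x\<bar> \<le> B * \<bar>t\<bar>" for x t
  proof -
    have "norm (\<psi> (x + t *\<^sub>R e) - \<psi> (x + 0 *\<^sub>R e)) \<le> B * norm (t - 0)"
      by (rule field_differentiable_bound[OF convex_UNIV DERIV_test_line[OF assms, THEN has_field_derivative_at_within]])
         (use B in auto)
    then show ?thesis by simp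
  qed
  then show thesis by (rule that)
qed

text \<open>Dominated convergence. The steps have absolute value at most 1, so all quotients vanish
  outside one ball of radius \<open>R + norm e\<close>; on it f is bounded, and the quotients are
  bounded by the Lipschitz constant of the test function along e.\<close>

lemma difference_quotient_tendsto:
  fixes \<psi> :: "'a::euclidean_space \<Rightarrow> real"
  assumes \<psi>: "\<psi> \<in> test_functions UNIV" and f: "continuous_on UNIV f"
    and t: "t \<longlonglongrightarrow> 0" "\<And>n. t n \<noteq> 0" "\<And>n. \<bar>t n\<bar> \<le> 1"
  shows "(\<lambda>n. LINT x|lborel. (\<psi> (x + t n *\<^sub>R e) - \<psi> x) / t n * f x) \<longlonglongrightarrow> (LINT x|lborel. dird \<psi> e x * f x)"
proof -
  obtain B where B: "\<And>x t. \<bar>\<psi> (x + t *\<^sub>R e) - \<psi> x\<bar> \<le> B * \<bar>t\<bar>" using test_lipschitz[OF \<psi>] by metis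
  obtain R where R: "\<And>x. norm x > R \<Longrightarrow> \<psi> x = 0" using test_bounded_support[OF \<psi>] by metis
  have "bounded (f ` cball 0 (R + norm e))"
    by (intro compact_imp_bounded compact_continuous_image continuous_on_subset[OF f]) auto
  then obtain C where "\<forall>y\<in>f ` cball 0 (R + norm e). norm y \<le> C" unfolding bounded_iff by blast
  then have C: "\<bar>f x\<bar> \<le> C" if "norm x \<le> R + norm e" for x using that by simp
  have mf[measurable]: "f \<in> borel_measurable borel" by (rule borel_measurable_continuous_onI[OF f])
  note [measurable] = test_measurable[OF \<psi>] test_measurable[OF test_dird[OF \<psi>]]
  have zero: "\<psi> (x + t n *\<^sub>R e) - \<psi> x = 0" if "norm x > R + norm e" for x n
  proof -
    have "norm (t n *\<^sub>R e) \<le> norm e" using t(3)[of n] by (simp add: mult_left_le_one_le)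
    then have "norm (x + t n *\<^sub>R e) > R" using that norm_triangle_ineq[of "x + t n *\<^sub>R e" "- (t n *\<^sub>R e)"] by simp
    moreover have "norm x > R" using that norm_ge_zero[of e] by linarith
    ultimately show ?thesis using R by simp
  qed
  show ?thesis
  proof (rule integral_dominated_convergence[where w="\<lambda>x. B * C * indicator (cball 0 (R + norm e)) x"])
    show "integrable lborel (\<lambda>x. B * C * indicator (cball 0 (R + norm e)) x :: real)"
      by (intro integrable_mult_right integrable_real_indicator emeasure_bounded_finite) auto
    show "AE x in lborel. (\<lambda>n. (\<psi> (x + t n *\<^sub>R e) - \<psi> x) / t n * f x) \<longlonglongrightarrow> dird \<psi> e x * f x"
    proof (intro AE_I2 tendsto_mult tendsto_const)
      fix x
      have "((\<lambda>h. (\<psi> (x + h *\<^sub>R e) - \<psi> x) / h) \<longlongrightarrow> dird \<psi> e x) (at 0)"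
        using DERIV_test_line[OF \<psi>, of x e 0] by (simp add: DERIV_def)
      moreover have "filterlim t (at 0) sequentially"
        using t by (simp add: filterlim_at)
      ultimately show "(\<lambda>n. (\<psi> (x + t n *\<^sub>R e) - \<psi> x) / t n) \<longlonglongrightarrow> dird \<psi> e x"
        by (rule filterlim_compose)
    qed
    show "AE x in lborel. norm ((\<psi> (x + t n *\<^sub>R e) - \<psi> x) / t n * f x)
        \<le> B * C * indicator (cball 0 (R + norm e)) x" for n
    proof (intro AE_I2)
      fix x
      have "\<bar>\<psi> (x + t n *\<^sub>R e) - \<psi> x\<bar> / \<bar>t n\<bar> \<le> B"
        using B[of x "t n"] t(2)[of n] by (simp add: divide_le_eq)
      then have "\<bar>\<psi> (x + t n *\<^sub>R e) - \<psi> x\<bar> / \<bar>t n\<bar> * \<bar>f x\<bar> \<le> B * C" if "norm x \<le> R + norm e"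
        using C[OF that] by (intro mult_mono) (auto intro: order_trans[of 0 "\<bar>\<psi> (x + t n *\<^sub>R e) - \<psi> x\<bar> / \<bar>t n\<bar>"])
      then show "norm ((\<psi> (x + t n *\<^sub>R e) - \<psi> x) / t n * f x) \<le> B * C * indicator (cball 0 (R + norm e)) x"
        using zero[of x n] by (auto simp: abs_mult indicator_def not_le)
    qed
  qed measurable
qed

lemma integral_lborel_translate:
  fixes f :: "'a::euclidean_space \<Rightarrow> real"
  assumes "f \<in> borel_measurable borel"
  shows "(LINT x|lborel. f (x + a)) = (LINT x|lborel. f x)"
proof -
  have "(LINT x|lborel. f x) = (LINT x|distr lborel borel ((+) a). f x)"
    by (simp add: lborel_distr_plus)
  also have "\<dots> = (LINT x|lborel. f (a + x))"
    using assms by (subst integral_distr) auto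
  finally show ?thesis by (simp add: add.commute)
qed

text \<open>By translation invariance every difference quotient has integral zero, and the
  derivative is the limit of these quotients.\<close>

lemma integral_dird_zero:
  fixes \<psi> :: "'a::euclidean_space \<Rightarrow> real"
  assumes \<psi>: "\<psi> \<in> test_functions UNIV"
  shows "(LINT x|lborel. dird \<psi> e x) = 0"
proof -
  let ?t = "\<lambda>n. inverse (real (Suc n))"
  have "(\<lambda>n. LINT x|lborel. (\<psi> (x + ?t n *\<^sub>R e) - \<psi> x) / ?t n * 1) \<longlonglongrightarrow> (LINT x|lborel. dird \<psi> e x * 1)"
    by (rule difference_quotient_tendsto[OF \<psi> _ LIMSEQ_inverse_real_of_nat]) (auto simp: field_simps)
  moreover have "(LINT x|lborel. (\<psi> (x + ?t n *\<^sub>R e) - \<psi> x) / ?t n * 1) = 0" for n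
    using integral_lborel_translate[OF test_measurable[OF \<psi>], of "?t n *\<^sub>R e"]
      test_integrable[OF \<psi>] test_integrable[OF test_translate[OF \<psi>], of "?t n *\<^sub>R e"] by simp
  ultimately show ?thesis by (simp add: LIMSEQ_const_iff)
qed

text \<open>The product of the two test functions is a test function, so its directional derivative
  has integral zero.\<close>

lemma integral_by_parts_test:
  fixes \<psi> :: "'a::euclidean_space \<Rightarrow> real"
  assumes "\<psi> \<in> test_functions UNIV" "\<eta> \<in> test_functions UNIV"
  shows "(LINT x|lborel. \<psi> x * dird \<eta> e x) = - (LINT x|lborel. dird \<psi> e x * \<eta> x)"
proof -
  have "(LINT x|lborel. \<psi> x * dird \<eta> e x + dird \<psi> e x * \<eta> x) = 0"
    using integral_dird_zero[OF test_mult[OF assms], of e] by (simp add: dird_mult[OF assms])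
  moreover have "integrable lborel (\<lambda>x. \<psi> x * dird \<eta> e x)" "integrable lborel (\<lambda>x. dird \<psi> e x * \<eta> x)"
    using assms by (auto intro: test_integrable test_mult test_dird)
  ultimately show ?thesis by simp
qed

text \<open>Difference quotients in one of the two directions replace the symmetry of second
  derivatives.\<close>

lemma integral_dird_swap:
  fixes \<psi> :: "'a::euclidean_space \<Rightarrow> real"
  assumes \<psi>: "\<psi> \<in> test_functions UNIV" and \<eta>: "\<eta> \<in> test_functions UNIV"
  shows "(LINT x|lborel. dird \<psi> a x * dird \<eta> b x) = (LINT x|lborel. dird \<eta> a x * dird \<psi> b x)"
proof -
  let ?t = "\<lambda>n. inverse (real (Suc n))"
  have t: "?t \<longlonglongrightarrow> 0" "?t n \<noteq> 0" "\<bar>?t n\<bar> \<le> 1" "- ?t n \<noteq> 0" "\<bar>- ?t n\<bar> \<le> 1" for n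
    using LIMSEQ_inverse_real_of_nat by (auto simp: field_simps)
  have t': "(\<lambda>n. - ?t n) \<longlonglongrightarrow> 0" using tendsto_minus[OF t(1)] by simp
  have d: "dird \<psi> b \<in> test_functions UNIV" "dird \<eta> b \<in> test_functions UNIV"
    using \<psi> \<eta> by (auto intro: test_dird)
  have 1: "(\<lambda>n. LINT x|lborel. (\<psi> (x + ?t n *\<^sub>R a) - \<psi> x) / ?t n * dird \<eta> b x)
      \<longlonglongrightarrow> (LINT x|lborel. dird \<psi> a x * dird \<eta> b x)"
    by (rule difference_quotient_tendsto[OF \<psi> test_continuous[OF d(2)] t(1-3)])
  have 2: "(\<lambda>n. LINT x|lborel. (\<eta> (x + (- ?t n) *\<^sub>R a) - \<eta> x) / (- ?t n) * dird \<psi> b x)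
      \<longlonglongrightarrow> (LINT x|lborel. dird \<eta> a x * dird \<psi> b x)"
    by (rule difference_quotient_tendsto[OF \<eta> test_continuous[OF d(1)] t' t(4,5)])
  have "(LINT x|lborel. (\<psi> (x + s *\<^sub>R a) - \<psi> x) / s * dird \<eta> b x)
      = (LINT x|lborel. (\<eta> (x + (- s) *\<^sub>R a) - \<eta> x) / (- s) * dird \<psi> b x)" (is "?L = ?R") for s
  proof -
    note s\<psi> = test_translate[OF \<psi>, of "s *\<^sub>R a"]
    note s\<eta> = test_translate[OF \<eta>, of "(-s) *\<^sub>R a"]
    note m[measurable] = test_measurable[OF \<psi>] test_measurable[OF \<eta>] test_measurable[OF d(1)] test_measurable[OF d(2)]
    have i: "integrable lborel (\<lambda>x. \<psi> (x + s *\<^sub>R a) * dird \<eta> b x)" "integrable lborel (\<lambda>x. \<psi> x * dird \<eta> b x)"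
      "integrable lborel (\<lambda>x. \<eta> (x + (-s) *\<^sub>R a) * dird \<psi> b x)" "integrable lborel (\<lambda>x. \<eta> x * dird \<psi> b x)"
      by (intro test_integrable[where S=UNIV] test_mult \<psi> \<eta> d s\<psi> s\<eta>)+
    \<comment> \<open>The shift by s a is moved to the other factor by a change of variables. There
      it commutes with the derivative in direction b, which is then moved across by integration by
      parts.\<close>
    have "(LINT x|lborel. \<psi> (x + s *\<^sub>R a) * dird \<eta> b x) = (LINT x|lborel. \<psi> x * dird \<eta> b (x + (-s) *\<^sub>R a))"
      using integral_lborel_translate[of "\<lambda>x. \<psi> x * dird \<eta> b (x + (-s) *\<^sub>R a)" "s *\<^sub>R a"] by simp
    also have "\<dots> = (LINT x|lborel. \<psi> x * dird (\<lambda>x. \<eta> (x + (-s) *\<^sub>R a)) b x)"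
      by (simp only: dird_translate[OF \<eta>])
    also have "\<dots> = - (LINT x|lborel. dird \<psi> b x * \<eta> (x + (-s) *\<^sub>R a))"
      by (rule integral_by_parts_test[OF \<psi> s\<eta>])
    finally have A: "(LINT x|lborel. \<psi> (x + s *\<^sub>R a) * dird \<eta> b x) = - (LINT x|lborel. \<eta> (x + (-s) *\<^sub>R a) * dird \<psi> b x)"
      by (simp add: mult.commute)
    have B: "(LINT x|lborel. \<psi> x * dird \<eta> b x) = - (LINT x|lborel. \<eta> x * dird \<psi> b x)"
      using integral_by_parts_test[OF \<psi> \<eta>, of b] by (simp add: mult.commute)
    have "?L = (LINT x|lborel. (\<psi> (x + s *\<^sub>R a) * dird \<eta> b x - \<psi> x * dird \<eta> b x) / s)"
      by (intro Bochner_Integration.integral_cong refl) (simp add: field_simps)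
    also have "\<dots> = (- (LINT x|lborel. \<eta> (x + (-s) *\<^sub>R a) * dird \<psi> b x) + (LINT x|lborel. \<eta> x * dird \<psi> b x)) / s"
      using i A B by simp
    also have "\<dots> = (LINT x|lborel. (\<eta> (x + (-s) *\<^sub>R a) * dird \<psi> b x - \<eta> x * dird \<psi> b x) / (-s))"
      using i minus_divide_left[of "(LINT x|lborel. \<eta> (x + (-s) *\<^sub>R a) * dird \<psi> b x) - (LINT x|lborel. \<eta> x * dird \<psi> b x)" s]
      by simp
    also have "\<dots> = ?R"
      by (intro Bochner_Integration.integral_cong refl) (simp add: field_simps)
    finally show ?thesis .
  qed
  with 1 have "(\<lambda>n. LINT x|lborel. (\<eta> (x + (- ?t n) *\<^sub>R a) - \<eta> x) / (- ?t n) * dird \<psi> b x)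
      \<longlonglongrightarrow> (LINT x|lborel. dird \<psi> a x * dird \<eta> b x)" by simp
  with 2 show ?thesis by (rule LIMSEQ_unique[rotated])
qed

text \<open>The positive and negative parts of h are densities of two measures that agree on boxes,
  an intersection-stable generator of the Borel sets. The measures coincide, hence so do the
  densities almost everywhere, and h = 0 where the two parts are equal.\<close>

lemma AE_zero_if_box_integrals_zero:
  fixes h :: "'a::euclidean_space \<Rightarrow> real"
  assumes h: "integrable lborel h" and z: "\<And>a b. (LINT x|lborel. indicator (box a b) x * h x) = 0"
  shows "AE x in lborel. h x = 0"
proof -
  note [measurable] = borel_measurable_integrable[OF h]
  let ?p = "\<lambda>x. ennreal (max 0 (h x))" and ?n = "\<lambda>x. ennreal (max 0 (- h x))"
  have ip: "integrable lborel (\<lambda>x. indicator A x * max 0 (h x))" and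
    im: "integrable lborel (\<lambda>x. indicator A x * max 0 (- h x))" if "A \<in> sets borel" for A
  proof -
    have [measurable]: "A \<in> sets borel" by fact
    show "integrable lborel (\<lambda>x. indicator A x * max 0 (h x))"
      by (rule Bochner_Integration.integrable_bound[OF h]) (auto simp: indicator_def intro!: AE_I2)
    show "integrable lborel (\<lambda>x. indicator A x * max 0 (- h x))"
      by (rule Bochner_Integration.integrable_bound[OF h]) (auto simp: indicator_def intro!: AE_I2)
  qed
  have e: "emeasure (density lborel ?p) A = ennreal (LINT x|lborel. indicator A x * max 0 (h x))"
    "emeasure (density lborel ?n) A = ennreal (LINT x|lborel. indicator A x * max 0 (- h x))"
    if "A \<in> sets borel" for A
  proof -
    show "emeasure (density lborel ?p) A = ennreal (LINT x|lborel. indicator A x * max 0 (h x))"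
      using that
      by (subst nn_integral_eq_integral[OF ip, symmetric])
         (auto simp: emeasure_density ennreal_mult ennreal_indicator mult.commute)
    show "emeasure (density lborel ?n) A = ennreal (LINT x|lborel. indicator A x * max 0 (- h x))"
      using that
      by (subst nn_integral_eq_integral[OF im, symmetric])
         (auto simp: emeasure_density ennreal_mult ennreal_indicator mult.commute)
  qed
  have "density lborel ?p = density lborel ?n"
  proof (rule measure_eqI_generator_eq)
    let ?E = "range (\<lambda>(a, b). box a b::'a set)"
    show "Int_stable ?E" by (auto simp: Int_stable_def box_Int_box)
    show "?E \<subseteq> Pow UNIV" by simp
    show "sets (density lborel ?p) = sigma_sets UNIV ?E" "sets (density lborel ?n) = sigma_sets UNIV ?E"
      by (simp_all add: borel_eq_box)
    let ?A = "\<lambda>n::nat. box (- (real n *\<^sub>R One)) (real n *\<^sub>R One) :: 'a set"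
    show "range ?A \<subseteq> ?E" "(\<Union>i. ?A i) = UNIV"
      unfolding UN_box_eq_UNIV by auto
    show "emeasure (density lborel ?p) (?A i) \<noteq> \<infinity>" for i by (simp add: e)
    fix X assume "X \<in> ?E"
    then obtain a b where X: "X = box a b" by auto
    have "(LINT x|lborel. indicator X x * max 0 (h x)) - (LINT x|lborel. indicator X x * max 0 (- h x))
        = (LINT x|lborel. indicator X x * max 0 (h x) - indicator X x * max 0 (- h x))"
      using ip[of X] im[of X] X by simp
    also have "\<dots> = (LINT x|lborel. indicator X x * h x)"
      by (intro Bochner_Integration.integral_cong refl) (auto simp: indicator_def)
    also have "\<dots> = 0" using z X by simp
    finally show "emeasure (density lborel ?p) X = emeasure (density lborel ?n) X"
      using X by (simp add: e)
  qed
  then have "AE x in lborel. ?p x = ?n x"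
    by (intro sigma_finite_measure.density_unique_iff[OF sigma_finite_lborel, THEN iffD1]) simp_all
  then show ?thesis
  proof eventually_elim
    fix x assume "?p x = ?n x"
    then have "max 0 (h x) = max 0 (- h x)" by (subst (asm) ennreal_inj) auto
    then show "h x = 0" by linarith
  qed
qed

lemma lebesgue_on_borel_representative:
  fixes f :: "'a::euclidean_space \<Rightarrow> real"
  assumes "f \<in> borel_measurable (lebesgue_on A)" "A \<in> sets lebesgue"
  obtains f' where "f' \<in> borel_measurable borel" "AE x in lborel. indicator A x * f x = f' x"
proof -
  have "(\<lambda>x. indicator A x * f x) \<in> borel_measurable lebesgue"
    using assms by (subst (asm) borel_measurable_restrict_space_iff) auto
  then show thesis
    using completion_ex_borel_measurable_real[of "\<lambda>x. indicator A x * f x" lborel] that by auto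
qed

text \<open>Box bumps tend to box indicators, so a Borel representative F has integral zero over
  every box whose closure lies in the domain, and vanishes almost everywhere in each such box.
  Countably many closed boxes cover the domain, and their boundaries are null sets.\<close>

lemma fundamental_lemma:
  fixes f :: "'a::euclidean_space \<Rightarrow> real"
  assumes "open \<Omega>" and f: "integrable (lebesgue_on \<Omega>) f"
    and z: "\<And>\<psi>. \<psi> \<in> test_functions \<Omega> \<Longrightarrow> (LINT x|lebesgue_on \<Omega>. f x * \<psi> x) = 0"
  shows "AE x in lebesgue_on \<Omega>. f x = 0"
proof -
  have \<Omega>: "\<Omega> \<in> sets lebesgue" "\<Omega> \<in> sets borel" using \<open>open \<Omega>\<close> by auto
  have mf: "f \<in> borel_measurable (lebesgue_on \<Omega>)" using f by auto
  obtain F where F[measurable]: "F \<in> borel_measurable borel" "AE x in lborel. indicator \<Omega> x * f x = F x"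
    using lebesgue_on_borel_representative[OF mf \<Omega>(1)] by metis
  have F': "AE x in lebesgue. indicator \<Omega> x * f x = F x" using F(2) by (rule AE_completion)
  have iL: "integrable lebesgue (\<lambda>x. indicator \<Omega> x * f x)"
    using f \<Omega> by (subst (asm) integrable_restrict_space) auto
  have mL: "(\<lambda>x. indicator \<Omega> x * f x) \<in> borel_measurable lebesgue" using iL by auto
  have mFL: "F \<in> borel_measurable lebesgue" using F(1) by (simp add: measurable_completion)
  have iF: "integrable lborel F"
    using iL F' mL mFL integrable_cong_AE[OF mL mFL F'] by (simp add: integrable_completion)
  have zF: "(LINT x|lborel. F x * \<psi> x) = 0" if \<psi>: "\<psi> \<in> test_functions \<Omega>" for \<psi>
  proof -
    have m: "\<psi> \<in> borel_measurable borel" using \<psi> by (rule test_measurable)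
    have ml: "\<psi> \<in> borel_measurable lebesgue" using m by (simp add: measurable_completion)
    have "(LINT x|lborel. F x * \<psi> x) = (LINT x|lebesgue. F x * \<psi> x)"
      using m by (subst integral_completion) auto
    also have "\<dots> = (LINT x|lebesgue. indicator \<Omega> x * f x * \<psi> x)"
      by (rule integral_cong_AE) (use mFL mL ml F' in auto)
    also have "\<dots> = (LINT x|lebesgue_on \<Omega>. f x * \<psi> x)"
      using \<Omega> by (subst integral_restrict_space) (auto simp: mult.assoc)
    finally show ?thesis using z[OF \<psi>] by simp
  qed
  have zB: "(LINT x|lborel. F x * indicator (box a b) x) = 0" if "cbox a b \<subseteq> \<Omega>" for a b
  proof -
    note [measurable] = test_measurable[OF box_bump_test_function[OF that]]
    have "(\<lambda>n. LINT x|lborel. F x * box_bump a b n x) \<longlonglongrightarrow> (LINT x|lborel. F x * indicator (box a b) x)"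
    proof (rule integral_dominated_convergence[where w="\<lambda>x. norm (F x)"])
      show "AE x in lborel. (\<lambda>n. F x * box_bump a b n x) \<longlonglongrightarrow> F x * indicator (box a b) x"
        by (intro AE_I2 tendsto_intros box_bump_tendsto)
      show "AE x in lborel. norm (F x * box_bump a b n x) \<le> norm (F x)" for n
      proof (intro AE_I2)
        fix x
        have "\<bar>box_bump a b n x\<bar> \<le> 1" using box_bump_nonneg[of a b n x] box_bump_le_1[of a b n x] by simp
        then show "norm (F x * box_bump a b n x) \<le> norm (F x)"
          by (simp add: abs_mult mult_left_le)
      qed
    qed (use iF in auto)
    moreover have "(LINT x|lborel. F x * box_bump a b n x) = 0" for n
      by (rule zF[OF box_bump_test_function[OF that]])
    ultimately show ?thesis by (simp add: LIMSEQ_const_iff)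
  qed
  have AEB: "AE x in lborel. x \<in> box c d \<longrightarrow> F x = 0" if cd: "cbox c d \<subseteq> \<Omega>" for c d
  proof -
    have "AE x in lborel. indicator (box c d) x * F x = 0"
    proof (rule AE_zero_if_box_integrals_zero)
      show "integrable lborel (\<lambda>x. indicator (box c d) x * F x)"
        using integrable_real_mult_indicator[OF _ iF, of "box c d"] by (simp add: mult.commute)
      fix a b
      obtain p q where pq: "box a b \<inter> box c d = box p q" unfolding box_Int_box by blast
      have "(LINT x|lborel. indicator (box a b) x * (indicator (box c d) x * F x))
          = (LINT x|lborel. F x * indicator (box p q) x)"
        by (intro Bochner_Integration.integral_cong refl) (auto simp: pq[symmetric] indicator_def)
      also have "\<dots> = 0"
      \<comment> \<open>\<open>zB\<close> asks for the closed box to lie in the domain. For a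
        nonempty open box the closed one is its closure; for an empty one the corners say nothing,
        but then the integral is trivially zero.\<close>
      proof (cases "box p q = {}")
        case False
        then have "cbox p q = closure (box p q)" by (simp add: closure_box)
        also have "\<dots> \<subseteq> cbox c d"
          by (rule closure_minimal) (use pq box_subset_cbox in auto)
        finally show ?thesis using cd by (intro zB) auto
      qed simp
      finally show "(LINT x|lborel. indicator (box a b) x * (indicator (box c d) x * F x)) = 0" .
    qed
    then show ?thesis by eventually_elim (auto simp: indicator_def split: if_splits)
  qed
  obtain \<D> :: "'a set set" where D: "countable \<D>" "\<And>X. X \<in> \<D> \<Longrightarrow> X \<subseteq> \<Omega>" "\<And>X. X \<in> \<D> \<Longrightarrow> \<exists>a b. X = cbox a b" "\<Union>\<D> = \<Omega>"
    by (rule open_countable_Union_open_cbox[OF \<open>open \<Omega>\<close>]) (auto simp: subset_Pow_Union subset_iff)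
  have "AE x in lborel. \<forall>X\<in>\<D>. x \<in> X \<longrightarrow> F x = 0"
  proof (subst AE_ball_countable[OF D(1)], rule ballI)
    fix X assume X: "X \<in> \<D>"
    then obtain a b where ab: "X = cbox a b" using D(3) by blast
    have "cbox a b - box a b \<in> null_sets lborel"
      using negligible_frontier_interval[of a b] by (simp add: negligible_iff_null_sets null_sets_completion_iff)
    then have "AE x in lborel. x \<notin> cbox a b - box a b" by (rule AE_not_in)
    moreover have "AE x in lborel. x \<in> box a b \<longrightarrow> F x = 0" using D(2)[OF X] ab by (intro AEB) auto
    ultimately show "AE x in lborel. x \<in> X \<longrightarrow> F x = 0" by eventually_elim (auto simp: ab)
  qed
  then have "AE x in lborel. x \<in> \<Omega> \<longrightarrow> F x = 0" by eventually_elim (use D(4) in auto)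
  then have "AE x in lebesgue. x \<in> \<Omega> \<longrightarrow> F x = 0" by (rule AE_completion)
  with F' have "AE x in lebesgue. x \<in> \<Omega> \<longrightarrow> f x = 0" by eventually_elim auto
  then show ?thesis using \<Omega> by (simp add: AE_restrict_space_iff)
qed

section \<open>Weak gradients and $H^1_0$\<close>

definition cgrad :: "(real^2 \<Rightarrow> real) \<Rightarrow> real^2 \<Rightarrow> real^2" where
  "cgrad \<psi> x = (\<chi> j. dird \<psi> (axis j 1) x)"

lemma squeeze_0:
  fixes f :: "nat \<Rightarrow> real"
  assumes "\<And>n. 0 \<le> f n" "\<And>n. f n \<le> g n" "g \<longlonglongrightarrow> 0"
  shows "f \<longlonglongrightarrow> 0"
  by (rule tendsto_sandwich[OF always_eventually always_eventually tendsto_const assms(3)]) (use assms in auto)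

lemma norm_sq_vec2: "(norm (v::real^2))\<^sup>2 = (v$1)\<^sup>2 + (v$2)\<^sup>2"
  unfolding power2_norm_eq_inner by (simp add: inner_vec_def sum_2 power2_eq_square)

lemma norm_sq_mat2: "(norm (A::real^2^2))\<^sup>2 = (norm (A$1))\<^sup>2 + (norm (A$2))\<^sup>2"
  by (simp add: power2_norm_eq_inner inner_vec_def[of A A] sum_2)

lemma borel_measurable_vec_nth [measurable (raw)]:
  fixes f :: "'a \<Rightarrow> 'b::euclidean_space^'n"
  shows "f \<in> borel_measurable M \<Longrightarrow> (\<lambda>x. f x $ i) \<in> borel_measurable M"
  by (rule measurable_compose[of f M borel "\<lambda>v. v $ i" borel])
     (auto intro!: borel_measurable_continuous_onI continuous_intros)

lemma borel_measurable_vec_lambda [measurable (raw)]: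
  fixes f :: "'n::finite \<Rightarrow> 'a \<Rightarrow> 'b::euclidean_space"
  assumes "\<And>i. f i \<in> borel_measurable M"
  shows "(\<lambda>x. \<chi> i. f i x) \<in> borel_measurable M"
proof -
  have eq: "(\<chi> i. f i x) = (\<Sum>i\<in>UNIV. axis i (f i x))" for x
    by (simp add: vec_eq_iff axis_def sum.delta if_distrib cong: if_cong)
  have "(\<lambda>v::'b. axis i v :: 'b^'n) \<in> borel_measurable borel" for i
  proof (intro borel_measurable_continuous_onI linear_continuous_on)
    show "bounded_linear (\<lambda>v::'b. axis i v :: 'b^'n)"
      by (rule linear_linear[THEN iffD2]) (auto intro!: linearI simp: axis_def vec_eq_iff)
  qed
  then show ?thesis unfolding eq
    by (intro borel_measurable_sum measurable_compose[OF assms]) auto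
qed

lemma L2_vec:
  assumes "\<And>i. square_integrable M (\<lambda>x. f x $ i)" "f \<in> borel_measurable M"
  shows "square_integrable M (f :: 'a \<Rightarrow> 'b::euclidean_space^2)"
proof -
  have "(norm (f x))\<^sup>2 = (norm (f x $ 1))\<^sup>2 + (norm (f x $ 2))\<^sup>2" for x
    by (simp add: power2_norm_eq_inner inner_vec_def[of "f x"] sum_2)
  then show ?thesis
    using assms(2) L2_integrable[OF assms(1)] by (simp add: square_integrable_def)
qed

lemma L2norm_nth_le:
  assumes "square_integrable M (f :: 'a \<Rightarrow> 'b::euclidean_space^'n)"
  shows "L2norm M (\<lambda>x. f x $ i) \<le> L2norm M f"
  unfolding L2norm_def
  by (intro real_sqrt_le_mono integral_mono L2_integrable assms L2_nth power_mono
      Finite_Cartesian_Product.norm_nth_le) simp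

text \<open>The error is split into one term with f - fs n against ks n and one with f against k -
  ks n; the norms of ks n stay bounded by that of k plus the error.\<close>

lemma L2norm_convergent_bilinear:
  fixes f k :: "'a \<Rightarrow> 'b::euclidean_space"
  assumes "\<And>n. square_integrable M (fs n)" "\<And>n. square_integrable M (ks n)"
    and f: "square_integrable M f" and k: "square_integrable M k"
    and lf: "(\<lambda>n. L2norm M (\<lambda>x. f x - fs n x)) \<longlonglongrightarrow> 0" and lk: "(\<lambda>n. L2norm M (\<lambda>x. k x - ks n x)) \<longlonglongrightarrow> 0"
  shows "(\<lambda>n. LINT x|M. fs n x \<bullet> ks n x) \<longlonglongrightarrow> (LINT x|M. f x \<bullet> k x)"
proof -
  define d e where "d n = L2norm M (\<lambda>x. f x - fs n x)" and "e n = L2norm M (\<lambda>x. k x - ks n x)" for n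
  have 1: "norm ((LINT x|M. fs n x \<bullet> ks n x) - (LINT x|M. f x \<bullet> k x))
      \<le> d n * (L2norm M k + e n) + L2norm M f * e n" for n
  proof -
    have df: "square_integrable M (\<lambda>x. f x - fs n x)" and dk: "square_integrable M (\<lambda>x. k x - ks n x)"
      by (intro L2_diff assms)+
    have "(LINT x|M. fs n x \<bullet> ks n x) - (LINT x|M. f x \<bullet> k x)
        = - (LINT x|M. (f x - fs n x) \<bullet> ks n x) - (LINT x|M. f x \<bullet> (k x - ks n x))"
      using assms by (simp add: inner_diff_left inner_diff_right L2_inner)
    moreover have "L2norm M (ks n) \<le> L2norm M k + e n"
      using L2norm_diff_triangle[OF k dk] by (simp add: e_def)
    then have "\<bar>LINT x|M. (f x - fs n x) \<bullet> ks n x\<bar> \<le> d n * (L2norm M k + e n)"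
      using L2_inner(2)[OF df assms(2)[of n]] unfolding d_def
      by (meson L2norm_nonneg mult_left_mono order_trans)
    moreover have "\<bar>LINT x|M. f x \<bullet> (k x - ks n x)\<bar> \<le> L2norm M f * e n"
      using L2_inner(2)[OF f dk] by (simp add: e_def)
    ultimately show ?thesis unfolding real_norm_def by linarith
  qed
  have "(\<lambda>n. d n * (L2norm M k + e n) + L2norm M f * e n) \<longlonglongrightarrow> 0 * (L2norm M k + 0) + L2norm M f * 0"
    using lf lk unfolding d_def[symmetric] e_def[symmetric] by (intro tendsto_intros)
  then have 2: "(\<lambda>n. d n * (L2norm M k + e n) + L2norm M f * e n) \<longlonglongrightarrow> 0" by simp
  have "(\<lambda>n. (LINT x|M. fs n x \<bullet> ks n x) - (LINT x|M. f x \<bullet> k x)) \<longlonglongrightarrow> 0"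
    by (rule Lim_null_comparison[OF always_eventually 2]) (intro allI 1)
  then show ?thesis using Lim_null by blast
qed

locale bounded_open =
  fixes \<Omega> :: "(real^2) set"
  assumes open_dom: "open \<Omega>" and bounded_dom: "bounded \<Omega>"
begin

abbreviation M where "M \<equiv> lebesgue_on \<Omega>"

lemma dom_lebesgue: "\<Omega> \<in> sets lebesgue"
  using open_dom by auto

lemma finite_dom: "finite_measure M"
proof
  have "emeasure lebesgue \<Omega> < \<infinity>"
    using emeasure_bounded_finite[OF bounded_dom] open_dom by simp
  then show "emeasure M (space M) \<noteq> \<infinity>"
    using dom_lebesgue by (simp add: emeasure_restrict_space)
qed

lemma L2_imp_integrable: "square_integrable M f \<Longrightarrow> integrable M (f :: _ \<Rightarrow> real)"
proof -
  assume f: "square_integrable M f"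
  have "square_integrable M (\<lambda>_. 1::real)"
    using finite_measure.integrable_const[OF finite_dom] by (simp add: square_integrable_def)
  from L2_mult_real(1)[OF f this] show ?thesis by simp
qed

lemma L2_test_dom: "\<psi> \<in> test_functions S \<Longrightarrow> square_integrable M \<psi>"
  by (rule L2_test[OF _ dom_lebesgue])

lemma L2_cgrad: "\<psi> \<in> test_functions S \<Longrightarrow> square_integrable M (cgrad \<psi>)"
  by (intro L2_vec) (auto simp: cgrad_def intro!: L2_test_dom test_dird borel_measurable_vec_lambda
      test_measurable_lebesgue_on cong: measurable_cong_simp)

lemma lborel_test:
  "f \<in> test_functions \<Omega> \<Longrightarrow> integral\<^sup>L M f = integral\<^sup>L lborel f"
  by (intro integral_lebesgue_on_eq_lborel dom_lebesgue) (auto intro: test_measurable test_outside)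

lemma test_UNIV: "f \<in> test_functions \<Omega> \<Longrightarrow> f \<in> test_functions UNIV"
  by (rule test_mono) auto

lemma weak_gradientD:
  assumes "weak_gradient \<Omega> v g"
  shows "square_integrable M v" "square_integrable M g"
    "\<psi> \<in> test_functions \<Omega> \<Longrightarrow> (LINT x|M. v x * cgrad \<psi> x $ j) = - (LINT x|M. g x $ j * \<psi> x)"
  using assms by (auto simp: weak_gradient_def cgrad_def dird_def)

lemma weak_gradientI:
  assumes "square_integrable M v" "square_integrable M g"
    "\<And>\<psi> j. \<psi> \<in> test_functions \<Omega> \<Longrightarrow> (LINT x|M. v x * cgrad \<psi> x $ j) = - (LINT x|M. g x $ j * \<psi> x)"
  shows "weak_gradient \<Omega> v g"
  using assms by (auto simp: weak_gradient_def cgrad_def dird_def)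

text \<open>The difference of the two gradients annihilates all test functions. This is what allows
  \<open>wgrad\<close>, an arbitrary choice for each function, to be replaced by any other
  representative, in particular by a slice of a field measurable in space-time.\<close>

lemma weak_gradient_unique_AE:
  assumes "weak_gradient \<Omega> v g" "weak_gradient \<Omega> v' g'" "AE x in M. v x = v' x"
  shows "AE x in M. g x = g' x"
proof -
  note g = weak_gradientD[OF assms(1)] and g' = weak_gradientD[OF assms(2)]
  have "AE x in M. g x $ j - g' x $ j = 0" for j
  proof (rule fundamental_lemma[OF open_dom])
    show "integrable M (\<lambda>x. g x $ j - g' x $ j)"
      by (intro Bochner_Integration.integrable_diff L2_imp_integrable L2_nth g g')
    fix \<psi> assume \<psi>: "\<psi> \<in> test_functions \<Omega>"
    note L\<psi> = L2_test_dom[OF \<psi>] and Lc = L2_nth[OF L2_cgrad[OF \<psi>]]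
    have "(LINT x|M. (g x $ j - g' x $ j) * \<psi> x) = (LINT x|M. g x $ j * \<psi> x) - (LINT x|M. g' x $ j * \<psi> x)"
      by (simp add: left_diff_distrib L2_mult_real L2_nth g g' L\<psi>)
    also have "\<dots> = - (LINT x|M. v x * cgrad \<psi> x $ j) + (LINT x|M. v' x * cgrad \<psi> x $ j)"
      by (simp add: g(3)[OF \<psi>] g'(3)[OF \<psi>])
    also have "(LINT x|M. v x * cgrad \<psi> x $ j) = (LINT x|M. v' x * cgrad \<psi> x $ j)"
      using assms(3) g(1) g'(1) Lc by (intro integral_cong_AE) (auto intro!: borel_measurable_times dest: L2_measurable)
    finally show "(LINT x|M. (g x $ j - g' x $ j) * \<psi> x) = 0" by simp
  qed
  then have "AE x in M. \<forall>j. g x $ j - g' x $ j = 0" by (simp add: AE_all_countable)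
  then show ?thesis by eventually_elim (simp add: vec_eq_iff)
qed

lemma weak_gradient_unique:
  "weak_gradient \<Omega> v g \<Longrightarrow> weak_gradient \<Omega> v g' \<Longrightarrow> AE x in M. g x = g' x"
  by (rule weak_gradient_unique_AE) auto

lemma weak_gradient_lincomb:
  assumes "weak_gradient \<Omega> v g" "weak_gradient \<Omega> w h"
  shows "weak_gradient \<Omega> (\<lambda>x. a * v x + b * w x) (\<lambda>x. a *\<^sub>R g x + b *\<^sub>R h x)"
proof (rule weak_gradientI)
  note g = weak_gradientD[OF assms(1)] and h = weak_gradientD[OF assms(2)]
  show "square_integrable M (\<lambda>x. a * v x + b * w x)" by (intro L2_add L2_cmult g h)
  show "square_integrable M (\<lambda>x. a *\<^sub>R g x + b *\<^sub>R h x)" by (intro L2_add L2_scaleR g h)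
  fix \<psi> j assume \<psi>: "\<psi> \<in> test_functions \<Omega>"
  note L\<psi> = L2_test_dom[OF \<psi>] and Lc = L2_nth[OF L2_cgrad[OF \<psi>]]
  show "(LINT x|M. (a * v x + b * w x) * cgrad \<psi> x $ j) = - (LINT x|M. (a *\<^sub>R g x + b *\<^sub>R h x) $ j * \<psi> x)"
    by (simp add: distrib_right mult.assoc L2_mult_real L2_nth g h L\<psi> Lc g(3)[OF \<psi>] h(3)[OF \<psi>])
qed

lemma weak_gradient_diff:
  "weak_gradient \<Omega> v g \<Longrightarrow> weak_gradient \<Omega> w h \<Longrightarrow> weak_gradient \<Omega> (\<lambda>x. v x - w x) (\<lambda>x. g x - h x)"
  using weak_gradient_lincomb[of v g w h 1 "-1"] by simp

lemma weak_gradient_test: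
  assumes "\<psi> \<in> test_functions \<Omega>" shows "weak_gradient \<Omega> \<psi> (cgrad \<psi>)"
proof (rule weak_gradientI)
  fix \<eta> :: "real^2 \<Rightarrow> real" and j assume \<eta>: "\<eta> \<in> test_functions \<Omega>"
  let ?e = "axis j 1 :: real^2"
  have "(LINT x|M. \<psi> x * dird \<eta> ?e x) = (LINT x|lborel. \<psi> x * dird \<eta> ?e x)"
    by (intro lborel_test test_mult test_dird assms \<eta>)
  also have "\<dots> = - (LINT x|lborel. dird \<psi> ?e x * \<eta> x)"
    by (intro integral_by_parts_test test_UNIV assms \<eta>)
  also have "(LINT x|lborel. dird \<psi> ?e x * \<eta> x) = (LINT x|M. dird \<psi> ?e x * \<eta> x)"
    by (intro lborel_test[symmetric] test_mult test_dird assms \<eta>)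
  finally show "(LINT x|M. \<psi> x * cgrad \<eta> x $ j) = - (LINT x|M. cgrad \<psi> x $ j * \<eta> x)"
    by (simp add: cgrad_def)
qed (auto intro: L2_test_dom L2_cgrad assms)

lemma weak_gradient_zero: "weak_gradient \<Omega> (\<lambda>_. 0) (\<lambda>_. 0)"
  by (rule weak_gradientI) (auto intro: L2_zero)

lemma weak_gradient_wgrad:
  "weak_gradient \<Omega> v g \<Longrightarrow> weak_gradient \<Omega> v (wgrad \<Omega> v)"
  unfolding wgrad_def by (rule someI[of "weak_gradient \<Omega> v"])

lemma wgrad_AE: "weak_gradient \<Omega> v g \<Longrightarrow> AE x in M. wgrad \<Omega> v x = g x"
  by (rule weak_gradient_unique[OF weak_gradient_wgrad])

lemma H10_weak_gradient: "v \<in> sobolev_H10 \<Omega> \<Longrightarrow> weak_gradient \<Omega> v (wgrad \<Omega> v)"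
  unfolding sobolev_H10_def sobolev_H1_def by (auto intro: weak_gradient_wgrad)

lemma H1norm_eq:
  assumes "weak_gradient \<Omega> v g"
  shows "H1norm \<Omega> v = sqrt ((L2norm M v)\<^sup>2 + (L2norm M g)\<^sup>2)"
  unfolding H1norm_def
  using L2norm_cong_AE[OF _ _ wgrad_AE[OF assms]] weak_gradientD(2)[OF assms]
    weak_gradientD(2)[OF weak_gradient_wgrad[OF assms]] by (simp add: L2_measurable)

lemma H10_approx:
  assumes "v \<in> sobolev_H10 \<Omega>" "weak_gradient \<Omega> v g"
  obtains \<psi> where "\<And>n. \<psi> n \<in> test_functions \<Omega>"
    "(\<lambda>n. L2norm M (\<lambda>x. v x - \<psi> n x)) \<longlonglongrightarrow> 0" "(\<lambda>n. L2norm M (\<lambda>x. g x - cgrad (\<psi> n) x)) \<longlonglongrightarrow> 0"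
proof -
  have "\<exists>\<psi>\<in>test_functions \<Omega>. H1norm \<Omega> (\<lambda>x. v x - \<psi> x) < inverse (real (Suc n))" for n
    using assms(1) by (simp add: sobolev_H10_def)
  then obtain \<psi> where \<psi>: "\<And>n. \<psi> n \<in> test_functions \<Omega>"
    "\<And>n. H1norm \<Omega> (\<lambda>x. v x - \<psi> n x) < inverse (real (Suc n))" by metis
  have eq: "H1norm \<Omega> (\<lambda>x. v x - \<psi> n x)
      = sqrt ((L2norm M (\<lambda>x. v x - \<psi> n x))\<^sup>2 + (L2norm M (\<lambda>x. g x - cgrad (\<psi> n) x))\<^sup>2)" for n
    by (intro H1norm_eq weak_gradient_diff assms(2) weak_gradient_test \<psi>)
  have le: "L2norm M (\<lambda>x. v x - \<psi> n x) \<le> inverse (real (Suc n))"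
    "L2norm M (\<lambda>x. g x - cgrad (\<psi> n) x) \<le> inverse (real (Suc n))" for n
  proof -
    have "L2norm M (\<lambda>x. v x - \<psi> n x) \<le> H1norm \<Omega> (\<lambda>x. v x - \<psi> n x)"
      "L2norm M (\<lambda>x. g x - cgrad (\<psi> n) x) \<le> H1norm \<Omega> (\<lambda>x. v x - \<psi> n x)"
      unfolding eq by (rule real_le_rsqrt; simp)+
    with \<psi>(2)[of n] show "L2norm M (\<lambda>x. v x - \<psi> n x) \<le> inverse (real (Suc n))"
      "L2norm M (\<lambda>x. g x - cgrad (\<psi> n) x) \<le> inverse (real (Suc n))" by linarith+
  qed
  show thesis
  proof (rule that[OF \<psi>(1)])
    show "(\<lambda>n. L2norm M (\<lambda>x. v x - \<psi> n x)) \<longlonglongrightarrow> 0"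
      by (rule tendsto_sandwich[OF _ _ tendsto_const LIMSEQ_inverse_real_of_nat])
         (intro always_eventually allI L2norm_nonneg le)+
    show "(\<lambda>n. L2norm M (\<lambda>x. g x - cgrad (\<psi> n) x)) \<longlonglongrightarrow> 0"
      by (rule tendsto_sandwich[OF _ _ tendsto_const LIMSEQ_inverse_real_of_nat])
         (intro always_eventually allI L2norm_nonneg le)+
  qed
qed

lemma H10I:
  assumes "weak_gradient \<Omega> v g" "\<And>n. \<psi> n \<in> test_functions \<Omega>"
    "(\<lambda>n. L2norm M (\<lambda>x. v x - \<psi> n x)) \<longlonglongrightarrow> 0" "(\<lambda>n. L2norm M (\<lambda>x. g x - cgrad (\<psi> n) x)) \<longlonglongrightarrow> 0"
  shows "v \<in> sobolev_H10 \<Omega>"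
proof -
  have "(\<lambda>n. sqrt ((L2norm M (\<lambda>x. v x - \<psi> n x))\<^sup>2 + (L2norm M (\<lambda>x. g x - cgrad (\<psi> n) x))\<^sup>2)) \<longlonglongrightarrow> sqrt (0\<^sup>2 + 0\<^sup>2)"
    by (intro tendsto_intros assms)
  then have lim: "(\<lambda>n. H1norm \<Omega> (\<lambda>x. v x - \<psi> n x)) \<longlonglongrightarrow> 0"
    by (simp add: H1norm_eq[OF weak_gradient_diff[OF assms(1) weak_gradient_test[OF assms(2)]]])
  have "\<exists>\<psi>\<in>test_functions \<Omega>. H1norm \<Omega> (\<lambda>x. v x - \<psi> x) < \<epsilon>" if "\<epsilon> > 0" for \<epsilon>
    using order_tendstoD(2)[OF lim that] assms(2) by (auto simp: eventually_sequentially)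
  then show ?thesis using assms(1) by (auto simp: sobolev_H10_def sobolev_H1_def)
qed

lemma cgrad_lincomb:
  assumes "\<psi> \<in> test_functions \<Omega>" "\<eta> \<in> test_functions \<Omega>"
  shows "cgrad (\<lambda>x. a * \<psi> x + b * \<eta> x) x = a *\<^sub>R cgrad \<psi> x + b *\<^sub>R cgrad \<eta> x"
  using assms by (simp add: cgrad_def vec_eq_iff dird_add[of _ \<Omega>] dird_cmult[of _ \<Omega>] test_cmult)

lemma H10_lincomb:
  assumes v: "v \<in> sobolev_H10 \<Omega>" and w: "w \<in> sobolev_H10 \<Omega>"
  shows "(\<lambda>x. a * v x + b * w x) \<in> sobolev_H10 \<Omega>"
proof -
  note gv = H10_weak_gradient[OF v] and gw = H10_weak_gradient[OF w]
  obtain \<psi> where \<psi>: "\<And>n. \<psi> n \<in> test_functions \<Omega>"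
    "(\<lambda>n. L2norm M (\<lambda>x. v x - \<psi> n x)) \<longlonglongrightarrow> 0" "(\<lambda>n. L2norm M (\<lambda>x. wgrad \<Omega> v x - cgrad (\<psi> n) x)) \<longlonglongrightarrow> 0"
    by (rule H10_approx[OF v gv]) blast
  obtain \<eta> where \<eta>: "\<And>n. \<eta> n \<in> test_functions \<Omega>"
    "(\<lambda>n. L2norm M (\<lambda>x. w x - \<eta> n x)) \<longlonglongrightarrow> 0" "(\<lambda>n. L2norm M (\<lambda>x. wgrad \<Omega> w x - cgrad (\<eta> n) x)) \<longlonglongrightarrow> 0"
    by (rule H10_approx[OF w gw]) blast
  \<comment> \<open>The value type is left free, so that the same estimate serves the functions and
    their gradients.\<close>
  have lim: "(\<lambda>n. L2norm M (\<lambda>x. (a *\<^sub>R f x + b *\<^sub>R g x) - (a *\<^sub>R fs n x + b *\<^sub>R gs n x))) \<longlonglongrightarrow> 0"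
    if "square_integrable M f" "square_integrable M g" "\<And>n. square_integrable M (fs n)" "\<And>n. square_integrable M (gs n)"
      "(\<lambda>n. L2norm M (\<lambda>x. f x - fs n x)) \<longlonglongrightarrow> 0" "(\<lambda>n. L2norm M (\<lambda>x. g x - gs n x)) \<longlonglongrightarrow> 0"
    for f g :: "real^2 \<Rightarrow> 'b::euclidean_space" and fs gs
  proof -
    have le: "L2norm M (\<lambda>x. (a *\<^sub>R f x + b *\<^sub>R g x) - (a *\<^sub>R fs n x + b *\<^sub>R gs n x))
        \<le> \<bar>a\<bar> * L2norm M (\<lambda>x. f x - fs n x) + \<bar>b\<bar> * L2norm M (\<lambda>x. g x - gs n x)" for n
    proof -
      have "L2norm M (\<lambda>x. (a *\<^sub>R f x + b *\<^sub>R g x) - (a *\<^sub>R fs n x + b *\<^sub>R gs n x))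
          = L2norm M (\<lambda>x. a *\<^sub>R (f x - fs n x) + b *\<^sub>R (g x - gs n x))"
        by (simp add: algebra_simps)
      also have "\<dots> \<le> L2norm M (\<lambda>x. a *\<^sub>R (f x - fs n x)) + L2norm M (\<lambda>x. b *\<^sub>R (g x - gs n x))"
        by (intro L2norm_triangle L2_scaleR L2_diff that)
      finally show ?thesis by (simp only: L2norm_scaleR)
    qed
    have "(\<lambda>n. \<bar>a\<bar> * L2norm M (\<lambda>x. f x - fs n x) + \<bar>b\<bar> * L2norm M (\<lambda>x. g x - gs n x)) \<longlonglongrightarrow> \<bar>a\<bar> * 0 + \<bar>b\<bar> * 0"
      by (intro tendsto_intros that)
    then have "(\<lambda>n. \<bar>a\<bar> * L2norm M (\<lambda>x. f x - fs n x) + \<bar>b\<bar> * L2norm M (\<lambda>x. g x - gs n x)) \<longlonglongrightarrow> 0"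
      by simp
    with L2norm_nonneg le show ?thesis by (rule squeeze_0)
  qed
  show ?thesis
  proof (rule H10I[OF weak_gradient_lincomb[OF gv gw]])
    show t: "(\<lambda>x. a * \<psi> n x + b * \<eta> n x) \<in> test_functions \<Omega>" for n
      by (intro test_add test_cmult \<psi> \<eta>)
    show "(\<lambda>n. L2norm M (\<lambda>x. (a * v x + b * w x) - (a * \<psi> n x + b * \<eta> n x))) \<longlonglongrightarrow> 0"
      using lim[OF weak_gradientD(1)[OF gv] weak_gradientD(1)[OF gw] L2_test_dom[OF \<psi>(1)] L2_test_dom[OF \<eta>(1)] \<psi>(2) \<eta>(2)]
      by simp
    show "(\<lambda>n. L2norm M (\<lambda>x. (a *\<^sub>R wgrad \<Omega> v x + b *\<^sub>R wgrad \<Omega> w x) - cgrad (\<lambda>x. a * \<psi> n x + b * \<eta> n x) x)) \<longlonglongrightarrow> 0"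
      using lim[OF weak_gradientD(2)[OF gv] weak_gradientD(2)[OF gw] L2_cgrad[OF \<psi>(1)] L2_cgrad[OF \<eta>(1)] \<psi>(3) \<eta>(3)]
      by (simp add: cgrad_lincomb[OF \<psi>(1) \<eta>(1)])
  qed
qed

lemma H10_zero: "(\<lambda>_. 0) \<in> sobolev_H10 \<Omega>"
proof (rule H10I[OF weak_gradient_zero])
  have "cgrad (\<lambda>_. 0) = (\<lambda>_. 0)"
    by (simp add: cgrad_def fun_eq_iff vec_eq_iff dirdI[where f'="\<lambda>_. 0"])
  then show "(\<lambda>n::nat. L2norm M (\<lambda>x. 0 - cgrad (\<lambda>_. 0) x)) \<longlonglongrightarrow> 0" "(\<lambda>n::nat. L2norm M (\<lambda>x. 0 - 0::real)) \<longlonglongrightarrow> 0"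
    by (simp_all add: L2norm_def)
qed (rule test_zero)

text \<open>For test functions this is a double integration by parts, and both sides are continuous
  in the H^1 norm. For the two components of a vector field it says that the integral of the
  Jacobian determinant vanishes, the form in which Korn's identity uses it.\<close>

lemma H10_grad_swap:
  assumes v: "v \<in> sobolev_H10 \<Omega>" "weak_gradient \<Omega> v g" and w: "w \<in> sobolev_H10 \<Omega>" "weak_gradient \<Omega> w h"
  shows "(LINT x|M. g x $ a * h x $ b) = (LINT x|M. h x $ a * g x $ b)"
proof -
  obtain \<psi> where \<psi>: "\<And>n. \<psi> n \<in> test_functions \<Omega>"
    "(\<lambda>n. L2norm M (\<lambda>x. v x - \<psi> n x)) \<longlonglongrightarrow> 0" "(\<lambda>n. L2norm M (\<lambda>x. g x - cgrad (\<psi> n) x)) \<longlonglongrightarrow> 0"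
    by (rule H10_approx[OF v]) blast
  obtain \<eta> where \<eta>: "\<And>n. \<eta> n \<in> test_functions \<Omega>"
    "(\<lambda>n. L2norm M (\<lambda>x. w x - \<eta> n x)) \<longlonglongrightarrow> 0" "(\<lambda>n. L2norm M (\<lambda>x. h x - cgrad (\<eta> n) x)) \<longlonglongrightarrow> 0"
    by (rule H10_approx[OF w]) blast
  note gg = weak_gradientD(2)[OF v(2)] and hh = weak_gradientD(2)[OF w(2)]
  have comp: "(\<lambda>n. L2norm M (\<lambda>x. f x $ i - fs n x $ i)) \<longlonglongrightarrow> 0"
    if "(\<lambda>n. L2norm M (\<lambda>x. f x - fs n x)) \<longlonglongrightarrow> 0" "square_integrable M f" "\<And>n. square_integrable M (fs n)"
    for f :: "real^2 \<Rightarrow> real^2" and fs i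
    by (rule tendsto_sandwich[OF _ _ tendsto_const that(1)])
       (use L2norm_nth_le[OF L2_diff[OF that(2,3)], of _ i] in \<open>auto simp: L2norm_nonneg\<close>)
  have 1: "(\<lambda>n. LINT x|M. cgrad (\<psi> n) x $ a \<bullet> cgrad (\<eta> n) x $ b) \<longlonglongrightarrow> (LINT x|M. g x $ a \<bullet> h x $ b)"
    by (intro L2norm_convergent_bilinear L2_nth L2_cgrad[OF \<psi>(1)] L2_cgrad[OF \<eta>(1)] gg hh
        comp[OF \<psi>(3) gg L2_cgrad[OF \<psi>(1)]] comp[OF \<eta>(3) hh L2_cgrad[OF \<eta>(1)]])
  have 2: "(\<lambda>n. LINT x|M. cgrad (\<eta> n) x $ a \<bullet> cgrad (\<psi> n) x $ b) \<longlonglongrightarrow> (LINT x|M. h x $ a \<bullet> g x $ b)"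
    by (intro L2norm_convergent_bilinear L2_nth L2_cgrad[OF \<psi>(1)] L2_cgrad[OF \<eta>(1)] gg hh
        comp[OF \<psi>(3) gg L2_cgrad[OF \<psi>(1)]] comp[OF \<eta>(3) hh L2_cgrad[OF \<eta>(1)]])
  have "(LINT x|M. cgrad (\<psi> n) x $ a \<bullet> cgrad (\<eta> n) x $ b) = (LINT x|M. cgrad (\<eta> n) x $ a \<bullet> cgrad (\<psi> n) x $ b)" for n
  proof -
    have "(LINT x|M. dird (\<psi> n) (axis a 1) x * dird (\<eta> n) (axis b 1) x)
        = (LINT x|lborel. dird (\<psi> n) (axis a 1) x * dird (\<eta> n) (axis b 1) x)"
      by (intro lborel_test test_mult test_dird \<psi> \<eta>)
    also have "\<dots> = (LINT x|lborel. dird (\<eta> n) (axis a 1) x * dird (\<psi> n) (axis b 1) x)"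
      by (intro integral_dird_swap test_UNIV \<psi> \<eta>)
    also have "\<dots> = (LINT x|M. dird (\<eta> n) (axis a 1) x * dird (\<psi> n) (axis b 1) x)"
      by (intro lborel_test[symmetric] test_mult test_dird \<psi> \<eta>)
    finally show ?thesis by (simp add: cgrad_def)
  qed
  with 1 2 show ?thesis by (simp add: LIMSEQ_unique)
qed

end

section \<open>Ladyzhenskaya's inequality\<close>

definition pair_vec :: "real \<times> real \<Rightarrow> real^2" where
  "pair_vec p = fst p *\<^sub>R axis 1 1 + snd p *\<^sub>R axis 2 1"

lemma pair_vec_nth [simp]: "pair_vec p $ 1 = fst p" "pair_vec p $ 2 = snd p"
  by (simp_all add: pair_vec_def axis_def)

lemma pair_vec_measurable [measurable]: "pair_vec \<in> borel_measurable borel"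
  unfolding pair_vec_def[abs_def]
  by (intro borel_measurable_continuous_onI continuous_intros)

text \<open>Lebesgue measure is characterised by the volumes of boxes, and the preimage of a box is
  a box with the same side lengths. The identification makes Tonelli's theorem for pairs available
  on \<open>real^2\<close>.\<close>

lemma lborel_pair_vec: "distr (lborel \<Otimes>\<^sub>M lborel) borel pair_vec = lborel"
proof (rule lborel_eqI[symmetric])
  fix l u :: "real^2"
  assume le: "\<And>b. b \<in> Basis \<Longrightarrow> l \<bullet> b \<le> u \<bullet> b"
  have Basis2: "(Basis :: (real^2) set) = {axis 1 1, axis 2 1}"
    unfolding Basis_vec_def by (auto simp: UNIV_2)
  have ne: "(axis 1 1 :: real^2) \<noteq> axis 2 1"
    by (simp add: axis_eq_axis)
  have lu: "l$1 \<le> u$1" "l$2 \<le> u$2"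
    using le[of "axis 1 1"] le[of "axis 2 1"] by (simp_all add: Basis2 inner_axis)
  have pre: "pair_vec -` box l u = box (l$1, l$2) (u$1, u$2)"
    by (auto simp: mem_box_cart mem_box Basis_prod_def exhaust_2 forall_2)
  have "emeasure (distr (lborel \<Otimes>\<^sub>M lborel) borel pair_vec) (box l u) = emeasure lborel (box (l$1, l$2) (u$1, u$2))"
    by (subst emeasure_distr) (simp_all add: lborel_prod pre)
  also have "\<dots> = ennreal ((u$1 - l$1) * (u$2 - l$2))"
    using lu by (simp add: emeasure_lborel_box_eq Basis_prod_def prod.union_disjoint)
  also have "\<dots> = (\<Prod>b\<in>Basis. (u - l) \<bullet> b)"
    using ne by (simp add: Basis2 inner_axis)
  finally show "emeasure (distr (lborel \<Otimes>\<^sub>M lborel) borel pair_vec) (box l u) = (\<Prod>b\<in>Basis. (u - l) \<bullet> b)" .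
qed simp

lemma nn_integral_vec2:
  assumes [measurable]: "f \<in> borel_measurable borel"
  shows "(\<integral>\<^sup>+x. f x \<partial>lborel) = (\<integral>\<^sup>+x. \<integral>\<^sup>+y. f (pair_vec (x, y)) \<partial>lborel \<partial>lborel)"
    and "(\<integral>\<^sup>+x. f x \<partial>lborel) = (\<integral>\<^sup>+y. \<integral>\<^sup>+x. f (pair_vec (x, y)) \<partial>lborel \<partial>lborel)"
proof -
  have "(\<integral>\<^sup>+x. f x \<partial>lborel) = (\<integral>\<^sup>+x. f x \<partial>(distr (lborel \<Otimes>\<^sub>M lborel) borel pair_vec))"
    by (simp only: lborel_pair_vec)
  also have "\<dots> = (\<integral>\<^sup>+p. f (pair_vec p) \<partial>(lborel \<Otimes>\<^sub>M lborel))"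
    by (subst nn_integral_distr) (auto simp: lborel_prod)
  finally have 1: "(\<integral>\<^sup>+x. f x \<partial>lborel) = (\<integral>\<^sup>+p. f (pair_vec p) \<partial>(lborel \<Otimes>\<^sub>M lborel))" .
  have m: "(\<lambda>p. f (pair_vec p)) \<in> borel_measurable (lborel \<Otimes>\<^sub>M lborel)"
    by (simp add: lborel_prod)
  show "(\<integral>\<^sup>+x. f x \<partial>lborel) = (\<integral>\<^sup>+x. \<integral>\<^sup>+y. f (pair_vec (x, y)) \<partial>lborel \<partial>lborel)"
    unfolding 1 by (rule lborel.nn_integral_fst[symmetric, OF m])
  show "(\<integral>\<^sup>+x. f x \<partial>lborel) = (\<integral>\<^sup>+y. \<integral>\<^sup>+x. f (pair_vec (x, y)) \<partial>lborel \<partial>lborel)"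
    unfolding 1 by (rule lborel_pair.nn_integral_snd[symmetric]) (use m in \<open>simp add: case_prod_eta\<close>)
qed

text \<open>The fundamental theorem of calculus for the square of the test function, along the line
  from a point outside its support. The nonnegative integral avoids integrability questions when
  these bounds are multiplied later.\<close>

lemma test_sq_le_line_integral:
  fixes \<psi> :: "'a::euclidean_space \<Rightarrow> real"
  assumes \<psi>: "\<psi> \<in> test_functions S" and e: "norm e = 1"
  shows "ennreal ((\<psi> (z + x *\<^sub>R e))\<^sup>2)
    \<le> (\<integral>\<^sup>+t. ennreal (2 * \<bar>\<psi> (z + t *\<^sub>R e) * dird \<psi> e (z + t *\<^sub>R e)\<bar>) \<partial>lborel)"
proof -
  obtain R where R: "\<And>x. norm x > R \<Longrightarrow> \<psi> x = 0" using test_bounded_support[OF \<psi>] by metis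
  \<comment> \<open>The terms of a ensure that z + a e has norm greater than R, hence lies outside
    the support, and that the starting point a is to the left of x.\<close>
  define a where "a = - (\<bar>R\<bar> + norm z + \<bar>x\<bar> + 1)"
  let ?f = "\<lambda>t. 2 * (\<psi> (z + t *\<^sub>R e) * dird \<psi> e (z + t *\<^sub>R e))"
  have a: "a \<le> x" unfolding a_def using norm_ge_zero[of z] by linarith
  have "norm (z + a *\<^sub>R e) \<ge> norm (a *\<^sub>R e) - norm z"
    using norm_triangle_ineq4[of "z + a *\<^sub>R e" z] by simp
  then have "norm (z + a *\<^sub>R e) > R" using e unfolding a_def by simp
  then have z: "\<psi> (z + a *\<^sub>R e) = 0" by (rule R)
  have d: "DERIV (\<lambda>t. (\<psi> (z + t *\<^sub>R e))\<^sup>2) t :> ?f t" for t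
    by (auto intro!: derivative_eq_intros DERIV_test_line[OF \<psi>])
  have c: "continuous_on UNIV ?f"
    by (intro continuous_intros continuous_on_compose2[OF test_continuous[OF \<psi>, of UNIV]]
        continuous_on_compose2[OF test_continuous[OF test_dird[OF \<psi>], of UNIV]]) auto
  have "has_bochner_integral lborel (\<lambda>t. ?f t * indicator {a..x} t) ((\<psi> (z + x *\<^sub>R e))\<^sup>2 - (\<psi> (z + a *\<^sub>R e))\<^sup>2)"
    using c by (intro has_bochner_integral_FTC_Icc_real[OF a]) (auto intro: d simp: continuous_on_eq_continuous_at)
  then have I: "integrable lborel (\<lambda>t. ?f t * indicator {a..x} t)"
    and eq: "(LINT t|lborel. ?f t * indicator {a..x} t) = (\<psi> (z + x *\<^sub>R e))\<^sup>2"
    by (auto simp: has_bochner_integral_iff z)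
  have "ennreal ((\<psi> (z + x *\<^sub>R e))\<^sup>2) = ennreal (norm (LINT t|lborel. ?f t * indicator {a..x} t))"
    by (simp add: eq)
  also have "\<dots> \<le> (\<integral>\<^sup>+t. ennreal (norm (?f t * indicator {a..x} t)) \<partial>lborel)"
    by (rule integral_norm_bound_ennreal[OF I])
  also have "\<dots> \<le> (\<integral>\<^sup>+t. ennreal (2 * \<bar>\<psi> (z + t *\<^sub>R e) * dird \<psi> e (z + t *\<^sub>R e)\<bar>) \<partial>lborel)"
    by (intro nn_integral_mono ennreal_leI) (auto simp: indicator_def abs_mult)
  finally show ?thesis .
qed

text \<open>The fourth power is a product of two squares. One is bounded by its integral along the
  horizontal line, a function of y alone, the other by its integral along the vertical line, a
  function of x alone; the double integral of the product of bounds then factorises.\<close>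

lemma ladyzhenskaya_test_nn:
  fixes \<psi> :: "real^2 \<Rightarrow> real"
  assumes \<psi>: "\<psi> \<in> test_functions S"
  shows "(\<integral>\<^sup>+x. ennreal ((\<psi> x)^4) \<partial>lborel) \<le>
    (\<integral>\<^sup>+x. ennreal (2 * \<bar>\<psi> x * dird \<psi> (axis 1 1) x\<bar>) \<partial>lborel) *
    (\<integral>\<^sup>+x. ennreal (2 * \<bar>\<psi> x * dird \<psi> (axis 2 1) x\<bar>) \<partial>lborel)"
proof -
  note [measurable] = test_measurable[OF \<psi>] test_measurable[OF test_dird[OF \<psi>]]
  define A where "A y = (\<integral>\<^sup>+x. ennreal (2 * \<bar>\<psi> (pair_vec (x, y)) * dird \<psi> (axis 1 1) (pair_vec (x, y))\<bar>) \<partial>lborel)" for y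
  define B where "B x = (\<integral>\<^sup>+y. ennreal (2 * \<bar>\<psi> (pair_vec (x, y)) * dird \<psi> (axis 2 1) (pair_vec (x, y))\<bar>) \<partial>lborel)" for x
  have [measurable]: "(\<lambda>p. pair_vec (fst p, snd p)) \<in> borel_measurable (borel \<Otimes>\<^sub>M borel)"
    "(\<lambda>p. pair_vec (snd p, fst p)) \<in> borel_measurable (borel \<Otimes>\<^sub>M borel)"
    by (auto simp: borel_prod pair_vec_def intro!: borel_measurable_continuous_onI continuous_intros)
  have [measurable]: "A \<in> borel_measurable borel" "B \<in> borel_measurable borel"
    unfolding A_def[abs_def] B_def[abs_def] by (auto intro!: lborel.borel_measurable_nn_integral simp: case_prod_beta')
  have e: "ennreal (t^4) = ennreal (t\<^sup>2) * ennreal (t\<^sup>2)" for t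
    by (simp add: ennreal_mult[symmetric] power_add[symmetric])
  have lA: "ennreal ((\<psi> (pair_vec (x, y)))\<^sup>2) \<le> A y" for x y
    using test_sq_le_line_integral[OF \<psi>, of "axis 1 1" "y *\<^sub>R axis 2 1" x]
    by (simp add: A_def pair_vec_def add.commute)
  have lB: "ennreal ((\<psi> (pair_vec (x, y)))\<^sup>2) \<le> B x" for x y
    using test_sq_le_line_integral[OF \<psi>, of "axis 2 1" "x *\<^sub>R axis 1 1" y]
    by (simp add: B_def pair_vec_def)
  have le: "ennreal ((\<psi> (pair_vec (x, y)))^4) \<le> B x * A y" for x y
    unfolding e by (intro mult_mono lA lB zero_le)
  have "(\<integral>\<^sup>+x. ennreal ((\<psi> x)^4) \<partial>lborel) = (\<integral>\<^sup>+x. \<integral>\<^sup>+y. ennreal ((\<psi> (pair_vec (x, y)))^4) \<partial>lborel \<partial>lborel)"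
    by (rule nn_integral_vec2) auto
  also have "\<dots> \<le> (\<integral>\<^sup>+x. \<integral>\<^sup>+y. B x * A y \<partial>lborel \<partial>lborel)"
    by (intro nn_integral_mono le)
  also have "\<dots> = (\<integral>\<^sup>+y. A y \<partial>lborel) * (\<integral>\<^sup>+x. B x \<partial>lborel)"
    by (simp add: nn_integral_cmult nn_integral_multc mult.commute)
  also have "(\<integral>\<^sup>+y. A y \<partial>lborel) = (\<integral>\<^sup>+x. ennreal (2 * \<bar>\<psi> x * dird \<psi> (axis 1 1) x\<bar>) \<partial>lborel)"
    unfolding A_def by (rule nn_integral_vec2(2)[symmetric]) measurable
  also have "(\<integral>\<^sup>+x. B x \<partial>lborel) = (\<integral>\<^sup>+x. ennreal (2 * \<bar>\<psi> x * dird \<psi> (axis 2 1) x\<bar>) \<partial>lborel)"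
    unfolding B_def by (rule nn_integral_vec2(1)[symmetric]) measurable
  finally show ?thesis .
qed

text \<open>The $L^4$ norm enters only through its square $\| |v|^2 \|_{L^2}$.\<close>

definition N4 :: "'a measure \<Rightarrow> ('a \<Rightarrow> 'b::euclidean_space) \<Rightarrow> real" where
  "N4 M v = L2norm M (\<lambda>x. (norm (v x))\<^sup>2)"

definition L4 :: "'a measure \<Rightarrow> ('a \<Rightarrow> 'b::euclidean_space) \<Rightarrow> bool" where
  "L4 M v \<longleftrightarrow> v \<in> borel_measurable M \<and> square_integrable M (\<lambda>x. (norm (v x))\<^sup>2)"

lemma L4_product:
  assumes "L4 M u" "L4 M w"
  shows "square_integrable M (\<lambda>x. norm (u x) * norm (w x))"
    and "L2norm M (\<lambda>x. norm (u x) * norm (w x)) \<le> sqrt (N4 M u * N4 M w)"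
proof -
  note i = L2_mult[of M "\<lambda>x. (norm (u x))\<^sup>2" "\<lambda>x. (norm (w x))\<^sup>2"]
  show "square_integrable M (\<lambda>x. norm (u x) * norm (w x))"
    using assms i(1) by (auto simp: L4_def square_integrable_def[of M "\<lambda>x. norm (u x) * norm (w x)"] power_mult_distrib)
  show "L2norm M (\<lambda>x. norm (u x) * norm (w x)) \<le> sqrt (N4 M u * N4 M w)"
    using assms i(2) by (simp add: L4_def N4_def L2norm_def[of M "\<lambda>x. norm (u x) * norm (w x)"] power_mult_distrib)
qed

text \<open>Hoelder's inequality with exponents 2, 4, 4, obtained by applying the Cauchy-Schwarz
  inequality twice.\<close>

lemma triple_product:
  assumes "square_integrable M h" "L4 M u" "L4 M w"
  shows "integrable M (\<lambda>x. norm (h x) * (norm (u x) * norm (w x)))"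
    and "(LINT x|M. norm (h x) * (norm (u x) * norm (w x))) \<le> L2norm M h * sqrt (N4 M u * N4 M w)"
proof -
  note i = L2_mult[OF assms(1) L4_product(1)[OF assms(2,3)]]
  show "integrable M (\<lambda>x. norm (h x) * (norm (u x) * norm (w x)))" using i(1) by simp
  have "(LINT x|M. norm (h x) * (norm (u x) * norm (w x))) \<le> L2norm M h * L2norm M (\<lambda>x. norm (u x) * norm (w x))"
    using i(2) by simp
  also have "\<dots> \<le> L2norm M h * sqrt (N4 M u * N4 M w)"
    by (intro mult_left_mono L4_product(2)[OF assms(2,3)] L2norm_nonneg)
  finally show "(LINT x|M. norm (h x) * (norm (u x) * norm (w x))) \<le> L2norm M h * sqrt (N4 M u * N4 M w)" .
qed

lemma N4_nonneg: "0 \<le> N4 M v" by (simp add: N4_def L2norm_nonneg)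

context bounded_open
begin

lemma L2norm_dird_le: "\<psi> \<in> test_functions \<Omega> \<Longrightarrow> L2norm M (dird \<psi> (axis j 1)) \<le> L2norm M (cgrad \<psi>)"
  using L2norm_nth_le[OF L2_cgrad, of \<psi> \<Omega> j] by (simp add: cgrad_def)

text \<open>Each of the two line-integral factors is at most twice the product of the L^2 norms of
  the function and its gradient; the 2 comes from differentiating a square.\<close>

lemma ladyzhenskaya_test:
  assumes \<psi>: "\<psi> \<in> test_functions \<Omega>"
  shows "(\<integral>\<^sup>+x. ennreal ((\<psi> x)^4) \<partial>M) \<le> ennreal ((2 * L2norm M \<psi> * L2norm M (cgrad \<psi>))\<^sup>2)"
proof -
  have 1: "(\<integral>\<^sup>+x. ennreal (2 * \<bar>\<psi> x * dird \<psi> (axis j 1) x\<bar>) \<partial>lborel) \<le> ennreal (2 * L2norm M \<psi> * L2norm M (cgrad \<psi>))" for j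
  proof -
    let ?p = "\<lambda>x. \<psi> x * dird \<psi> (axis j 1) x"
    have t: "?p \<in> test_functions \<Omega>" by (intro test_mult test_dird \<psi>)
    have i: "integrable lborel (\<lambda>x. 2 * \<bar>?p x\<bar>)" using test_integrable[OF t] by auto
    have "(\<integral>\<^sup>+x. ennreal (2 * \<bar>?p x\<bar>) \<partial>lborel) = ennreal (LINT x|lborel. 2 * \<bar>?p x\<bar>)"
      by (rule nn_integral_eq_integral[OF i]) auto
    also have "(LINT x|lborel. 2 * \<bar>?p x\<bar>) = (LINT x|M. 2 * \<bar>?p x\<bar>)"
      using test_measurable[OF t] test_outside[OF t]
      by (intro integral_lebesgue_on_eq_lborel(1)[symmetric] dom_lebesgue) auto
    also have "\<dots> = 2 * (LINT x|M. norm (\<psi> x) * norm (dird \<psi> (axis j 1) x))"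
      by (simp add: abs_mult)
    also have "\<dots> \<le> 2 * (L2norm M \<psi> * L2norm M (cgrad \<psi>))"
      using L2_mult(2)[OF L2_test_dom[OF \<psi>] L2_test_dom[OF test_dird[OF \<psi>]], of "axis j 1"]
        mult_left_mono[OF L2norm_dird_le[OF \<psi>] L2norm_nonneg[of M \<psi>], of j] by linarith
    finally show ?thesis by (simp add: ennreal_leI mult.assoc)
  qed
  have "(\<integral>\<^sup>+x. ennreal ((\<psi> x)^4) \<partial>M) = (\<integral>\<^sup>+x. ennreal ((\<psi> x)^4) * indicator \<Omega> x \<partial>lebesgue)"
    using dom_lebesgue by (subst nn_integral_restrict_space) auto
  also have "\<dots> = (\<integral>\<^sup>+x. ennreal ((\<psi> x)^4) \<partial>lebesgue)"
    using test_outside[OF \<psi>] by (intro nn_integral_cong) (auto simp: indicator_def)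
  also have "\<dots> = (\<integral>\<^sup>+x. ennreal ((\<psi> x)^4) \<partial>lborel)" by (rule nn_integral_completion)
  also have "\<dots> \<le> ennreal (2 * L2norm M \<psi> * L2norm M (cgrad \<psi>)) * ennreal (2 * L2norm M \<psi> * L2norm M (cgrad \<psi>))"
    by (rule order_trans[OF ladyzhenskaya_test_nn[OF \<psi>]]) (intro mult_mono 1 zero_le)
  also have "\<dots> = ennreal ((2 * L2norm M \<psi> * L2norm M (cgrad \<psi>))\<^sup>2)"
    by (simp add: ennreal_mult[symmetric] power2_eq_square L2norm_nonneg)
  finally show ?thesis .
qed

text \<open>Fatou's lemma extends the inequality to $H^1_0$.\<close>

lemma ladyzhenskaya:
  assumes v: "v \<in> sobolev_H10 \<Omega>" "weak_gradient \<Omega> v g"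
  shows "L4 M v" and "N4 M v \<le> 2 * L2norm M v * L2norm M g"
proof -
  obtain \<psi> where \<psi>: "\<And>n. \<psi> n \<in> test_functions \<Omega>"
    "(\<lambda>n. L2norm M (\<lambda>x. v x - \<psi> n x)) \<longlonglongrightarrow> 0" "(\<lambda>n. L2norm M (\<lambda>x. g x - cgrad (\<psi> n) x)) \<longlonglongrightarrow> 0"
    by (rule H10_approx[OF v]) blast
  note Lv = weak_gradientD(1)[OF v(2)] and Lg = weak_gradientD(2)[OF v(2)]
  note L\<psi> = L2_test_dom[OF \<psi>(1)] and Lc = L2_cgrad[OF \<psi>(1)]
  have [measurable]: "v \<in> borel_measurable M" "\<And>n. \<psi> n \<in> borel_measurable M"
    using Lv L\<psi> by (auto dest: L2_measurable)
  have cv: "(\<lambda>n. L2norm M (fs n)) \<longlonglongrightarrow> L2norm M f"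
    if "(\<lambda>n. L2norm M (\<lambda>x. f x - fs n x)) \<longlonglongrightarrow> 0" "square_integrable M f" "\<And>n. square_integrable M (fs n)"
    for f :: "real^2 \<Rightarrow> 'b::euclidean_space" and fs
  proof -
    have "(\<lambda>n. norm (L2norm M (fs n) - L2norm M f)) \<longlonglongrightarrow> 0"
      by (rule squeeze_0[OF _ _ that(1)]) (use L2norm_diff_abs[OF that(2,3)] in \<open>auto simp: abs_minus_commute\<close>)
    then show ?thesis
      by (rule LIM_zero_cancel[OF tendsto_norm_zero_cancel])
  qed
  let ?C = "\<lambda>n. (2 * L2norm M (\<psi> n) * L2norm M (cgrad (\<psi> n)))\<^sup>2"
  have C: "?C \<longlonglongrightarrow> (2 * L2norm M v * L2norm M g)\<^sup>2"
    by (intro tendsto_intros cv \<psi> Lv Lg L\<psi> Lc)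
  \<comment> \<open>Fatou's lemma needs pointwise convergence, which L^2 convergence provides almost
    everywhere along a subsequence.\<close>
  have "\<exists>r::nat\<Rightarrow>nat. strict_mono r \<and> (AE x in M. (\<lambda>n. (v x - \<psi> (r n) x)\<^sup>2) \<longlonglongrightarrow> 0)"
  proof (rule tendsto_L1_AE_subseq)
    show "integrable M (\<lambda>x. (v x - \<psi> n x)\<^sup>2)" for n
      using L2_integrable[OF L2_diff[OF Lv L\<psi>]] by simp
    have "(\<lambda>n. (L2norm M (\<lambda>x. v x - \<psi> n x))\<^sup>2) \<longlonglongrightarrow> 0\<^sup>2" by (intro tendsto_intros \<psi>)
    then show "(\<lambda>n. LINT x|M. norm ((v x - \<psi> n x)\<^sup>2)) \<longlonglongrightarrow> 0" by (simp add: L2norm_sq)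
  qed
  then obtain r where r: "strict_mono r" "AE x in M. (\<lambda>n. (v x - \<psi> (r n) x)\<^sup>2) \<longlonglongrightarrow> 0" by blast
  have "AE x in M. (\<lambda>n. \<psi> (r n) x) \<longlonglongrightarrow> v x"
    using r(2)
  proof eventually_elim
    case (elim x)
    then have "(\<lambda>n. sqrt ((v x - \<psi> (r n) x)\<^sup>2)) \<longlonglongrightarrow> sqrt 0" by (intro tendsto_real_sqrt)
    then have "(\<lambda>n. v x - \<psi> (r n) x) \<longlonglongrightarrow> 0" by (simp add: tendsto_rabs_zero_iff)
    from tendsto_diff[OF tendsto_const[of "v x"] this] show ?case by simp
  qed
  then have "AE x in M. ennreal ((v x)^4) = liminf (\<lambda>n. ennreal ((\<psi> (r n) x)^4))"
    by eventually_elim (intro lim_imp_Liminf[symmetric] tendsto_intros; simp)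
  then have "(\<integral>\<^sup>+x. ennreal ((v x)^4) \<partial>M) = (\<integral>\<^sup>+x. liminf (\<lambda>n. ennreal ((\<psi> (r n) x)^4)) \<partial>M)"
    by (rule nn_integral_cong_AE)
  also have "\<dots> \<le> liminf (\<lambda>n. \<integral>\<^sup>+x. ennreal ((\<psi> (r n) x)^4) \<partial>M)"
    by (rule nn_integral_liminf) auto
  also have "\<dots> \<le> liminf (\<lambda>n. ennreal (?C (r n)))"
    by (intro Liminf_mono always_eventually allI ladyzhenskaya_test \<psi>)
  also have "\<dots> = ennreal ((2 * L2norm M v * L2norm M g)\<^sup>2)"
    using LIMSEQ_subseq_LIMSEQ[OF C r(1)] by (intro lim_imp_Liminf tendsto_ennrealI) (auto simp: o_def)
  finally have le: "(\<integral>\<^sup>+x. ennreal ((v x)^4) \<partial>M) \<le> ennreal ((2 * L2norm M v * L2norm M g)\<^sup>2)" .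
  then have I: "integrable M (\<lambda>x. (v x)^4)"
    by (intro integrableI_bounded) (auto intro: le_less_trans)
  then show "L4 M v"
    by (simp add: L4_def square_integrable_def)
  have "(N4 M v)\<^sup>2 = (LINT x|M. (v x)^4)"
    by (simp add: N4_def L2norm_sq)
  also have "ennreal \<dots> \<le> ennreal ((2 * L2norm M v * L2norm M g)\<^sup>2)"
    using le by (subst nn_integral_eq_integral[OF I, symmetric]) auto
  finally have "(N4 M v)\<^sup>2 \<le> (2 * L2norm M v * L2norm M g)\<^sup>2"
    by (simp add: ennreal_le_iff)
  then show "N4 M v \<le> 2 * L2norm M v * L2norm M g"
    by (rule power2_le_imp_le) (simp add: L2norm_nonneg)
qed

subsection \<open>Vector fields\<close>

text \<open>The gradient is carried as a separate argument rather than as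
  \<open>jacobian_weak\<close>: the latter is chosen anew for each function, so along a curve of
  functions it need not be measurable in space-time, whereas a given field G can be.\<close>

definition has_grad :: "(real^2 \<Rightarrow> real^2) \<Rightarrow> (real^2 \<Rightarrow> real^2^2) \<Rightarrow> bool" where
  "has_grad v G \<longleftrightarrow> v \<in> space_V \<Omega> \<and> (\<forall>i. weak_gradient \<Omega> (\<lambda>x. v x $ i) (\<lambda>x. G x $ i))"

lemma has_gradD:
  assumes "has_grad v G"
  shows "v \<in> space_V \<Omega>" "(\<lambda>x. v x $ i) \<in> sobolev_H10 \<Omega>"
    "weak_gradient \<Omega> (\<lambda>x. v x $ i) (\<lambda>x. G x $ i)"
  using assms by (auto simp: has_grad_def space_V_def)

lemma measurable_of_components:
  fixes f :: "'a \<Rightarrow> 'b::euclidean_space^2"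
  assumes "\<And>i. (\<lambda>x. f x $ i) \<in> borel_measurable N"
  shows "f \<in> borel_measurable N"
  using borel_measurable_vec_lambda[of "\<lambda>i x. f x $ i" N, OF assms] by simp

lemma has_grad_L2:
  assumes "has_grad v G" shows "square_integrable M v" "square_integrable M G"
proof -
  note w = weak_gradientD(1,2)[OF has_gradD(3)[OF assms]]
  show "square_integrable M v"
    by (rule L2_vec[OF w(1) measurable_of_components[OF L2_measurable[OF w(1)]]])
  show "square_integrable M G"
    by (rule L2_vec[OF w(2) measurable_of_components[OF L2_measurable[OF w(2)]]])
qed

lemma has_grad_jacobian: "v \<in> space_V \<Omega> \<Longrightarrow> has_grad v (jacobian_weak \<Omega> v)"
  by (auto simp: has_grad_def space_V_def jacobian_weak_def intro: H10_weak_gradient)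

lemma has_grad_unique:
  assumes "has_grad v G" "has_grad v' G'" "AE x in M. v x = v' x"
  shows "AE x in M. G x = G' x"
proof -
  have "AE x in M. G x $ i = G' x $ i" for i
    by (rule weak_gradient_unique_AE[OF has_gradD(3)[OF assms(1)] has_gradD(3)[OF assms(2)]])
       (use assms(3) in eventually_elim, simp)
  then have "AE x in M. \<forall>i. G x $ i = G' x $ i" by (simp add: AE_all_countable)
  then show ?thesis by eventually_elim (simp add: vec_eq_iff)
qed

lemma Vnorm_eq:
  assumes "has_grad v G" shows "Vnorm \<Omega> v = L2norm M G"
  unfolding Vnorm_def
  by (intro L2norm_cong_AE has_grad_unique[OF has_grad_jacobian assms] L2_measurable has_grad_L2(2)[OF assms]
      has_grad_L2(2)[OF has_grad_jacobian] has_gradD(1)[OF assms]) auto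

lemma has_grad_trace: "has_grad v G \<Longrightarrow> AE x in M. trace (G x) = 0"
proof -
  assume G: "has_grad v G"
  have "AE x in M. trace (jacobian_weak \<Omega> v x) = 0" using has_gradD(1)[OF G] by (simp add: space_V_def)
  moreover have "AE x in M. jacobian_weak \<Omega> v x = G x"
    by (rule has_grad_unique[OF has_grad_jacobian G]) (auto intro: has_gradD(1)[OF G])
  ultimately show ?thesis by eventually_elim simp
qed

lemma has_grad_lincomb:
  assumes v: "has_grad v G" and w: "has_grad w H"
  shows "has_grad (\<lambda>x. a *\<^sub>R v x + b *\<^sub>R w x) (\<lambda>x. a *\<^sub>R G x + b *\<^sub>R H x)"
proof -
  have g: "weak_gradient \<Omega> (\<lambda>x. (a *\<^sub>R v x + b *\<^sub>R w x) $ i) (\<lambda>x. (a *\<^sub>R G x + b *\<^sub>R H x) $ i)" for i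
    using weak_gradient_lincomb[OF has_gradD(3)[OF v, of i] has_gradD(3)[OF w, of i], of a b] by simp
  \<comment> \<open>The gradient chosen for the combination is unrelated to those chosen for the
    summands. It agrees with their combination only almost everywhere, and the vanishing trace is
    transported along this equality.\<close>
  have "AE x in M. \<forall>i. wgrad \<Omega> (\<lambda>y. (a *\<^sub>R v y + b *\<^sub>R w y) $ i) x = (a *\<^sub>R G x + b *\<^sub>R H x) $ i"
    unfolding AE_all_countable by (intro allI wgrad_AE g)
  moreover note has_grad_trace[OF v] has_grad_trace[OF w]
  ultimately have "AE x in M. trace (jacobian_weak \<Omega> (\<lambda>x. a *\<^sub>R v x + b *\<^sub>R w x) x) = 0"
  proof eventually_elim
    case (elim x)
    then have "jacobian_weak \<Omega> (\<lambda>x. a *\<^sub>R v x + b *\<^sub>R w x) x = a *\<^sub>R G x + b *\<^sub>R H x"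
      unfolding jacobian_weak_def by (simp add: vec_eq_iff)
    then have "trace (jacobian_weak \<Omega> (\<lambda>x. a *\<^sub>R v x + b *\<^sub>R w x) x) = a * trace (G x) + b * trace (H x)"
      by (simp add: trace_def sum_2 algebra_simps)
    then show ?case using elim by simp
  qed
  then show ?thesis
    using g H10_lincomb[OF has_gradD(2)[OF v] has_gradD(2)[OF w], of a _ b]
    by (auto simp: has_grad_def space_V_def)
qed

lemma has_grad_diff: "has_grad v G \<Longrightarrow> has_grad w H \<Longrightarrow> has_grad (\<lambda>x. v x - w x) (\<lambda>x. G x - H x)"
  using has_grad_lincomb[of v G w H 1 "-1"] by simp

lemma has_grad_zero: "has_grad (\<lambda>_. 0) (\<lambda>_. 0)"
proof -
  have "AE x in M. \<forall>i::2. wgrad \<Omega> (\<lambda>y. 0) x = 0"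
    unfolding AE_all_countable using wgrad_AE[OF weak_gradient_zero] by simp
  then have "AE x in M. trace (jacobian_weak \<Omega> (\<lambda>x. 0) x) = 0"
    by eventually_elim (simp add: jacobian_weak_def trace_def)
  then show ?thesis
    by (simp add: has_grad_def space_V_def H10_zero weak_gradient_zero)
qed

text \<open>The square of the length is the sum of the squares of the two components; each of them
  contributes the scalar constant 2, which gives 4.\<close>

lemma ladyzhenskaya_vec:
  assumes "has_grad v G"
  shows "L4 M v" and "N4 M v \<le> 4 * L2norm M v * L2norm M G"
proof -
  note i = ladyzhenskaya[OF has_gradD(2,3)[OF assms]]
  note L = has_grad_L2[OF assms]
  have s: "square_integrable M (\<lambda>x. (v x $ i)\<^sup>2)" for i
    using i(1)[of i] by (simp add: L4_def)
  have eq: "(\<lambda>x. (norm (v x))\<^sup>2) = (\<lambda>x. (v x $ 1)\<^sup>2 + (v x $ 2)\<^sup>2)" by (simp add: norm_sq_vec2)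
  show "L4 M v" unfolding L4_def eq by (intro conjI L2_add s L2_measurable L)
  have c: "L2norm M (\<lambda>x. (v x $ i)\<^sup>2) \<le> 2 * L2norm M v * L2norm M G" for i
  proof -
    have "L2norm M (\<lambda>x. (v x $ i)\<^sup>2) \<le> 2 * (L2norm M (\<lambda>x. v x $ i) * L2norm M (\<lambda>x. G x $ i))"
      using i(2)[of i] by (simp add: N4_def)
    also have "\<dots> \<le> 2 * (L2norm M v * L2norm M G)"
      by (intro mult_left_mono mult_mono L2norm_nth_le L L2norm_nonneg) auto
    finally show ?thesis by simp
  qed
  have "N4 M v \<le> L2norm M (\<lambda>x. (v x $ 1)\<^sup>2) + L2norm M (\<lambda>x. (v x $ 2)\<^sup>2)"
    unfolding N4_def eq by (intro L2norm_triangle s)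
  also have "\<dots> \<le> 4 * L2norm M v * L2norm M G" using c[of 1] c[of 2] by linarith
  finally show "N4 M v \<le> 4 * L2norm M v * L2norm M G" .
qed

end

section \<open>The convective term and Korn's inequality\<close>

lemma norm_matrix_vector_le: "norm (A *v x) \<le> norm (A::real^2^2) * norm x"
proof (rule power2_le_imp_le)
  have c: "(A$i \<bullet> x)\<^sup>2 \<le> (norm (A$i))\<^sup>2 * (norm x)\<^sup>2" for i
    using power_mono[OF Cauchy_Schwarz_ineq2[of "A$i" x], of 2] by (simp add: power_mult_distrib)
  have "(A *v x) $ i = A$i \<bullet> x" for i
    by (simp add: matrix_vector_mult_def inner_vec_def)
  then have "(norm (A *v x))\<^sup>2 = (A$1 \<bullet> x)\<^sup>2 + (A$2 \<bullet> x)\<^sup>2" by (simp add: norm_sq_vec2)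
  also have "\<dots> \<le> (norm A * norm x)\<^sup>2"
    using c[of 1] c[of 2] by (simp add: power_mult_distrib norm_sq_mat2 distrib_right)
  finally show "(norm (A *v x))\<^sup>2 \<le> (norm A * norm x)\<^sup>2" .
qed simp

lemma matrix_vector_inner: "(A *v x) \<bullet> y = (A$1 \<bullet> x) * y$1 + (A$2 \<bullet> x) * y$(2::2)"
  by (simp add: matrix_vector_mult_def inner_vec_def sum_2)

lemma borel_measurable_matrix_vector [measurable]:
  fixes A :: "'a \<Rightarrow> real^2^2"
  assumes "A \<in> borel_measurable M" "x \<in> borel_measurable M"
  shows "(\<lambda>z. A z *v x z) \<in> borel_measurable M"
  unfolding matrix_vector_mult_def using assms by measurable

lemma sym_part_nth: "sym_part A $ i $ j = (A $ i $ j + A $ j $ i) / 2"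
  by (simp add: sym_part_def transpose_def)

lemma norm_sym_part_le: "norm (sym_part A) \<le> norm A" for A :: "real^2^2"
proof (rule power2_le_imp_le)
  have "(norm A)\<^sup>2 - (norm (sym_part A))\<^sup>2 = (A$1$2 - A$2$1)\<^sup>2 / 2"
    unfolding norm_sq_mat2 norm_sq_vec2 sym_part_nth by (simp add: power2_eq_square field_simps)
  then show "(norm (sym_part A))\<^sup>2 \<le> (norm A)\<^sup>2"
    by (metis diff_ge_0_iff_ge divide_nonneg_nonneg zero_le_numeral zero_le_power2)
qed simp

lemma borel_measurable_sym_part [measurable (raw)]:
  assumes "G \<in> borel_measurable N" shows "(\<lambda>z. sym_part (G z)) \<in> borel_measurable N"
proof -
  have "sym_part A = (\<chi> i. \<chi> j. (A $ i $ j + A $ j $ i) / 2)" for A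
    by (simp add: vec_eq_iff sym_part_nth)
  then show ?thesis using assms by simp
qed

context bounded_open
begin

text \<open>Integrating each coordinate by parts turns the integrand into the trace of G times the
  test function, and the trace vanishes almost everywhere on fields of V.\<close>

lemma divergence_free_test:
  assumes u: "has_grad u G" and \<psi>: "\<psi> \<in> test_functions \<Omega>"
  shows "(LINT x|M. u x \<bullet> cgrad \<psi> x) = 0"
proof -
  note L = has_grad_L2[OF u] and L\<psi> = L2_test_dom[OF \<psi>] and Lc = L2_cgrad[OF \<psi>]
  have "(LINT x|M. u x \<bullet> cgrad \<psi> x) = (LINT x|M. u x $ 1 * cgrad \<psi> x $ 1 + u x $ 2 * cgrad \<psi> x $ 2)"
    by (simp add: inner_vec_def sum_2)
  also have "\<dots> = (LINT x|M. u x $ 1 * cgrad \<psi> x $ 1) + (LINT x|M. u x $ 2 * cgrad \<psi> x $ 2)"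
    by (intro Bochner_Integration.integral_add L2_mult_real L2_nth L Lc)
  also have "\<dots> = - ((LINT x|M. G x $ 1 $ 1 * \<psi> x) + (LINT x|M. G x $ 2 $ 2 * \<psi> x))"
    by (simp add: weak_gradientD(3)[OF has_gradD(3)[OF u] \<psi>])
  also have "(LINT x|M. G x $ 1 $ 1 * \<psi> x) + (LINT x|M. G x $ 2 $ 2 * \<psi> x) = (LINT x|M. G x $ 1 $ 1 * \<psi> x + G x $ 2 $ 2 * \<psi> x)"
    by (intro Bochner_Integration.integral_add[symmetric] L2_mult_real L2_nth L L\<psi>)
  also have "\<dots> = (LINT x|M. 0)"
  proof (rule integral_cong_AE)
    show "(\<lambda>x. G x $ 1 $ 1 * \<psi> x + G x $ 2 $ 2 * \<psi> x) \<in> borel_measurable M"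
      using L2_measurable[OF L(2)] L2_measurable[OF L\<psi>] by measurable
    show "AE x in M. G x $ 1 $ 1 * \<psi> x + G x $ 2 $ 2 * \<psi> x = 0"
      using has_grad_trace[OF u] by eventually_elim (simp add: trace_def sum_2 distrib_right[symmetric])
  qed simp
  finally show ?thesis by simp
qed

lemma triple_real:
  fixes h u :: "real^2 \<Rightarrow> real^2" and v :: "real^2 \<Rightarrow> real"
  assumes "square_integrable M h" "L4 M u" "L4 M v"
  shows "integrable M (\<lambda>x. (h x \<bullet> u x) * v x)"
    and "\<bar>LINT x|M. (h x \<bullet> u x) * v x\<bar> \<le> L2norm M h * sqrt (N4 M u * N4 M v)"
proof -
  note t = triple_product[OF assms]
  have [measurable]: "h \<in> borel_measurable M" "u \<in> borel_measurable M" "v \<in> borel_measurable M"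
    using assms by (auto simp: L4_def dest: L2_measurable)
  have le: "norm ((h x \<bullet> u x) * v x) \<le> norm (h x) * (norm (u x) * norm (v x))" for x
    using mult_right_mono[OF Cauchy_Schwarz_ineq2[of "h x" "u x"], of "norm (v x)"] by (simp add: abs_mult mult.assoc)
  show i: "integrable M (\<lambda>x. (h x \<bullet> u x) * v x)"
    by (rule Bochner_Integration.integrable_bound[OF t(1)]) (use le in \<open>auto simp: abs_mult\<close>)
  have "\<bar>LINT x|M. (h x \<bullet> u x) * v x\<bar> \<le> (LINT x|M. norm ((h x \<bullet> u x) * v x))"
    unfolding real_norm_def[symmetric] by (rule integral_norm_bound)
  also have "\<dots> \<le> (LINT x|M. norm (h x) * (norm (u x) * norm (v x)))"
    by (intro integral_mono integrable_norm i t le)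
  also note t(2)
  finally show "\<bar>LINT x|M. (h x \<bullet> u x) * v x\<bar> \<le> L2norm M h * sqrt (N4 M u * N4 M v)" .
qed

text \<open>For a test function, v grad v is half the gradient of v^2, against which a
  divergence-free field integrates to zero. Density extends this, since Ladyzhenskaya's inequality
  makes the trilinear integral continuous in the H^1 norm of v.\<close>

lemma transport_zero_scalar:
  assumes u: "has_grad u G" and v: "v \<in> sobolev_H10 \<Omega>" "weak_gradient \<Omega> v g"
  shows "(LINT x|M. (g x \<bullet> u x) * v x) = 0"
proof -
  obtain \<psi> where \<psi>: "\<And>n. \<psi> n \<in> test_functions \<Omega>"
    "(\<lambda>n. L2norm M (\<lambda>x. v x - \<psi> n x)) \<longlonglongrightarrow> 0" "(\<lambda>n. L2norm M (\<lambda>x. g x - cgrad (\<psi> n) x)) \<longlonglongrightarrow> 0"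
    by (rule H10_approx[OF v]) blast
  have \<psi>H: "\<psi> n \<in> sobolev_H10 \<Omega>" for n
    by (rule H10I[OF weak_gradient_test[OF \<psi>(1)], where \<psi>="\<lambda>_. \<psi> n"]) (auto intro: \<psi>(1) simp: L2norm_def)
  have dH: "(\<lambda>x. v x - \<psi> n x) \<in> sobolev_H10 \<Omega>" for n
    using H10_lincomb[OF v(1) \<psi>H[of n], of 1 "-1"] by simp
  note dg = weak_gradient_diff[OF v(2) weak_gradient_test[OF \<psi>(1)]]
  note Lv = weak_gradientD(1)[OF v(2)] and Lg = weak_gradientD(2)[OF v(2)]
  note L\<psi> = L2_test_dom[OF \<psi>(1)] and Lc = L2_cgrad[OF \<psi>(1)]
  note u4 = ladyzhenskaya_vec(1)[OF u] and v4 = ladyzhenskaya(1)[OF v]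
    and \<psi>4 = ladyzhenskaya(1)[OF \<psi>H weak_gradient_test[OF \<psi>(1)]] and d4 = ladyzhenskaya[OF dH dg]
  define d e where "d n = L2norm M (\<lambda>x. v x - \<psi> n x)" and "e n = L2norm M (\<lambda>x. g x - cgrad (\<psi> n) x)" for n
  have z: "(LINT x|M. (cgrad (\<psi> n) x \<bullet> u x) * \<psi> n x) = 0" for n
  proof -
    have "cgrad (\<lambda>x. \<psi> n x * \<psi> n x) x = 2 *\<^sub>R (\<psi> n x *\<^sub>R cgrad (\<psi> n) x)" for x
      by (simp add: cgrad_def vec_eq_iff dird_mult[OF \<psi>(1) \<psi>(1)])
    then have "u x \<bullet> cgrad (\<lambda>x. \<psi> n x * \<psi> n x) x = 2 * ((cgrad (\<psi> n) x \<bullet> u x) * \<psi> n x)" for x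
      by (simp add: inner_commute)
    then show ?thesis
      using divergence_free_test[OF u test_mult[OF \<psi>(1) \<psi>(1)], of n n] by simp
  qed
  have "norm (LINT x|M. (g x \<bullet> u x) * v x)
    \<le> e n * sqrt (N4 M u * N4 M v) + (L2norm M g + e n) * sqrt (N4 M u * (2 * d n * e n))" for n
  proof -
    note t1 = triple_real[OF L2_diff[OF Lg Lc[of n]] u4 v4] and t2 = triple_real[OF Lc[of n] u4 d4(1)[of n]]
      and t3 = triple_real[OF Lc[of n] u4 \<psi>4[of n]]
    \<comment> \<open>A telescoping sum that replaces first the gradient and then the function by
      the approximating test function. The last term is the one known to vanish by
      \<open>z\<close>.\<close>
    have "(LINT x|M. (g x \<bullet> u x) * v x) = (LINT x|M. ((g x - cgrad (\<psi> n) x) \<bullet> u x) * v x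
        + (cgrad (\<psi> n) x \<bullet> u x) * (v x - \<psi> n x) + (cgrad (\<psi> n) x \<bullet> u x) * \<psi> n x)"
      by (intro Bochner_Integration.integral_cong refl) (simp add: inner_diff_left algebra_simps)
    also have "\<dots> = (LINT x|M. ((g x - cgrad (\<psi> n) x) \<bullet> u x) * v x) + (LINT x|M. (cgrad (\<psi> n) x \<bullet> u x) * (v x - \<psi> n x))"
      using t1(1) t2(1) t3(1) z[of n] by simp
    finally have "norm (LINT x|M. (g x \<bullet> u x) * v x)
       \<le> e n * sqrt (N4 M u * N4 M v) + L2norm M (cgrad (\<psi> n)) * sqrt (N4 M u * N4 M (\<lambda>x. v x - \<psi> n x))"
      using t1(2) t2(2) unfolding e_def real_norm_def by linarith
    also have "L2norm M (cgrad (\<psi> n)) * sqrt (N4 M u * N4 M (\<lambda>x. v x - \<psi> n x))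
        \<le> (L2norm M g + e n) * sqrt (N4 M u * (2 * d n * e n))"
    proof (intro mult_mono real_sqrt_le_mono mult_left_mono)
      show "L2norm M (cgrad (\<psi> n)) \<le> L2norm M g + e n"
        using L2norm_diff_triangle[OF Lg L2_diff[OF Lg Lc[of n]]] by (simp add: e_def)
      show "N4 M (\<lambda>x. v x - \<psi> n x) \<le> 2 * d n * e n" using d4(2) by (simp add: d_def e_def)
    qed (auto simp: N4_nonneg L2norm_nonneg e_def)
    finally show ?thesis by simp
  qed
  moreover have "(\<lambda>n. e n * sqrt (N4 M u * N4 M v) + (L2norm M g + e n) * sqrt (N4 M u * (2 * d n * e n)))
      \<longlonglongrightarrow> 0 * sqrt (N4 M u * N4 M v) + (L2norm M g + 0) * sqrt (N4 M u * (2 * 0 * 0))"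
    by (intro tendsto_intros) (use \<psi>(2,3) in \<open>simp_all add: d_def e_def\<close>)
  ultimately have "norm (LINT x|M. (g x \<bullet> u x) * v x) \<le> 0 * sqrt (N4 M u * N4 M v) + (L2norm M g + 0) * sqrt (N4 M u * (2 * 0 * 0))"
    by (intro tendsto_lowerbound[OF _ always_eventually]) auto
  then show ?thesis by simp
qed

text \<open>The trilinear form of the Navier-Stokes equations. Since G is an independent argument,
  the transporting field u and the field being transported can differ.\<close>

definition conv :: "(real^2 \<Rightarrow> real^2^2) \<Rightarrow> (real^2 \<Rightarrow> real^2) \<Rightarrow> (real^2 \<Rightarrow> real^2) \<Rightarrow> real" where
  "conv G u w = (LINT x|M. (G x *v u x) \<bullet> w x)"

lemma conv_bound:
  assumes "square_integrable M G" "L4 M u" "L4 M w"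
  shows "integrable M (\<lambda>x. (G x *v u x) \<bullet> w x)"
    and "\<bar>conv G u w\<bar> \<le> L2norm M G * sqrt (N4 M u * N4 M w)"
proof -
  note t = triple_product[OF assms]
  have [measurable]: "G \<in> borel_measurable M" "u \<in> borel_measurable M" "w \<in> borel_measurable M"
    using assms by (auto simp: L4_def dest: L2_measurable)
  have le: "norm ((G x *v u x) \<bullet> w x) \<le> norm (G x) * (norm (u x) * norm (w x))" for x
    using Cauchy_Schwarz_ineq2[of "G x *v u x" "w x"] mult_right_mono[OF norm_matrix_vector_le[of "G x" "u x"], of "norm (w x)"]
    by (simp add: mult.assoc)
  show i: "integrable M (\<lambda>x. (G x *v u x) \<bullet> w x)"
    by (rule Bochner_Integration.integrable_bound[OF t(1)]) (use le in auto)
  have "\<bar>LINT x|M. (G x *v u x) \<bullet> w x\<bar> \<le> (LINT x|M. norm ((G x *v u x) \<bullet> w x))"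
    unfolding real_norm_def[symmetric] by (rule integral_norm_bound)
  also have "\<dots> \<le> (LINT x|M. norm (G x) * (norm (u x) * norm (w x)))"
    by (intro integral_mono integrable_norm i t le)
  also note t(2)
  finally show "\<bar>conv G u w\<bar> \<le> L2norm M G * sqrt (N4 M u * N4 M w)" by (simp add: conv_def)
qed

text \<open>The form splits into one scalar transport integral for each component of w, and each of
  them vanishes.\<close>

lemma conv_zero:
  assumes u: "has_grad u Gu" and w: "has_grad w H"
  shows "conv H u w = 0"
proof -
  have i: "integrable M (\<lambda>x. (H x $ i \<bullet> u x) * w x $ i)" for i
    by (intro triple_real(1) L2_nth has_grad_L2[OF w] ladyzhenskaya_vec(1)[OF u] ladyzhenskaya(1)[OF has_gradD(2,3)[OF w]])
  have "conv H u w = (LINT x|M. (H x $ 1 \<bullet> u x) * w x $ 1) + (LINT x|M. (H x $ 2 \<bullet> u x) * w x $ 2)"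
    using i by (simp add: conv_def matrix_vector_inner)
  then show ?thesis
    using transport_zero_scalar[OF u has_gradD(2,3)[OF w]] by simp
qed

text \<open>The difference of the convective terms is (w.grad) u1 + (u2.grad) w. Tested with w, the
  second summand is zero, and the first is bounded through the L^4 norm of w alone.\<close>

lemma conv_difference:
  assumes u1: "has_grad u1 G1" and u2: "has_grad u2 G2"
  defines "w \<equiv> \<lambda>x. u1 x - u2 x" and "H \<equiv> \<lambda>x. G1 x - G2 x"
  shows "\<bar>conv G1 u1 w - conv G2 u2 w\<bar> \<le> 4 * L2norm M G1 * L2norm M w * L2norm M H"
proof -
  have w: "has_grad w H" unfolding w_def H_def by (rule has_grad_diff[OF u1 u2])
  note w4 = ladyzhenskaya_vec[OF w] and u14 = ladyzhenskaya_vec(1)[OF u1] and u24 = ladyzhenskaya_vec(1)[OF u2]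
  note i1 = conv_bound(1)[OF has_grad_L2(2)[OF u1] u14 w4(1)] and i2 = conv_bound(1)[OF has_grad_L2(2)[OF u2] u24 w4(1)]
    and i3 = conv_bound(1)[OF has_grad_L2(2)[OF u1] w4(1) w4(1)] and i4 = conv_bound(1)[OF has_grad_L2(2)[OF w] u24 w4(1)]
  have "conv G1 u1 w - conv G2 u2 w = (LINT x|M. (G1 x *v u1 x) \<bullet> w x - (G2 x *v u2 x) \<bullet> w x)"
    using i1 i2 by (simp add: conv_def)
  also have "\<dots> = (LINT x|M. (G1 x *v w x) \<bullet> w x + (H x *v u2 x) \<bullet> w x)"
    by (intro Bochner_Integration.integral_cong refl)
       (simp add: w_def H_def matrix_vector_mult_diff_distrib matrix_vector_mult_diff_rdistrib inner_diff_left)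
  also have "\<dots> = conv G1 w w + conv H u2 w"
    using i3 i4 by (simp add: conv_def)
  also have "\<dots> = conv G1 w w" by (simp add: conv_zero[OF u2 w])
  finally have "\<bar>conv G1 u1 w - conv G2 u2 w\<bar> \<le> L2norm M G1 * sqrt (N4 M w * N4 M w)"
    using conv_bound(2)[OF has_grad_L2(2)[OF u1] w4(1) w4(1)] by simp
  also have "\<dots> = L2norm M G1 * N4 M w" by (simp add: N4_nonneg)
  also have "\<dots> \<le> L2norm M G1 * (4 * L2norm M w * L2norm M H)"
    by (intro mult_left_mono w4 L2norm_nonneg)
  finally show ?thesis by (simp add: mult.assoc mult.left_commute)
qed

text \<open>For a matrix of trace zero, |sym H|^2 equals |H|^2 / 2 minus the determinant of H, and
  the integral of the determinant vanishes by \<open>H10_grad_swap\<close>.\<close>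

lemma korn_identity:
  assumes w: "has_grad w H"
  shows "(LINT x|M. (norm (sym_part (H x)))\<^sup>2) = (L2norm M H)\<^sup>2 / 2"
proof -
  note L = has_grad_L2(2)[OF w]
  have i: "integrable M (\<lambda>x. H x $ i $ j * H x $ k $ l)" for i j k l
    by (intro L2_mult_real L2_nth L)
  have sw: "(LINT x|M. H x $ 1 $ 1 * H x $ 2 $ 2) = (LINT x|M. H x $ 1 $ 2 * H x $ 2 $ 1)"
    using H10_grad_swap[OF has_gradD(2,3)[OF w, of 1] has_gradD(2,3)[OF w, of 2], of 1 2] by (simp add: mult.commute)
  have [measurable]: "H \<in> borel_measurable M" by (rule L2_measurable[OF L])
  have "(LINT x|M. (norm (sym_part (H x)))\<^sup>2)
     = (LINT x|M. (norm (H x))\<^sup>2 / 2 + (H x $ 1 $ 2 * H x $ 2 $ 1 - H x $ 1 $ 1 * H x $ 2 $ 2))"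
  proof (rule integral_cong_AE)
    show "AE x in M. (norm (sym_part (H x)))\<^sup>2 = (norm (H x))\<^sup>2 / 2 + (H x $ 1 $ 2 * H x $ 2 $ 1 - H x $ 1 $ 1 * H x $ 2 $ 2)"
      using has_grad_trace[OF w]
    proof eventually_elim
      case (elim x)
      then have "H x $ 2 $ 2 = - H x $ 1 $ 1" by (simp add: trace_def sum_2)
      then show ?case
        unfolding norm_sq_mat2 norm_sq_vec2 sym_part_nth by (simp add: power2_eq_square field_simps)
    qed
  qed measurable
  also have "\<dots> = (L2norm M H)\<^sup>2 / 2"
    using i L2_integrable[OF L] sw by (simp add: L2norm_sq)
  finally show ?thesis .
qed

end

section \<open>Monotonicity of the Bingham law\<close>

definition bingham_rel :: "real \<Rightarrow> real \<Rightarrow> real^2^2 \<Rightarrow> real^2^2 \<Rightarrow> bool" where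
  "bingham_rel \<mu> \<tau>y A S \<longleftrightarrow>
     (A \<noteq> 0 \<longrightarrow> S = (2 * \<mu> + \<tau>y / norm A) *\<^sub>R A) \<and> (A = 0 \<longrightarrow> norm S \<le> \<tau>y)"

text \<open>In both cases the plastic part \<open>S - 2 \<mu> A\<close> is a subgradient of \<open>\<tau>y |\<cdot>|\<close> at \<open>A\<close>.\<close>

lemma bingham_rel_subgradient:
  assumes "bingham_rel \<mu> \<tau>y A S" "\<tau>y > 0"
  shows "(S - (2 * \<mu>) *\<^sub>R A) \<bullet> (B - A) \<le> \<tau>y * norm B - \<tau>y * norm A"
proof -
  let ?P = "S - (2 * \<mu>) *\<^sub>R A"
  have P: "norm ?P \<le> \<tau>y \<and> ?P \<bullet> A = \<tau>y * norm A"
  proof (cases "A = 0")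
    case False
    then have "?P = (\<tau>y / norm A) *\<^sub>R A" using assms by (simp add: bingham_rel_def scaleR_add_left)
    then show ?thesis
      using False assms(2) by (simp add: power2_norm_eq_inner[symmetric] power2_eq_square)
  qed (use assms in \<open>simp add: bingham_rel_def\<close>)
  have "?P \<bullet> B \<le> norm ?P * norm B" by (rule norm_cauchy_schwarz)
  also have "\<dots> \<le> \<tau>y * norm B" using P by (intro mult_right_mono) auto
  finally show ?thesis using P by (simp add: inner_diff_right)
qed

text \<open>The subgradient inequality at A tested at B, and the one at B tested at A, are added.
  The yield terms on the right cancel, and the viscous parts supply 2 \<mu> |A - B|^2.\<close>

lemma bingham_rel_monotone:
  assumes "bingham_rel \<mu> \<tau>y A S" "bingham_rel \<mu> \<tau>y B R" "\<tau>y > 0"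
  shows "2 * \<mu> * (norm (A - B))\<^sup>2 \<le> (S - R) \<bullet> (A - B)"
  using bingham_rel_subgradient[OF assms(1,3), of B] bingham_rel_subgradient[OF assms(2,3), of A]
  by (simp add: power2_norm_eq_inner inner_diff_left inner_diff_right inner_commute algebra_simps)

section \<open>Fubini's theorem for Lebesgue measurable functions on the space-time cylinder\<close>

lemma AE_lebesgue_on_iff:
  fixes A :: "'a::euclidean_space set"
  assumes "A \<in> sets lebesgue"
  shows "(AE x in lebesgue_on A. P x) \<longleftrightarrow> (AE x in lborel. x \<in> A \<longrightarrow> P x)"
  using assms by (simp add: AE_restrict_space_iff AE_completion_iff)

text \<open>Completeness of Lebesgue measure. It passes measurability from a Borel representative to
  the function as given, of which nothing but its almost everywhere values may be known.\<close>

lemma borel_measurable_lebesgue_on_AE: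
  fixes f g :: "'a::euclidean_space \<Rightarrow> real"
  assumes "f \<in> borel_measurable (lebesgue_on A)" "A \<in> sets lebesgue" "AE x in lebesgue_on A. f x = g x"
  shows "g \<in> borel_measurable (lebesgue_on A)"
proof -
  have 1: "(\<lambda>x. indicator A x * f x) \<in> borel_measurable lebesgue"
    using assms by (subst (asm) borel_measurable_restrict_space_iff) auto
  have "AE x in lebesgue. x \<in> A \<longrightarrow> f x = g x"
    using assms(2,3) by (simp add: AE_restrict_space_iff)
  then have "AE x in lebesgue. indicator A x * f x = indicator A x * g x"
    by eventually_elim (auto simp: indicator_def)
  from borel_measurable_AE[OF 1 this] show ?thesis
    using assms(2) by (subst borel_measurable_restrict_space_iff) auto
qed

lemma borel_measurable_lebesgue_onI:
  fixes f :: "'a::euclidean_space \<Rightarrow> 'b::topological_space"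
  shows "f \<in> borel_measurable borel \<Longrightarrow> f \<in> borel_measurable (lebesgue_on A)"
  by (intro measurable_restrict_space1 measurable_completion) simp

lemma nn_integral_lebesgue_on_eq_lborel:
  fixes A :: "'a::euclidean_space set"
  assumes "A \<in> sets lebesgue" "\<And>x. x \<notin> A \<Longrightarrow> f x = 0"
  shows "integral\<^sup>N (lebesgue_on A) f = integral\<^sup>N lborel f"
proof -
  have "integral\<^sup>N (lebesgue_on A) f = (\<integral>\<^sup>+x. f x * indicator A x \<partial>lebesgue)"
    using assms(1) by (subst nn_integral_restrict_space) auto
  also have "\<dots> = integral\<^sup>N lebesgue f"
    using assms(2) by (intro nn_integral_cong) (auto simp: indicator_def)
  finally show ?thesis by (simp add: nn_integral_completion)
qed

lemma AE_lborel_prod_swap: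
  fixes P :: "'a::euclidean_space \<times> 'b::euclidean_space \<Rightarrow> bool"
  assumes "AE z in lborel. P z"
  shows "AE t in lborel. AE x in lborel. P (x, t)"
proof -
  obtain N where N: "N \<in> null_sets lborel" "{z. \<not> P z} \<subseteq> N"
    using assms by (auto elim!: AE_E simp: null_sets_def)
  have m: "N \<in> sets (lborel \<Otimes>\<^sub>M lborel)" unfolding lborel_prod using N(1) by (simp add: null_sets_def)
  then have "(\<integral>\<^sup>+t. \<integral>\<^sup>+x. indicator N (x, t) \<partial>lborel \<partial>lborel) = (\<integral>\<^sup>+z. indicator N z \<partial>(lborel \<Otimes>\<^sub>M lborel))"
    by (subst lborel_pair.nn_integral_snd) (simp_all add: case_prod_eta split_beta')
  also have "\<dots> = 0" using N(1) by (simp add: lborel_prod null_sets_def)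
  finally have z: "(\<integral>\<^sup>+t. \<integral>\<^sup>+x. indicator N (x, t) \<partial>lborel \<partial>lborel) = 0" .
  have m1: "(\<lambda>t. \<integral>\<^sup>+x. indicator N (x, t) \<partial>lborel) \<in> borel_measurable lborel"
    by (intro lborel.borel_measurable_nn_integral) (use m in measurable)
  have "AE t in lborel. (\<integral>\<^sup>+x. indicator N (x, t) \<partial>lborel) = 0"
    using z nn_integral_0_iff_AE[OF m1] by simp
  then show ?thesis
  proof eventually_elim
    case (elim t)
    have "(\<lambda>x. indicator N (x, t) :: ennreal) \<in> borel_measurable lborel" using m by measurable
    with elim have "AE x in lborel. indicator N (x, t) = (0::ennreal)"
      by (subst (asm) nn_integral_0_iff_AE) auto
    then show ?case by eventually_elim (use N(2) in \<open>auto simp: indicator_def split: if_splits\<close>)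
  qed
qed

context bounded_open
begin

abbreviation It where "It T \<equiv> lebesgue_on {0<..<T::real}"

lemma cyl_open: "open (\<Omega> \<times> {0<..<T::real})"
  using open_dom by (simp add: open_Times)

lemma cyl_sets: "\<Omega> \<times> {0<..<T::real} \<in> sets lebesgue" "\<Omega> \<times> {0<..<T::real} \<in> sets borel"
  using cyl_open[of T] by auto

lemma spacetime_AE:
  assumes "AE z in spacetime \<Omega> T. P z"
  shows "AE t in It T. AE x in M. P (x, t)"
proof -
  have "AE z in lborel. z \<in> \<Omega> \<times> {0<..<T} \<longrightarrow> P z"
    using assms unfolding spacetime_def AE_lebesgue_on_iff[OF cyl_sets(1)] .
  then have "AE t in lborel. AE x in lborel. (x, t) \<in> \<Omega> \<times> {0<..<T} \<longrightarrow> P (x, t)"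
    by (rule AE_lborel_prod_swap)
  then have "AE t in lborel. t \<in> {0<..<T} \<longrightarrow> (AE x in lborel. x \<in> \<Omega> \<longrightarrow> P (x, t))"
    by eventually_elim (auto elim: eventually_mono)
  then show ?thesis by (simp add: AE_lebesgue_on_iff dom_lebesgue)
qed

text \<open>Completed measure on the cylinder is not the product of the completed measures on the
  factors, and a Lebesgue measurable function may have nonmeasurable slices at a null set of times.
  Fubini's theorem is therefore applied to a Borel function that agrees with the given one on almost
  every slice.\<close>

lemma spacetime_representative:
  fixes F :: "(real^2) \<times> real \<Rightarrow> real"
  assumes "F \<in> borel_measurable (spacetime \<Omega> T)"
  obtains F' where "F' \<in> borel_measurable borel" "\<And>z. z \<notin> \<Omega> \<times> {0<..<T} \<Longrightarrow> F' z = 0"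
    "AE z in spacetime \<Omega> T. F z = F' z" "AE t in It T. AE x in M. F (x, t) = F' (x, t)"
proof -
  let ?Q = "\<Omega> \<times> {0<..<T}"
  obtain F0 where F0: "F0 \<in> borel_measurable borel" "AE z in lborel. indicator ?Q z * F z = F0 z"
    by (rule lebesgue_on_borel_representative[OF assms[unfolded spacetime_def] cyl_sets(1)])
  let ?F = "\<lambda>z. indicator ?Q z * F0 z"
  have "AE z in lborel. z \<in> ?Q \<longrightarrow> F z = ?F z"
    using F0(2) by eventually_elim (auto simp: indicator_def split: if_splits)
  then have ae: "AE z in spacetime \<Omega> T. F z = ?F z"
    unfolding spacetime_def AE_lebesgue_on_iff[OF cyl_sets(1)] .
  show thesis
  proof (rule that)
    show "?F \<in> borel_measurable borel" using F0(1) cyl_sets(2) by measurable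
    show "AE t in It T. AE x in M. F (x, t) = ?F (x, t)" by (rule spacetime_AE[OF ae])
  qed (use ae in auto)
qed

lemma spacetime_nn_integral:
  fixes F :: "(real^2) \<times> real \<Rightarrow> real"
  assumes F: "F \<in> borel_measurable (spacetime \<Omega> T)"
  shows "(\<integral>\<^sup>+z. ennreal (F z) \<partial>spacetime \<Omega> T) = (\<integral>\<^sup>+t. \<integral>\<^sup>+x. ennreal (F (x, t)) \<partial>M \<partial>It T)"
proof -
  obtain F' where F': "F' \<in> borel_measurable borel" "\<And>z. z \<notin> \<Omega> \<times> {0<..<T} \<Longrightarrow> F' z = 0"
    "AE z in spacetime \<Omega> T. F z = F' z" "AE t in It T. AE x in M. F (x, t) = F' (x, t)"
    by (rule spacetime_representative[OF F]) blast
  have m: "(\<lambda>z. ennreal (F' z)) \<in> borel_measurable (lborel \<Otimes>\<^sub>M lborel)" using F'(1) by (simp add: lborel_prod)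
  have "(\<integral>\<^sup>+z. ennreal (F z) \<partial>spacetime \<Omega> T) = (\<integral>\<^sup>+z. ennreal (F' z) \<partial>spacetime \<Omega> T)"
    by (rule nn_integral_cong_AE) (use F'(3) in eventually_elim, simp)
  also have "\<dots> = (\<integral>\<^sup>+z. ennreal (F' z) \<partial>lborel)"
    unfolding spacetime_def using cyl_sets(1) F'(2) by (intro nn_integral_lebesgue_on_eq_lborel) auto
  also have "\<dots> = (\<integral>\<^sup>+z. ennreal (F' z) \<partial>(lborel \<Otimes>\<^sub>M lborel))" by (simp add: lborel_prod)
  also have "\<dots> = (\<integral>\<^sup>+t. \<integral>\<^sup>+x. ennreal (F' (x, t)) \<partial>lborel \<partial>lborel)"
    by (rule lborel_pair.nn_integral_snd[symmetric]) (use m in \<open>simp add: case_prod_eta\<close>)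
  also have "\<dots> = (\<integral>\<^sup>+t. \<integral>\<^sup>+x. ennreal (F' (x, t)) \<partial>lborel \<partial>It T)"
    by (rule nn_integral_lebesgue_on_eq_lborel[symmetric]) (auto simp: F'(2))
  also have "\<dots> = (\<integral>\<^sup>+t. \<integral>\<^sup>+x. ennreal (F' (x, t)) \<partial>M \<partial>It T)"
    by (intro nn_integral_cong nn_integral_lebesgue_on_eq_lborel[symmetric] dom_lebesgue) (auto simp: F'(2))
  also have "\<dots> = (\<integral>\<^sup>+t. \<integral>\<^sup>+x. ennreal (F (x, t)) \<partial>M \<partial>It T)"
  proof (rule nn_integral_cong_AE)
    show "AE t in It T. (\<integral>\<^sup>+x. ennreal (F' (x, t)) \<partial>M) = (\<integral>\<^sup>+x. ennreal (F (x, t)) \<partial>M)"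
      using F'(4)
    proof eventually_elim
      case (elim t)
      show ?case by (rule nn_integral_cong_AE) (use elim in eventually_elim, simp)
    qed
  qed
  finally show ?thesis .
qed

lemma spacetime_slice_measurable:
  fixes F :: "(real^2) \<times> real \<Rightarrow> real"
  assumes F: "F \<in> borel_measurable (spacetime \<Omega> T)"
  shows "AE t in It T. (\<lambda>x. F (x, t)) \<in> borel_measurable M"
proof -
  obtain F' where F': "F' \<in> borel_measurable borel" "AE t in It T. AE x in M. F (x, t) = F' (x, t)"
    by (rule spacetime_representative[OF F])
  from F'(2) show ?thesis
  proof eventually_elim
    case (elim t)
    have "(\<lambda>x. F' (x, t)) \<in> borel_measurable borel"
      using F'(1) measurable_compose[of "\<lambda>x. (x, t)" borel borel F' borel]
      by (simp add: borel_prod[symmetric])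
    then show ?case
      by (rule borel_measurable_lebesgue_on_AE[OF borel_measurable_lebesgue_onI dom_lebesgue])
        (use elim in eventually_elim, simp)
  qed
qed

text \<open>The first claim presupposes no integrability on the cylinder. This is the form needed
  for the convective integrand, which is only known to be integrable in the iterated sense.\<close>

lemma spacetime_integral_slice:
  fixes F :: "(real^2) \<times> real \<Rightarrow> real"
  assumes F: "F \<in> borel_measurable (spacetime \<Omega> T)"
  shows "(\<lambda>t. LINT x|M. F (x, t)) \<in> borel_measurable (It T)" (is ?A)
    and "integrable (spacetime \<Omega> T) F \<Longrightarrow> integrable (It T) (\<lambda>t. LINT x|M. F (x, t))" (is "_ \<Longrightarrow> ?B")
    and "integrable (spacetime \<Omega> T) F \<Longrightarrow> (LINT z|spacetime \<Omega> T. F z) = (LINT t|It T. LINT x|M. F (x, t))" (is "_ \<Longrightarrow> ?C")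
proof -
  obtain F' where F': "F' \<in> borel_measurable borel" "\<And>z. z \<notin> \<Omega> \<times> {0<..<T} \<Longrightarrow> F' z = 0"
    "AE z in spacetime \<Omega> T. F z = F' z" "AE t in It T. AE x in M. F (x, t) = F' (x, t)"
    by (rule spacetime_representative[OF F]) blast
  have sl: "(\<lambda>x. F' (x, t)) \<in> borel_measurable borel" for t
    using F'(1) measurable_compose[of "\<lambda>x. (x, t)" borel borel F' borel]
    by (simp add: borel_prod[symmetric])
  have m: "F' \<in> borel_measurable (lborel \<Otimes>\<^sub>M lborel)" using F'(1) by (simp add: lborel_prod)
  let ?J = "\<lambda>t. LINT x|lborel. F' (x, t)"
  have J: "(LINT x|M. F' (x, t)) = ?J t" for t
    by (rule integral_lebesgue_on_eq_lborel(1)[OF sl dom_lebesgue]) (auto simp: F'(2))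
  have Jz: "?J t = 0" if "t \<notin> {0<..<T}" for t using that by (auto simp: F'(2))
  have Jm: "?J \<in> borel_measurable borel"
  proof -
    have "case_prod (\<lambda>t x. F' (x, t)) \<in> borel_measurable (borel \<Otimes>\<^sub>M lborel)"
    proof -
      have "(\<lambda>p. F' (snd p, fst p)) \<in> borel_measurable (borel \<Otimes>\<^sub>M lborel)"
        using m by measurable
      then show ?thesis by (simp add: case_prod_beta')
    qed
    then show ?thesis by (rule lborel.borel_measurable_lebesgue_integral)
  qed
  have ae: "AE t in It T. (LINT x|M. F (x, t)) = ?J t"
    using F'(4) spacetime_slice_measurable[OF F]
  proof eventually_elim
    case (elim t)
    then show ?case unfolding J[symmetric]
      by (intro integral_cong_AE[OF elim(2) borel_measurable_lebesgue_onI[OF sl]]) auto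
  qed
  show A: ?A
    by (rule borel_measurable_lebesgue_on_AE[OF borel_measurable_lebesgue_onI[OF Jm]])
       (use ae in \<open>auto elim: eventually_mono\<close>)
  assume i: "integrable (spacetime \<Omega> T) F"
  have F'ms: "F' \<in> borel_measurable (spacetime \<Omega> T)"
    unfolding spacetime_def by (rule borel_measurable_lebesgue_onI[OF F'(1)])
  have i': "integrable (spacetime \<Omega> T) F'"
    using i integrable_cong_AE[OF F F'ms F'(3)] by simp
  then have "integrable lebesgue (\<lambda>z. indicator (\<Omega> \<times> {0<..<T}) z *\<^sub>R F' z)"
    unfolding spacetime_def using cyl_sets(1)[of T] by (subst (asm) integrable_restrict_space) auto
  also have "(\<lambda>z. indicator (\<Omega> \<times> {0<..<T}) z *\<^sub>R F' z) = F'"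
  proof
    show "indicator (\<Omega> \<times> {0<..<T}) z *\<^sub>R F' z = F' z" for z
      using F'(2)[of z] by (cases "z \<in> \<Omega> \<times> {0<..<T}") simp_all
  qed
  finally have "integrable lborel F'" using F'(1) by (subst (asm) integrable_completion) auto
  then have iP: "integrable (lborel \<Otimes>\<^sub>M lborel) (case_prod (\<lambda>x t. F' (x, t)))" by (simp add: lborel_prod)
  have "integrable lborel ?J" by (rule lborel_pair.integrable_snd[OF iP])
  then have "integrable (It T) ?J"
    using Jm Jz by (intro integral_lebesgue_on_eq_lborel(2)) auto
  then show ?B
    using integrable_cong_AE[OF A borel_measurable_lebesgue_onI[OF Jm] ae] by simp
  have "(LINT z|spacetime \<Omega> T. F z) = (LINT z|spacetime \<Omega> T. F' z)"
    by (rule integral_cong_AE[OF F F'ms F'(3)])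
  also have "\<dots> = (LINT z|lborel. F' z)"
    unfolding spacetime_def by (rule integral_lebesgue_on_eq_lborel(1)[OF F'(1) cyl_sets(1) F'(2)])
  also have "\<dots> = (LINT t|lborel. ?J t)"
    using lborel_pair.integral_snd[OF iP] by (simp add: lborel_prod)
  also have "\<dots> = (LINT t|It T. ?J t)"
    using Jm Jz by (intro integral_lebesgue_on_eq_lborel(1)[symmetric]) auto
  also have "\<dots> = (LINT t|It T. LINT x|M. F (x, t))"
    by (rule integral_cong_AE[OF borel_measurable_lebesgue_onI[OF Jm] A]) (use ae in \<open>auto elim: eventually_mono\<close>)
  finally show ?C .
qed

text \<open>The converse of passing to slices: Tonelli's theorem for |F|, which uses its joint
  measurability.\<close>

lemma spacetime_AE_zero:
  fixes F :: "(real^2) \<times> real \<Rightarrow> real"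
  assumes F: "F \<in> borel_measurable (spacetime \<Omega> T)" and z: "AE t in It T. AE x in M. F (x, t) = 0"
  shows "AE p in spacetime \<Omega> T. F p = 0"
proof -
  have a: "(\<lambda>p. \<bar>F p\<bar>) \<in> borel_measurable (spacetime \<Omega> T)" using F by simp
  have "(\<integral>\<^sup>+z. ennreal \<bar>F z\<bar> \<partial>spacetime \<Omega> T) = (\<integral>\<^sup>+t. \<integral>\<^sup>+x. ennreal \<bar>F (x, t)\<bar> \<partial>M \<partial>It T)"
    by (rule spacetime_nn_integral[OF a])
  also have "\<dots> = (\<integral>\<^sup>+t. 0 \<partial>It T)"
  proof (rule nn_integral_cong_AE)
    show "AE t in It T. (\<integral>\<^sup>+x. ennreal \<bar>F (x, t)\<bar> \<partial>M) = 0"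
      using z
    proof eventually_elim
      case (elim t)
      then have "(\<integral>\<^sup>+x. ennreal \<bar>F (x, t)\<bar> \<partial>M) = (\<integral>\<^sup>+x. 0 \<partial>M)"
        by (intro nn_integral_cong_AE) (auto elim: eventually_mono)
      then show ?case by simp
    qed
  qed
  finally have "(\<integral>\<^sup>+z. ennreal \<bar>F z\<bar> \<partial>spacetime \<Omega> T) = 0" by simp
  then have "AE p in spacetime \<Omega> T. ennreal \<bar>F p\<bar> = 0"
    using a by (subst (asm) nn_integral_0_iff_AE) auto
  then show ?thesis by eventually_elim simp
qed

lemma spacetime_L2:
  fixes F :: "(real^2) \<times> real \<Rightarrow> 'b::euclidean_space"
  assumes F: "F \<in> borel_measurable (spacetime \<Omega> T)"
    and sl: "AE t in It T. square_integrable M (\<lambda>x. F (x, t))"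
    and i: "integrable (It T) (\<lambda>t. (L2norm M (\<lambda>x. F (x, t)))\<^sup>2)"
  shows "square_integrable (spacetime \<Omega> T) F"
proof -
  have a: "(\<lambda>p. (norm (F p))\<^sup>2) \<in> borel_measurable (spacetime \<Omega> T)" using F by simp
  have "(\<integral>\<^sup>+z. ennreal ((norm (F z))\<^sup>2) \<partial>spacetime \<Omega> T) = (\<integral>\<^sup>+t. \<integral>\<^sup>+x. ennreal ((norm (F (x, t)))\<^sup>2) \<partial>M \<partial>It T)"
    by (rule spacetime_nn_integral[OF a])
  also have "\<dots> = (\<integral>\<^sup>+t. ennreal ((L2norm M (\<lambda>x. F (x, t)))\<^sup>2) \<partial>It T)"
  proof (rule nn_integral_cong_AE)
    show "AE t in It T. (\<integral>\<^sup>+x. ennreal ((norm (F (x, t)))\<^sup>2) \<partial>M) = ennreal ((L2norm M (\<lambda>x. F (x, t)))\<^sup>2)"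
      using sl
    proof eventually_elim
      case (elim t)
      then show ?case unfolding L2norm_sq by (intro nn_integral_eq_integral L2_integrable) auto
    qed
  qed
  also have "\<dots> < \<infinity>" using i by (simp add: integrable_iff_bounded)
  finally have "integrable (spacetime \<Omega> T) (\<lambda>p. (norm (F p))\<^sup>2)"
    using a by (intro integrableI_bounded) auto
  then show ?thesis using F by (simp add: square_integrable_def)
qed

end

section \<open>Translation continuity in the time variable\<close>

lemma integrable_lborel_translate:
  fixes f :: "real \<Rightarrow> real"
  assumes "integrable lborel f" shows "integrable lborel (\<lambda>t. f (t + a))"
  using lborel_integrable_real_affine[OF assms, of 1 a] by (simp add: add.commute)

text \<open>For an open set U and t in U, t + \<rho> n lies in U from some index on, so the overlap
  of U with its translates tends to the measure of U by dominated convergence. Outer regularity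
  reduces a Borel set to an open one.\<close>

lemma indicator_translation_tendsto:
  fixes A :: "real set"
  assumes A: "A \<in> sets borel" "emeasure lborel A < \<infinity>" and \<rho>: "\<rho> \<longlonglongrightarrow> (0::real)"
  shows "(\<lambda>n. LINT t|lborel. \<bar>indicator A (t + \<rho> n) - indicator A t :: real\<bar>) \<longlonglongrightarrow> 0"
proof (rule LIMSEQ_I)
  fix \<epsilon> :: real assume \<epsilon>: "\<epsilon> > 0"
  note [measurable] = A(1)
  \<comment> \<open>The final bound is at most twice the overlap defect plus four times the measure
    of U - A, hence below 2 * \<epsilon>/8 + 4 * \<epsilon>/8.\<close>
  obtain U where U: "open U" "A \<subseteq> U" and eUA: "emeasure lborel (U - A) < ennreal (\<epsilon>/8)"
    using outer_regular_lborel[OF A(1), of "\<epsilon>/8"] \<epsilon> by auto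
  have mU[measurable]: "U \<in> sets borel" using U(1) by simp
  have "emeasure lborel U \<le> emeasure lborel A + emeasure lborel (U - A)"
    using U(2) by (intro order_trans[OF emeasure_mono emeasure_subadditive]) auto
  also have "\<dots> < \<infinity>" using A(2) eUA by (simp add: less_top[symmetric] ennreal_add_eq_top) (metis ennreal_less_top less_trans top.not_eq_extremum)
  finally have fU: "emeasure lborel U < \<infinity>" .
  have iA: "integrable lborel (indicator A :: real \<Rightarrow> real)" and iU: "integrable lborel (indicator U :: real \<Rightarrow> real)"
    using A fU by (auto intro!: integrable_real_indicator)
  have iD: "integrable lborel (indicator (U - A) :: real \<Rightarrow> real)"
    by (intro integrable_real_indicator) (use eUA in \<open>auto intro: less_trans\<close>)
  let ?d = "LINT t|lborel. indicator (U - A) t :: real"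
  have d: "?d \<le> \<epsilon>/8"
  proof -
    have "enn2real (emeasure lborel (U - A)) \<le> \<epsilon>/8"
      using eUA \<epsilon> by (intro enn2real_leI) auto
    then show ?thesis by (simp add: measure_def)
  qed
  have "(\<lambda>n. LINT t|lborel. indicator U t * indicator U (t + \<rho> n) :: real) \<longlonglongrightarrow> (LINT t|lborel. indicator U t)"
  proof (rule integral_dominated_convergence[where w="indicator U"])
    show "AE t in lborel. (\<lambda>n. indicator U t * indicator U (t + \<rho> n) :: real) \<longlonglongrightarrow> indicator U t"
    proof (intro AE_I2)
      fix t
      have "(\<lambda>n. t + \<rho> n) \<longlonglongrightarrow> t" using tendsto_add[OF tendsto_const \<rho>, of t] by simp
      then have "t \<in> U \<Longrightarrow> \<forall>\<^sub>F n in sequentially. t + \<rho> n \<in> U"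
        using U(1) by (rule topological_tendstoD)
      then show "(\<lambda>n. indicator U t * indicator U (t + \<rho> n) :: real) \<longlonglongrightarrow> indicator U t"
        by (cases "t \<in> U") (auto intro!: tendsto_eventually elim: eventually_mono)
    qed
  qed (use iU in \<open>auto simp: indicator_def\<close>)
  then have "\<forall>\<^sub>F n in sequentially. (LINT t|lborel. indicator U t) - \<epsilon>/8 < (LINT t|lborel. indicator U t * indicator U (t + \<rho> n) :: real)"
    by (rule order_tendstoD) (use \<epsilon> in simp)
  then obtain N where N: "\<And>n. n \<ge> N \<Longrightarrow> (LINT t|lborel. indicator U t) - \<epsilon>/8 < (LINT t|lborel. indicator U t * indicator U (t + \<rho> n) :: real)"
    by (auto simp: eventually_sequentially)
  have main: "(LINT t|lborel. \<bar>indicator A (t + r) - indicator A t\<bar>)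
      \<le> 2 * (LINT t|lborel. indicator U t) - 2 * (LINT t|lborel. indicator U t * indicator U (t + r) :: real) + 4 * ?d" for r
  proof -
    have tr: "integrable lborel (\<lambda>t. indicator B (t + r) :: real)" "(LINT t|lborel. indicator B (t + r) :: real) = (LINT t|lborel. indicator B t)"
      if "integrable lborel (indicator B :: real \<Rightarrow> real)" "B \<in> sets borel" for B
      using integrable_lborel_translate[OF that(1)] integral_lborel_translate[of "indicator B" r] that(2) by auto
    have iUU: "integrable lborel (\<lambda>t. indicator U t * indicator U (t + r) :: real)"
      by (rule Bochner_Integration.integrable_bound[OF iU]) (auto simp: indicator_def)
    have iAA: "integrable lborel (\<lambda>t. \<bar>indicator A (t + r) - indicator A t :: real\<bar>)"
      using tr(1)[OF iA A(1)] iA by (intro integrable_abs Bochner_Integration.integrable_diff)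
    have iR: "integrable lborel (\<lambda>t. indicator U (t + r) + indicator U t - 2 * (indicator U t * indicator U (t + r))
          + 2 * indicator (U - A) (t + r) + 2 * indicator (U - A) t :: real)"
      by (intro Bochner_Integration.integrable_add Bochner_Integration.integrable_diff integrable_mult_right
          iUU tr(1)[OF iU mU] tr(1)[OF iD] iU iD) simp
    have "(LINT t|lborel. \<bar>indicator A (t + r) - indicator A t :: real\<bar>)
      \<le> (LINT t|lborel. indicator U (t + r) + indicator U t - 2 * (indicator U t * indicator U (t + r))
          + 2 * indicator (U - A) (t + r) + 2 * indicator (U - A) t :: real)"
      using U(2) by (intro integral_mono[OF iAA iR]) (auto simp: indicator_def)
    also have "\<dots> = 2 * (LINT t|lborel. indicator U t) - 2 * (LINT t|lborel. indicator U t * indicator U (t + r) :: real) + 4 * ?d"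
      using iUU tr[OF iU mU] tr[OF iD] iU iD by simp
    finally show ?thesis .
  qed
  show "\<exists>N. \<forall>n\<ge>N. norm ((LINT t|lborel. \<bar>indicator A (t + \<rho> n) - indicator A t :: real\<bar>) - 0) < \<epsilon>"
  proof (intro exI allI impI)
    fix n assume "n \<ge> N"
    have "0 \<le> (LINT t|lborel. \<bar>indicator A (t + \<rho> n) - indicator A t :: real\<bar>)" by simp
    with N[OF \<open>n \<ge> N\<close>] main[of "\<rho> n"] d \<epsilon>
    show "norm ((LINT t|lborel. \<bar>indicator A (t + \<rho> n) - indicator A t :: real\<bar>) - 0) < \<epsilon>"
      unfolding real_norm_def diff_0_right by linarith
  qed
qed

text \<open>The values lie in a bare set of functions without a sigma-algebra, so measurability is
  expressed by level sets. Borel rather than Lebesgue level sets keep it stable under composition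
  with Borel maps, such as shifts and the projections of a product.\<close>

definition borel_simple :: "'v set \<Rightarrow> (real \<Rightarrow> 'v) \<Rightarrow> bool" where
  "borel_simple X s \<longleftrightarrow> finite (range s) \<and> range s \<subseteq> X \<and> (\<forall>e. s -` {e} \<in> sets borel)"

lemma borel_simple_measurable:
  assumes "borel_simple X s"
  shows "s \<in> measurable borel (count_space (range s))"
  using assms unfolding borel_simple_def by (subst measurable_count_space_eq2) auto

text \<open>Both arguments take finitely many values, so the composite is assembled from finitely
  many measurable pieces, whatever \<Phi> is.\<close>

lemma borel_simple_apply2:
  assumes s: "borel_simple X s" and s': "borel_simple Y s'" and "f \<in> measurable M borel" "f' \<in> measurable M borel"
  shows "(\<lambda>p. \<Phi> (s (f p)) (s' (f' p)) :: real) \<in> borel_measurable M"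
proof (rule measurable_compose_countable'[where I="range s" and g="\<lambda>p. s (f p)" and f="\<lambda>e p. \<Phi> e (s' (f' p))"])
  show "(\<lambda>p. s (f p)) \<in> M \<rightarrow>\<^sub>M count_space (range s)"
    by (rule measurable_compose[OF assms(3) borel_simple_measurable[OF s]])
  show "(\<lambda>p. \<Phi> e (s' (f' p))) \<in> borel_measurable M" for e
  proof (rule measurable_compose_countable'[where I="range s'" and g="\<lambda>p. s' (f' p)" and f="\<lambda>e' p. \<Phi> e e'"])
    show "(\<lambda>p. s' (f' p)) \<in> M \<rightarrow>\<^sub>M count_space (range s')"
      by (rule measurable_compose[OF assms(4) borel_simple_measurable[OF s']])
  qed (use s' in \<open>auto simp: borel_simple_def countable_finite\<close>)
qed (use s in \<open>auto simp: borel_simple_def countable_finite\<close>)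

text \<open>Strong measurability and continuity of translations use nothing but distances between
  values, so V and V' can be treated together. Distance zero does not mean equality, since elements
  are represented by functions.\<close>

locale pseudo_distance =
  fixes X :: "'v set" and d :: "'v \<Rightarrow> 'v \<Rightarrow> real"
  assumes d_nonneg: "\<And>x y. 0 \<le> d x y" and d_refl: "\<And>x. d x x = 0"
    and d_sym: "\<And>x y. d x y = d y x"
    and d_triangle: "\<And>x y z. x \<in> X \<Longrightarrow> y \<in> X \<Longrightarrow> z \<in> X \<Longrightarrow> d x z \<le> d x y + d y z"
begin

lemma d_tendsto:
  assumes "\<And>n. a n \<in> X" "\<And>n. b n \<in> X" "x \<in> X" "y \<in> X" "(\<lambda>n. d (a n) x) \<longlonglongrightarrow> 0" "(\<lambda>n. d (b n) y) \<longlonglongrightarrow> 0"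
  shows "(\<lambda>n. d (a n) (b n)) \<longlonglongrightarrow> d x y"
proof -
  have le: "\<bar>d (a n) (b n) - d x y\<bar> \<le> d (a n) x + d (b n) y" for n
    using d_triangle[of "a n" x "b n"] d_triangle[of x y "b n"] d_triangle[of x "a n" y] d_triangle[of "a n" "b n" y]
      assms(1)[of n] assms(2)[of n] assms(3,4) d_sym[of "b n" y] d_sym[of x "a n"] by auto
  have "(\<lambda>n. d (a n) x + d (b n) y) \<longlonglongrightarrow> 0 + 0" by (intro tendsto_add assms)
  then have "(\<lambda>n. d (a n) x + d (b n) y) \<longlonglongrightarrow> 0" by simp
  then have "(\<lambda>n. \<bar>d (a n) (b n) - d x y\<bar>) \<longlonglongrightarrow> 0" by (rule squeeze_0[rotated 2]) (use le in auto)
  then show ?thesis by (simp add: tendsto_rabs_zero_iff LIM_zero_iff)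
qed

lemma d_measurable:
  assumes w: "range w \<subseteq> X" and w': "range w' \<subseteq> X" and s: "\<And>n. borel_simple X (s n)" and s': "\<And>n. borel_simple X (s' n)"
    and lim: "\<And>t. (\<lambda>n. d (s n t) (w t)) \<longlonglongrightarrow> 0" and lim': "\<And>t. (\<lambda>n. d (s' n t) (w' t)) \<longlonglongrightarrow> 0"
    and f: "f \<in> measurable M borel" "f' \<in> measurable M borel"
  shows "(\<lambda>p. d (w (f p)) (w' (f' p))) \<in> borel_measurable M"
proof (rule borel_measurable_LIMSEQ_real)
  show "(\<lambda>n. d (s n (f p)) (s' n (f' p))) \<longlonglongrightarrow> d (w (f p)) (w' (f' p))" for p
  proof (rule d_tendsto[OF _ _ _ _ lim lim'])
    show "s n (f p) \<in> X" "s' n (f' p) \<in> X" for n using s[of n] s'[of n] by (auto simp: borel_simple_def)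
  qed (use w w' in auto)
  show "(\<lambda>p. d (s n (f p)) (s' n (f' p))) \<in> borel_measurable M" for n
    by (rule borel_simple_apply2[OF s s' f])
qed

text \<open>Where S (t + r) and S t differ, at least one of them is a value other than z, and the
  indicator of its level set changes by 1. Such level sets lie in (0, T) and so have finite measure;
  there are finitely many of them, and C bounds all squared distances of values.\<close>

lemma simple_translation_tendsto:
  assumes S: "borel_simple X S" and z: "z \<in> X" and out: "\<And>t. t \<notin> {0<..<T} \<Longrightarrow> S t = z" and \<rho>: "\<rho> \<longlonglongrightarrow> (0::real)"
  shows "(\<lambda>n. LINT t|lborel. (d (S (t + \<rho> n)) (S t))\<^sup>2) \<longlonglongrightarrow> 0"
    and "integrable lborel (\<lambda>t. (d (S (t + r)) (S t))\<^sup>2)"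
proof -
  define C where "C = Max ((\<lambda>(e, e'). (d e e')\<^sup>2) ` (range S \<times> range S))"
  define E where "E = range S - {z}"
  have fin: "finite (range S)" using S by (simp add: borel_simple_def)
  have C: "(d (S t) (S t'))\<^sup>2 \<le> C" for t t'
    unfolding C_def using fin by (intro Max_ge) auto
  have C0: "0 \<le> C" using C[of 0 0] by (meson order_trans zero_le_power2)
  let ?A = "\<lambda>e. S -` {e}"
  have mA: "?A e \<in> sets borel" for e using S by (simp add: borel_simple_def)
  have fA: "emeasure lborel (?A e) < \<infinity>" if "e \<in> E" for e
  proof -
    have "?A e \<subseteq> {0<..<T}" using out that unfolding E_def by blast
    then have "bounded (?A e)" using bounded_subset[of "{0<..<T}"] by auto
    then show ?thesis by (rule emeasure_bounded_finite)
  qed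
  let ?g = "\<lambda>r t. C * (\<Sum>e\<in>E. \<bar>indicator (?A e) (t + r) - indicator (?A e) t :: real\<bar>)"
  have le: "(d (S (t + r)) (S t))\<^sup>2 \<le> ?g r t" for r t
  proof (cases "S (t + r) = S t")
    case True
    then show ?thesis using C0 by (auto simp: d_refl intro!: mult_nonneg_nonneg sum_nonneg)
  next
    case False
    then obtain e where e: "e \<in> E" "e = S t \<or> e = S (t + r)" unfolding E_def by (cases "S t = z") auto
    have "1 = \<bar>indicator (?A e) (t + r) - indicator (?A e) t :: real\<bar>"
      using e False by (auto simp: indicator_def)
    also have "\<dots> \<le> (\<Sum>e\<in>E. \<bar>indicator (?A e) (t + r) - indicator (?A e) t :: real\<bar>)"
      using fin e by (intro member_le_sum[where f="\<lambda>e. \<bar>indicator (?A e) (t + r) - indicator (?A e) t :: real\<bar>"]) (auto simp: E_def)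
    finally have "C * 1 \<le> ?g r t" using C0 by (intro mult_left_mono)
    with C[of "t + r" t] show ?thesis by linarith
  qed
  have iA: "integrable lborel (\<lambda>t. \<bar>indicator (?A e) (t + r) - indicator (?A e) t :: real\<bar>)" if "e \<in> E" for e r
  proof -
    have "integrable lborel (indicator (?A e) :: real \<Rightarrow> real)"
      using mA fA[OF that] by (intro integrable_real_indicator) auto
    then show ?thesis
      by (intro integrable_abs Bochner_Integration.integrable_diff integrable_lborel_translate)
  qed
  have ig: "integrable lborel (?g r)" for r
    by (intro integrable_mult_right Bochner_Integration.integrable_sum iA)
  have m: "(\<lambda>t. d (S (t + r)) (S t)) \<in> borel_measurable borel" for r
    by (rule borel_simple_apply2[OF S S]) auto
  show i: "integrable lborel (\<lambda>t. (d (S (t + r)) (S t))\<^sup>2)" for r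
    by (rule Bochner_Integration.integrable_bound[OF ig[of r]])
       (use m[of r] le[of _ r] in \<open>auto intro!: AE_I2 order_trans[OF _ abs_ge_self]\<close>)
  have 1: "(LINT t|lborel. (d (S (t + r)) (S t))\<^sup>2) \<le> C * (\<Sum>e\<in>E. LINT t|lborel. \<bar>indicator (?A e) (t + r) - indicator (?A e) t :: real\<bar>)" for r
  proof -
    have "(LINT t|lborel. (d (S (t + r)) (S t))\<^sup>2) \<le> (LINT t|lborel. ?g r t)"
      by (intro integral_mono i ig le)
    also have "\<dots> = C * (\<Sum>e\<in>E. LINT t|lborel. \<bar>indicator (?A e) (t + r) - indicator (?A e) t :: real\<bar>)"
      by (simp add: Bochner_Integration.integral_sum iA)
    finally show ?thesis .
  qed
  have "(\<lambda>n. C * (\<Sum>e\<in>E. LINT t|lborel. \<bar>indicator (?A e) (t + \<rho> n) - indicator (?A e) t :: real\<bar>)) \<longlonglongrightarrow> C * (\<Sum>e\<in>E. 0)"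
    by (intro tendsto_intros indicator_translation_tendsto mA fA \<rho>)
  then have "(\<lambda>n. C * (\<Sum>e\<in>E. LINT t|lborel. \<bar>indicator (?A e) (t + \<rho> n) - indicator (?A e) t :: real\<bar>)) \<longlonglongrightarrow> 0"
    by simp
  then show "(\<lambda>n. LINT t|lborel. (d (S (t + \<rho> n)) (S t))\<^sup>2) \<longlonglongrightarrow> 0"
    by (rule squeeze_0[rotated 2]) (use 1 in auto)
qed

text \<open>Approximation in L^2 by simple functions, followed by the triangle inequality through w
  (t + r), S (t + r), S t, w t. The two outer distances have the same integral, since Lebesgue
  measure is translation invariant.\<close>

lemma translation_tendsto:
  assumes w: "range w \<subseteq> X" and s: "\<And>n. borel_simple X (s n)" and lim: "\<And>t. (\<lambda>n. d (s n t) (w t)) \<longlonglongrightarrow> 0"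
    and z: "z \<in> X" and out: "\<And>t. t \<notin> {0<..<T} \<Longrightarrow> w t = z"
    and iw: "integrable lborel (\<lambda>t. (d (w t) z)\<^sup>2)" and \<rho>: "\<rho> \<longlonglongrightarrow> (0::real)"
  shows "(\<lambda>n. LINT t|lborel. (d (w (t + \<rho> n)) (w t))\<^sup>2) \<longlonglongrightarrow> 0"
proof -
  have sX: "s n t \<in> X" for n t using s[of n] by (auto simp: borel_simple_def)
  have wX: "w t \<in> X" for t using w by auto
  have sz: "borel_simple X (\<lambda>_. z)" using z by (auto simp: borel_simple_def vimage_def)
  have mz[measurable]: "(\<lambda>t. d (w t) z) \<in> borel_measurable borel"
    using d_measurable[where w=w and w'="\<lambda>_. z" and f=id and f'=id and M=borel, OF w _ s sz lim] z by (auto simp: d_refl)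
  have ss: "(\<lambda>m. d (s n t) (s n t)) \<longlonglongrightarrow> 0" for n t by (simp add: d_refl)
  have ms[measurable]: "(\<lambda>t. d (s n t) (w t)) \<in> borel_measurable borel" for n
    using d_measurable[where w="s n" and w'=w and f=id and f'=id and M=borel, OF _ w s[of n] s ss lim] sX by auto
  \<comment> \<open>The given simple functions converge only pointwise. Resetting them to z wherever
    they approximate w worse than z does makes d (w t) z a dominating function and does not disturb
    the limit.\<close>
  define S where "S n t = (if t \<in> {0<..<T} \<and> d (s n t) (w t) \<le> d (w t) z then s n t else z)" for n t
  have S: "borel_simple X (S n)" for n
  proof -
    let ?P = "{t. t \<in> {0<..<T} \<and> d (s n t) (w t) \<le> d (w t) z}"
    have "?P = {0<..<T} \<inter> {t \<in> space borel. d (s n t) (w t) \<le> d (w t) z}" by auto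
    then have P: "?P \<in> sets borel" using borel_measurable_le[OF ms[of n] mz] by auto
    have "range (S n) \<subseteq> insert z (range (s n))" by (auto simp: S_def)
    then have "finite (range (S n))" using s[of n] by (auto simp: borel_simple_def intro: finite_subset)
    moreover have "S n -` {e} \<in> sets borel" for e
    proof -
      have "S n -` {e} = (if e = z then (s n -` {e} \<inter> ?P) \<union> (- ?P) else s n -` {e} \<inter> ?P)"
      proof (rule set_eqI)
        fix t
        have "S n t = (if t \<in> ?P then s n t else z)" by (simp add: S_def)
        then show "t \<in> S n -` {e} \<longleftrightarrow> t \<in> (if e = z then (s n -` {e} \<inter> ?P) \<union> (- ?P) else s n -` {e} \<inter> ?P)"
          by (cases "t \<in> ?P") (simp_all del: mem_Collect_eq, blast?)
      qed
      moreover have "s n -` {e} \<in> sets borel" using s[of n] by (simp add: borel_simple_def)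
      ultimately show ?thesis using P by auto
    qed
    ultimately show ?thesis using sX z by (auto simp: borel_simple_def S_def)
  qed
  have SX: "S n t \<in> X" for n t using S[of n] by (auto simp: borel_simple_def)
  have Sle: "d (S n t) (w t) \<le> d (w t) z" for n t
    using d_sym[of z "w t"] by (auto simp: S_def)
  have Slim: "(\<lambda>n. d (S n t) (w t)) \<longlonglongrightarrow> 0" for t
  proof (cases "t \<in> {0<..<T} \<and> d (w t) z > 0")
    case True
    have "\<forall>\<^sub>F n in sequentially. d (s n t) (w t) < d (w t) z"
      using order_tendstoD(2)[OF lim[of t]] True by auto
    then have "\<forall>\<^sub>F n in sequentially. d (s n t) (w t) = d (S n t) (w t)"
      by eventually_elim (use True in \<open>simp add: S_def\<close>)
    then show ?thesis using lim[of t] by (rule Lim_transform_eventually[rotated])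
  next
    case False
    then have "d (w t) z = 0" using out[of t] d_nonneg[of "w t" z] d_refl[of z] by auto
    then have "d (S n t) (w t) = 0" for n using Sle[of n t] d_nonneg[of "S n t" "w t"] by linarith
    then show ?thesis by simp
  qed
  have mS[measurable]: "(\<lambda>t. d (S n t) (w t)) \<in> borel_measurable borel" for n
    using d_measurable[where w="S n" and w'=w and f=id and f'=id and M=borel, OF _ w S[of n] s _ lim] SX by (auto simp: d_refl)
  define e where "e n = (LINT t|lborel. (d (S n t) (w t))\<^sup>2)" for n
  have iS: "integrable lborel (\<lambda>t. (d (S n t) (w t))\<^sup>2)" for n
    by (rule Bochner_Integration.integrable_bound[OF iw]) (auto intro!: AE_I2 power_mono Sle d_nonneg)
  have e: "e \<longlonglongrightarrow> 0"
  proof -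
    have "(\<lambda>n. LINT t|lborel. (d (S n t) (w t))\<^sup>2) \<longlonglongrightarrow> (LINT t|(lborel::real measure). 0)"
    proof (rule integral_dominated_convergence[where w="\<lambda>t. (d (w t) z)\<^sup>2"])
      show "AE t in lborel. (\<lambda>n. (d (S n t) (w t))\<^sup>2) \<longlonglongrightarrow> 0"
        using tendsto_power[OF Slim, of _ 2] by (auto intro!: AE_I2)
      show "AE t in lborel. norm ((d (S n t) (w t))\<^sup>2) \<le> (d (w t) z)\<^sup>2" for n
        by (auto intro!: AE_I2 power_mono Sle d_nonneg)
    qed (use iw in auto)
    then show ?thesis by (simp add: e_def[abs_def])
  qed
  have bound: "(LINT t|lborel. (d (w (t + r)) (w t))\<^sup>2) \<le> 6 * e k + 3 * (LINT t|lborel. (d (S k (t + r)) (S k t))\<^sup>2)" for r k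
  proof -
    have tr: "integrable lborel (\<lambda>t. (d (S k (t + r)) (w (t + r)))\<^sup>2)"
      by (rule integrable_lborel_translate[OF iS])
    have tre: "(LINT t|lborel. (d (S k (t + r)) (w (t + r)))\<^sup>2) = e k"
      unfolding e_def by (rule integral_lborel_translate) measurable
    note iSS = simple_translation_tendsto(2)[OF S[of k] z _ \<rho>, where T=T and r=r]
    have SS: "integrable lborel (\<lambda>t. (d (S k (t + r)) (S k t))\<^sup>2)" by (rule iSS) (auto simp: S_def)
    have le: "(d (w (t + r)) (w t))\<^sup>2 \<le> 3 * (d (S k (t + r)) (w (t + r)))\<^sup>2 + 3 * (d (S k (t + r)) (S k t))\<^sup>2 + 3 * (d (S k t) (w t))\<^sup>2" for t
    proof -
      let ?a = "d (S k (t + r)) (w (t + r))" and ?b = "d (S k (t + r)) (S k t)" and ?c = "d (S k t) (w t)"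
      have "d (w (t + r)) (w t) \<le> ?a + ?b + ?c"
        using d_triangle[OF wX[of "t + r"] SX[of k "t + r"] wX[of t]]
          d_triangle[OF SX[of k "t + r"] SX[of k t] wX[of t]] d_sym[of "w (t + r)" "S k (t + r)"]
        by simp
      then have "(d (w (t + r)) (w t))\<^sup>2 \<le> (?a + ?b + ?c)\<^sup>2" by (intro power_mono d_nonneg)
      also have "\<dots> \<le> 3 * ?a\<^sup>2 + 3 * ?b\<^sup>2 + 3 * ?c\<^sup>2"
      proof -
        have "0 \<le> (?a - ?b)\<^sup>2 + (?b - ?c)\<^sup>2 + (?a - ?c)\<^sup>2" by simp
        then show ?thesis by (simp add: power2_eq_square algebra_simps)
      qed
      finally show ?thesis .
    qed
    have "(LINT t|lborel. (d (w (t + r)) (w t))\<^sup>2) \<le> (LINT t|lborel. 3 * (d (S k (t + r)) (w (t + r)))\<^sup>2 + 3 * (d (S k (t + r)) (S k t))\<^sup>2 + 3 * (d (S k t) (w t))\<^sup>2)"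
      by (intro integral_mono_AE' Bochner_Integration.integrable_add integrable_mult_right tr SS iS AE_I2 le) auto
    also have "\<dots> = 6 * e k + 3 * (LINT t|lborel. (d (S k (t + r)) (S k t))\<^sup>2)"
      using tr SS iS tre by (simp add: e_def)
    finally show ?thesis .
  qed
  show ?thesis
  proof (rule LIMSEQ_I)
    fix \<epsilon> :: real assume "\<epsilon> > 0"
    \<comment> \<open>The bound is 6 * e k plus three times the modulus of the simple function; the
      shares \<epsilon>/12 and \<epsilon>/6 add up to \<epsilon>.\<close>
    obtain k where k: "e k < \<epsilon> / 12"
      using order_tendstoD(2)[OF e, of "\<epsilon> / 12"] \<open>\<epsilon> > 0\<close> by (auto simp: eventually_sequentially)
    have "(\<lambda>n. LINT t|lborel. (d (S k (t + \<rho> n)) (S k t))\<^sup>2) \<longlonglongrightarrow> 0"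
      by (rule simple_translation_tendsto(1)[OF S z _ \<rho>]) (auto simp: S_def)
    then obtain N where N: "\<And>n. n \<ge> N \<Longrightarrow> (LINT t|lborel. (d (S k (t + \<rho> n)) (S k t))\<^sup>2) < \<epsilon> / 6"
      using order_tendstoD(2)[of _ 0 sequentially "\<epsilon> / 6"] \<open>\<epsilon> > 0\<close> by (auto simp: eventually_sequentially)
    show "\<exists>N. \<forall>n\<ge>N. norm ((LINT t|lborel. (d (w (t + \<rho> n)) (w t))\<^sup>2) - 0) < \<epsilon>"
    proof (intro exI allI impI)
      fix n assume "n \<ge> N"
      have "0 \<le> (LINT t|lborel. (d (w (t + \<rho> n)) (w t))\<^sup>2)" by simp
      with N[OF \<open>n \<ge> N\<close>] k bound[of "\<rho> n" k]
      show "norm ((LINT t|lborel. (d (w (t + \<rho> n)) (w t))\<^sup>2) - 0) < \<epsilon>"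
        unfolding real_norm_def diff_0_right by linarith
    qed
  qed
qed

end

section \<open>One-dimensional lemmas in time\<close>

text \<open>A continuation argument in place of the exponential form. Let r be the end of the
  initial interval on which y vanishes. On a short interval after r the integral of a is below 1/2,
  so the maximum of y there is at most half of itself, which contradicts the choice of r.\<close>

lemma gronwall_zero:
  fixes y a :: "real \<Rightarrow> real"
  assumes y: "continuous_on {0..T} y" "\<And>s. s \<in> {0..T} \<Longrightarrow> 0 \<le> y s"
    and a: "integrable lborel a" "\<And>t. 0 \<le> a t"
    and le: "\<And>s. s \<in> {0..<T} \<Longrightarrow> y s \<le> (LINT t|lborel. indicator {0<..<s} t * (a t * y t))"
    and s: "s \<in> {0..<T}"
  shows "y s = 0"
proof (rule ccontr)
  assume "y s \<noteq> 0"
  define Z where "Z = {r \<in> {0..s}. \<forall>t\<in>{0..r}. y t = 0}"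
  have sT: "0 \<le> s" "s < T" using s by auto
  have y0: "y 0 = 0" using le[of 0] y(2)[of 0] sT by simp
  have Z0: "0 \<in> Z" using sT y0 by (auto simp: Z_def)
  have bdd: "bdd_above Z" by (auto simp: Z_def intro: bdd_aboveI[of _ s])
  define r where "r = Sup Z"
  have r: "0 \<le> r" "r \<le> s"
  proof -
    show "0 \<le> r" unfolding r_def by (rule cSup_upper[OF Z0 bdd])
    show "r \<le> s" unfolding r_def by (rule cSup_least) (use Z0 in \<open>auto simp: Z_def\<close>)
  qed
  have below: "y t = 0" if "0 \<le> t" "t < r" for t
  proof -
    have "\<exists>z\<in>Z. t < z" by (rule less_cSupD) (use Z0 that in \<open>auto simp: r_def\<close>)
    then show ?thesis using that by (auto simp: Z_def)
  qed
  have yr: "y r = 0"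
  proof -
    have "y r \<le> (LINT t|lborel. indicator {0<..<r} t * (a t * y t))" using le[of r] r sT by auto
    also have "\<dots> = (LINT t|(lborel::real measure). 0)"
      by (intro Bochner_Integration.integral_cong refl) (auto simp: indicator_def below)
    finally show ?thesis using y(2)[of r] r sT by simp
  qed
  then have rs: "r < s" using \<open>y s \<noteq> 0\<close> r by (cases "r = s") auto
  have "(\<lambda>n. LINT t|lborel. indicator {r<..<r + inverse (real (Suc n))} t * a t) \<longlonglongrightarrow> (LINT t|(lborel::real measure). 0)"
  proof (rule integral_dominated_convergence[where w=a])
    show "AE t in lborel. (\<lambda>n. indicator {r<..<r + inverse (real (Suc n))} t * a t) \<longlonglongrightarrow> 0"
    proof (intro AE_I2)
      fix t
      have "\<forall>\<^sub>F n in sequentially. indicator {r<..<r + inverse (real (Suc n))} t * a t = 0"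
      proof (cases "t > r")
        case True
        have "\<forall>\<^sub>F n in sequentially. inverse (real (Suc n)) < t - r"
          using True by (intro order_tendstoD(2)[OF LIMSEQ_inverse_real_of_nat]) simp
        then show ?thesis by eventually_elim (auto simp: indicator_def)
      qed (auto simp: indicator_def)
      then show "(\<lambda>n. indicator {r<..<r + inverse (real (Suc n))} t * a t) \<longlonglongrightarrow> 0"
        by (rule tendsto_eventually)
    qed
  qed (use a in \<open>auto simp: indicator_def\<close>)
  then have "\<forall>\<^sub>F n in sequentially. (LINT t|lborel. indicator {r<..<r + inverse (real (Suc n))} t * a t) < 1/2"
    by (intro order_tendstoD(2)) auto
  moreover have "\<forall>\<^sub>F n in sequentially. inverse (real (Suc n)) < s - r"
    using rs by (intro order_tendstoD(2)[OF LIMSEQ_inverse_real_of_nat]) simp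
  ultimately have "\<forall>\<^sub>F n in sequentially. (LINT t|lborel. indicator {r<..<r + inverse (real (Suc n))} t * a t) < 1/2
     \<and> inverse (real (Suc n)) < s - r" by eventually_elim simp
  then obtain n where n: "(LINT t|lborel. indicator {r<..<r + inverse (real (Suc n))} t * a t) < 1/2"
    "inverse (real (Suc n)) < s - r" by (auto simp: eventually_sequentially)
  define q where "q = r + inverse (real (Suc n))"
  have q: "r < q" "q < s" "(LINT t|lborel. indicator {r<..<q} t * a t) < 1/2"
    using n by (auto simp: q_def)
  have "continuous_on {r..q} y" by (rule continuous_on_subset[OF y(1)]) (use r q sT in auto)
  then obtain p where p: "p \<in> {r..q}" "\<And>t. t \<in> {r..q} \<Longrightarrow> y t \<le> y p"
    using continuous_attains_sup[of "{r..q}" y] q by auto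
  have yp: "0 \<le> y p" using y(2)[of p] p r q sT by auto
  have "y p \<le> (LINT t|lborel. indicator {0<..<p} t * (a t * y t))" using le[of p] p r q sT by auto
  also have "\<dots> \<le> (LINT t|lborel. y p * (indicator {r<..<q} t * a t))"
  proof (rule integral_mono_AE')
    show "integrable lborel (\<lambda>t. y p * (indicator {r<..<q} t * a t))"
      by (intro integrable_mult_right Bochner_Integration.integrable_bound[OF a(1)])
         (use a in \<open>auto simp: indicator_def\<close>)
    have pt: "indicator {0<..<p} t * (a t * y t) \<le> y p * (indicator {r<..<q} t * a t)"
      "0 \<le> y p * (indicator {r<..<q} t * a t)" if "t \<noteq> r" for t
    proof -
      show "0 \<le> y p * (indicator {r<..<q} t * a t)" using yp a(2) by simp
      show "indicator {0<..<p} t * (a t * y t) \<le> y p * (indicator {r<..<q} t * a t)"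
        using that below[of t] p(1) p(2)[of t] mult_right_mono[OF p(2)[of t] a(2)[of t]] yp a(2)[of t]
        by (cases "t < r") (auto simp: indicator_def mult.commute)
    qed
    show "AE t in lborel. indicator {0<..<p} t * (a t * y t) \<le> y p * (indicator {r<..<q} t * a t)"
      "AE t in lborel. 0 \<le> y p * (indicator {r<..<q} t * a t)"
      using AE_lborel_singleton[of r] by (eventually_elim, use pt in blast)+
  qed
  also have "\<dots> = y p * (LINT t|lborel. indicator {r<..<q} t * a t)" by simp
  also have "\<dots> \<le> y p * (1/2)" using q(3) yp by (intro mult_left_mono) auto
  finally have "y p = 0" using yp by simp
  then have "y t = 0" if "t \<in> {0..q}" for t
    using that below[of t] p(2)[of t] y(2)[of t] q sT by (cases "t < r") auto
  then have "q \<in> Z" using q r by (auto simp: Z_def)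
  then have "q \<le> r" unfolding r_def by (rule cSup_upper[OF _ bdd])
  with q show False by simp
qed

section \<open>Weak derivatives of scalar functions of time\<close>

lemma step_tendsto_1_at_top: "(step \<longlongrightarrow> 1) at_top"
proof -
  have "((\<lambda>s. exp (- inverse s)) \<longlongrightarrow> exp (- 0)) (at_top :: real filter)"
    by (intro tendsto_intros tendsto_inverse_0_at_top filterlim_ident)
  then have 1: "((\<lambda>s. exp (- inverse s)) \<longlongrightarrow> 1) (at_top :: real filter)" by simp
  have "\<forall>\<^sub>F s in at_top. exp (- inverse s) = step s"
    using eventually_gt_at_top[of 0]
    by eventually_elim (simp add: expbump_def divide_inverse)
  with 1 show ?thesis by (rule Lim_transform_eventually)
qed

text \<open>Explicitly e^(-1/s) / s^2 for positive s. It is nonnegative with total mass 1, so its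
  rescalings are an approximate identity supported on one side of a point.\<close>

definition dstep :: "real \<Rightarrow> real" where "dstep = expbump ([:0,0,1:] * (1 - pderiv 1))"

lemma DERIV_step: "(step has_real_derivative dstep s) (at s)"
  unfolding dstep_def by (rule DERIV_expbump)

lemma dstep_nonneg: "0 \<le> dstep s"
  by (auto simp: dstep_def expbump_def)

lemma expbump_measurable [measurable]: "expbump p \<in> borel_measurable borel"
  by (intro borel_measurable_continuous_onI DERIV_continuous_on[where D="expbump ([:0,0,1:] * (p - pderiv p))"]
      has_field_derivative_at_within[OF DERIV_expbump])

lemma dstep_measurable [measurable]: "dstep \<in> borel_measurable borel"
  unfolding dstep_def by (rule expbump_measurable)

lemma dstep_integral: "integrable lborel dstep" "(LINT s|lborel. dstep s) = 1"
proof -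
  have "(\<integral>\<^sup>+s. ennreal (dstep s) * indicator {0..} s \<partial>lborel) = 1 - step 0"
    by (rule nn_integral_FTC_atLeast[OF dstep_measurable DERIV_step dstep_nonneg step_tendsto_1_at_top])
  also have "(\<integral>\<^sup>+s. ennreal (dstep s) * indicator {0..} s \<partial>lborel) = (\<integral>\<^sup>+s. ennreal (dstep s) \<partial>lborel)"
    by (intro nn_integral_cong) (auto simp: indicator_def dstep_def expbump_def)
  finally have *: "(\<integral>\<^sup>+s. ennreal (dstep s) \<partial>lborel) = ennreal 1" by (simp add: expbump_def)
  have "has_bochner_integral lborel dstep 1"
    by (rule has_bochner_integral_nn_integral[OF _ _ _ *]) (auto simp: dstep_nonneg)
  then show "integrable lborel dstep" "(LINT s|lborel. dstep s) = 1"
    by (auto simp: has_bochner_integral_iff)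
qed

text \<open>The derivative of a bump concentrates at the two endpoints (\<open>c = 1\<close> and \<open>c = -1\<close>).\<close>

lemma dstep_concentrates:
  fixes m :: "real \<Rightarrow> real"
  assumes m: "continuous_on UNIV m" "\<And>t. \<bar>m t\<bar> \<le> B" and l: "l > 0" and c: "c = 1 \<or> c = -1"
  shows "(\<lambda>n. LINT t|lborel. real (Suc n) * (dstep (real (Suc n) * (c * (t - a))) * step (real (Suc n) * (l - c * (t - a)))) * m t)
    \<longlonglongrightarrow> m a"
proof -
  have [measurable]: "m \<in> borel_measurable borel" by (rule borel_measurable_continuous_onI[OF m(1)])
  have cc: "c * c = 1" "\<bar>c\<bar> = 1" "c \<noteq> 0" using c by auto
  \<comment> \<open>Substitution t = a + c s / (n + 1). As c^2 = 1, the first factor becomes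
    \<open>dstep s\<close>; the argument of \<open>step\<close>, which refers to the other endpoint,
    grows to infinity, and m is evaluated ever closer to a.\<close>
  have eq: "(LINT t|lborel. real (Suc n) * (dstep (real (Suc n) * (c * (t - a))) * step (real (Suc n) * (l - c * (t - a)))) * m t)
      = (LINT s|lborel. dstep s * step (real (Suc n) * l - s) * m (a + c / real (Suc n) * s))" for n
  proof -
    let ?N = "real (Suc n)"
    have N: "?N > 0" by simp
    have "(LINT t|lborel. ?N * (dstep (?N * (c * (t - a))) * step (?N * (l - c * (t - a)))) * m t)
       = \<bar>c / ?N\<bar> *\<^sub>R (LINT s|lborel. ?N * (dstep (?N * (c * ((a + c / ?N * s) - a))) * step (?N * (l - c * ((a + c / ?N * s) - a)))) * m (a + c / ?N * s))"
      by (rule lborel_integral_real_affine) (use cc in simp)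
    also have "\<dots> = (LINT s|lborel. dstep s * step (?N * l - s) * m (a + c / ?N * s))"
    proof -
      have 1: "?N * (c * ((a + c / ?N * s) - a)) = s" "?N * (l - c * ((a + c / ?N * s) - a)) = ?N * l - s" for s
      proof -
        have "c * ((a + c / ?N * s) - a) = (c * c) * s / ?N" by simp
        also have "\<dots> = s / ?N" by (simp only: cc mult_1)
        finally have e: "c * ((a + c / ?N * s) - a) = s / ?N" .
        show "?N * (c * ((a + c / ?N * s) - a)) = s" "?N * (l - c * ((a + c / ?N * s) - a)) = ?N * l - s"
          unfolding e using N by (simp_all add: right_diff_distrib)
      qed
      have 2: "\<bar>c / ?N\<bar> = 1 / ?N" using cc N by (simp add: abs_divide)
      show ?thesis unfolding 1 2 mult.assoc integral_mult_right_zero real_scaleR_def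
        using N by simp
    qed
    finally show ?thesis .
  qed
  have "(\<lambda>n. LINT s|lborel. dstep s * step (real (Suc n) * l - s) * m (a + c / real (Suc n) * s)) \<longlonglongrightarrow> (LINT s|lborel. dstep s * 1 * m a)"
  proof (rule integral_dominated_convergence[where w="\<lambda>s. B * dstep s"])
    show "integrable lborel (\<lambda>s. B * dstep s)" using dstep_integral by simp
    show "AE s in lborel. (\<lambda>n. dstep s * step (real (Suc n) * l - s) * m (a + c / real (Suc n) * s)) \<longlonglongrightarrow> dstep s * 1 * m a"
    proof (intro AE_I2 tendsto_mult tendsto_const)
      fix s
      have "filterlim (\<lambda>n. real (Suc n) * l - s) at_top sequentially"
      proof -
        have "filterlim (\<lambda>n. (- s) + l * real (Suc n)) at_top sequentially"
          by (intro filterlim_tendsto_add_at_top[OF tendsto_const] filterlim_tendsto_pos_mult_at_top[OF tendsto_const l]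
              filterlim_compose[OF filterlim_real_sequentially filterlim_Suc])
        then show ?thesis by (simp add: algebra_simps)
      qed
      then show "(\<lambda>n. step (real (Suc n) * l - s)) \<longlonglongrightarrow> 1"
        by (rule filterlim_compose[OF step_tendsto_1_at_top])
      have "(\<lambda>n. a + c * inverse (real (Suc n)) * s) \<longlonglongrightarrow> a + c * 0 * s"
        by (intro tendsto_intros LIMSEQ_inverse_real_of_nat)
      then have "(\<lambda>n. a + c / real (Suc n) * s) \<longlonglongrightarrow> a" by (simp add: divide_inverse)
      then show "(\<lambda>n. m (a + c / real (Suc n) * s)) \<longlonglongrightarrow> m a"
        using m(1) by (auto intro: continuous_on_tendsto_compose[of UNIV m])
    qed
    show "AE s in lborel. norm (dstep s * step (real (Suc n) * l - s) * m (a + c / real (Suc n) * s)) \<le> B * dstep s" for n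
    proof (intro AE_I2)
      fix s
      have "\<bar>step (real (Suc n) * l - s)\<bar> * \<bar>m (a + c / real (Suc n) * s)\<bar> \<le> 1 * B"
        using step_nonneg step_le_1 m(2) by (intro mult_mono) (auto simp: abs_of_nonneg)
      then have "dstep s * (\<bar>step (real (Suc n) * l - s)\<bar> * \<bar>m (a + c / real (Suc n) * s)\<bar>) \<le> dstep s * (1 * B)"
        by (intro mult_left_mono dstep_nonneg)
      then show "norm (dstep s * step (real (Suc n) * l - s) * m (a + c / real (Suc n) * s)) \<le> B * dstep s"
        by (simp only: real_norm_def abs_mult abs_of_nonneg[OF dstep_nonneg] mult.assoc mult_1_left mult.commute[of B])
    qed
  qed measurable
  then show ?thesis unfolding eq using dstep_integral by simp
qed

text \<open>The test function is a bump on (a, b). Its derivative is the difference of two kernels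
  concentrating at a and at b, so the left side tends to m a - m b, while the bump itself tends to
  the indicator of (a, b).\<close>

lemma weak_derivative_1d:
  fixes m \<gamma> :: "real \<Rightarrow> real"
  assumes m: "continuous_on {0..T} m" and \<gamma>: "integrable (lebesgue_on {0<..<T}) \<gamma>"
    and weak: "\<And>\<theta>. \<theta> \<in> test_functions {0<..<T} \<Longrightarrow>
      (LINT t|lebesgue_on {0<..<T}. deriv \<theta> t * m t) = - (LINT t|lebesgue_on {0<..<T}. \<theta> t * \<gamma> t)"
    and ab: "0 < a" "a < b" "b < T"
  shows "m b - m a = (LINT t|lebesgue_on {0<..<T}. indicator {a<..<b} t * \<gamma> t)"
proof -
  \<comment> \<open>Clamping the argument to the interval extends m to a bounded continuous function
    on the line, as \<open>dstep_concentrates\<close> requires.\<close>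
  define m' where "m' t = m (max 0 (min T t))" for t
  have m'c: "continuous_on UNIV m'"
    unfolding m'_def by (rule continuous_on_compose2[OF m]) (use ab in \<open>auto intro!: continuous_intros\<close>)
  have m'eq: "m' t = m t" if "t \<in> {0..T}" for t using that by (auto simp: m'_def)
  have "bounded (m ` {0..T})" by (intro compact_imp_bounded compact_continuous_image m compact_Icc)
  then obtain B where "\<forall>y\<in>m ` {0..T}. norm y \<le> B" unfolding bounded_iff by blast
  then have B: "\<bar>m' t\<bar> \<le> B" for t using ab by (auto simp: m'_def)
  have mm[measurable]: "m' \<in> borel_measurable borel" by (rule borel_measurable_continuous_onI[OF m'c])
  let ?\<theta> = "\<lambda>n. box_bump a b (Suc n)"
  have bb: "?\<theta> n t = step (real (Suc n) * (t - a)) * step (real (Suc n) * (b - t))" for n t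
    by (simp add: box_bump_def)
  have sub: "cbox a b \<subseteq> {0<..<T}" using ab by auto
  note test = box_bump_test_function[OF sub]
  let ?g1 = "\<lambda>n t. real (Suc n) * (dstep (real (Suc n) * (1 * (t - a))) * step (real (Suc n) * ((b - a) - 1 * (t - a))))"
  let ?g2 = "\<lambda>n t. real (Suc n) * (dstep (real (Suc n) * ((-1) * (t - b))) * step (real (Suc n) * ((b - a) - (-1) * (t - b))))"
  have D: "DERIV (?\<theta> n) t :> ?g1 n t - ?g2 n t" for n t
  proof -
    have "DERIV (\<lambda>t. step (real (Suc n) * (t - a))) t :> dstep (real (Suc n) * (t - a)) * real (Suc n)"
      by (rule DERIV_chain2[OF DERIV_step]) (auto intro!: derivative_eq_intros)
    moreover have "DERIV (\<lambda>t. step (real (Suc n) * (b - t))) t :> dstep (real (Suc n) * (b - t)) * (- real (Suc n))"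
      by (rule DERIV_chain2[OF DERIV_step]) (auto intro!: derivative_eq_intros)
    ultimately have "DERIV (\<lambda>t. step (real (Suc n) * (t - a)) * step (real (Suc n) * (b - t))) t :>
       dstep (real (Suc n) * (t - a)) * real (Suc n) * step (real (Suc n) * (b - t)) +
       dstep (real (Suc n) * (b - t)) * (- real (Suc n)) * step (real (Suc n) * (t - a))"
      by (rule DERIV_mult)
    then show ?thesis unfolding bb[abs_def] by (simp add: algebra_simps)
  qed
  have zero: "?g1 n t = 0" "?g2 n t = 0" if "t \<notin> {a<..<b}" for n t
    using that by (auto simp: dstep_def expbump_def zero_less_mult_iff)
  have int: "integrable lborel (\<lambda>t. ?g1 n t * m' t)" "integrable lborel (\<lambda>t. ?g2 n t * m' t)" for n
  proof -
    \<comment> \<open>Boundedness of \<open>dstep\<close>: by compactness on the unit interval, and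
      by 1 to the right of it, where 1/s, 1/s and e^(-1/s) are factors of size at most 1.\<close>
    have gb: "\<exists>C. \<forall>s. dstep s \<le> C"
    proof -
      have c: "continuous_on {0..1} dstep"
        unfolding dstep_def
        by (intro DERIV_continuous_on[where D="expbump ([:0,0,1:] * ([:0,0,1:] * (1 - pderiv 1) - pderiv ([:0,0,1:] * (1 - pderiv 1))))"]
            has_field_derivative_at_within[OF DERIV_expbump])

      have ne: "{0..1::real} \<noteq> {}" by simp
      obtain p where p: "\<forall>s\<in>{0..1}. dstep s \<le> dstep p"
        using continuous_attains_sup[OF compact_Icc ne c] by blast
      have "dstep s \<le> max 1 (dstep p)" for s
      proof (cases "s \<in> {0..1}")
        case False
        then have "s \<le> 0 \<or> 1 < s" by auto
        then have "dstep s \<le> 1"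
        proof
          assume "1 < s"
          then have "1/s * (1/s * exp (- (1/s))) \<le> 1" by (intro mult_le_one) auto
          then show ?thesis using \<open>1 < s\<close> by (simp add: dstep_def expbump_def)
        qed (simp add: dstep_def expbump_def)
        then show ?thesis by simp
      qed (use p in \<open>auto simp: le_max_iff_disj\<close>)
      then show ?thesis by blast
    qed
    then obtain C where C: "\<And>s. dstep s \<le> C" by blast
    have C0: "0 \<le> C" using C[of 0] dstep_nonneg[of 0] by linarith
    have *: "integrable lborel (\<lambda>t. real (Suc n) * (dstep (p t) * step (q t)) * m' t)"
      if "\<And>t. t \<notin> {a<..<b} \<Longrightarrow> real (Suc n) * (dstep (p t) * step (q t)) = 0"
        "p \<in> borel_measurable borel" "q \<in> borel_measurable borel" for p q
    proof (rule integrable_lborel_bounded_support[where R="\<bar>a\<bar> + \<bar>b\<bar>" and B="real (Suc n) * (C * 1) * B"])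
      show "(\<lambda>t. real (Suc n) * (dstep (p t) * step (q t)) * m' t) \<in> borel_measurable borel"
        using that(2,3) by (intro borel_measurable_times measurable_compose[OF _ expbump_measurable] measurable_compose[OF _ dstep_measurable] mm) auto
      show "\<bar>real (Suc n) * (dstep (p t) * step (q t)) * m' t\<bar> \<le> real (Suc n) * (C * 1) * B" for t
      proof -
        have "dstep (p t) * step (q t) \<le> C * 1"
          by (intro mult_mono C step_le_1 C0 step_nonneg)
        then have "\<bar>real (Suc n) * (dstep (p t) * step (q t))\<bar> \<le> real (Suc n) * (C * 1)"
          using dstep_nonneg[of "p t"] step_nonneg[of "q t"] by (simp add: abs_mult mult_left_mono del: of_nat_Suc)
        then show ?thesis unfolding abs_mult[of _ "m' t"] using B C0 by (intro mult_mono) auto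
      qed
      show "real (Suc n) * (dstep (p t) * step (q t)) * m' t = 0" if t: "norm t > \<bar>a\<bar> + \<bar>b\<bar>" for t
      proof -
        have "t \<notin> {a<..<b}" using t by auto
        then show ?thesis using \<open>\<And>t. t \<notin> {a<..<b} \<Longrightarrow> real (Suc n) * (dstep (p t) * step (q t)) = 0\<close> by simp
      qed
    qed
    show "integrable lborel (\<lambda>t. ?g1 n t * m' t)" by (rule *[OF zero(1)]) auto
    show "integrable lborel (\<lambda>t. ?g2 n t * m' t)" by (rule *[OF zero(2)]) auto
  qed
  have lhs: "(LINT t|lebesgue_on {0<..<T}. deriv (?\<theta> n) t * m t) = (LINT t|lborel. ?g1 n t * m' t) - (LINT t|lborel. ?g2 n t * m' t)" for n
  proof -
    have "(LINT t|lebesgue_on {0<..<T}. deriv (?\<theta> n) t * m t) = (LINT t|lebesgue_on {0<..<T}. (?g1 n t - ?g2 n t) * m' t)"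
      using ab by (intro Bochner_Integration.integral_cong refl) (simp add: DERIV_imp_deriv[OF D] m'eq)
    also have "\<dots> = (LINT t|lborel. (?g1 n t - ?g2 n t) * m' t)"
    proof (rule integral_lebesgue_on_eq_lborel(1))
      have "(\<lambda>t. ?g1 n t * m' t - ?g2 n t * m' t) \<in> borel_measurable borel"
        using int[of n, THEN borel_measurable_integrable] by (intro borel_measurable_diff) auto
      then show "(\<lambda>t. (?g1 n t - ?g2 n t) * m' t) \<in> borel_measurable borel" by (simp add: left_diff_distrib)
      show "(?g1 n t - ?g2 n t) * m' t = 0" if "t \<notin> {0<..<T}" for t
      proof -
        have "t \<notin> {a<..<b}" using that ab by auto
        then show ?thesis unfolding zero[OF \<open>t \<notin> {a<..<b}\<close>] by simp
      qed
    qed simp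
    also have "\<dots> = (LINT t|lborel. ?g1 n t * m' t - ?g2 n t * m' t)"
      by (simp only: left_diff_distrib)
    also have "\<dots> = (LINT t|lborel. ?g1 n t * m' t) - (LINT t|lborel. ?g2 n t * m' t)"
      by (rule Bochner_Integration.integral_diff[OF int])
    finally show ?thesis .
  qed
  have L1: "(\<lambda>n. LINT t|lborel. ?g1 n t * m' t) \<longlonglongrightarrow> m' a"
    by (rule dstep_concentrates[OF m'c B]) (use ab in auto)
  have L2: "(\<lambda>n. LINT t|lborel. ?g2 n t * m' t) \<longlonglongrightarrow> m' b"
    by (rule dstep_concentrates[OF m'c B]) (use ab in auto)
  have "(\<lambda>n. LINT t|lebesgue_on {0<..<T}. deriv (?\<theta> n) t * m t) \<longlonglongrightarrow> m' a - m' b"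
    unfolding lhs by (intro tendsto_diff L1 L2)
  moreover have "(\<lambda>n. - (LINT t|lebesgue_on {0<..<T}. ?\<theta> n t * \<gamma> t)) \<longlonglongrightarrow> - (LINT t|lebesgue_on {0<..<T}. indicator {a<..<b} t * \<gamma> t)"
  proof (intro tendsto_minus integral_dominated_convergence[where w="\<lambda>t. norm (\<gamma> t)"])
    show "AE t in lebesgue_on {0<..<T}. (\<lambda>n. ?\<theta> n t * \<gamma> t) \<longlonglongrightarrow> indicator {a<..<b} t * \<gamma> t"
      using LIMSEQ_Suc[OF box_bump_tendsto[of a b]] by (auto intro!: AE_I2 tendsto_mult)
    show "AE t in lebesgue_on {0<..<T}. norm (?\<theta> n t * \<gamma> t) \<le> norm (\<gamma> t)" for n
    proof (intro AE_I2)
      fix t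
      have "\<bar>?\<theta> n t\<bar> \<le> 1" using box_bump_nonneg[of a b "Suc n" t] box_bump_le_1[of a b "Suc n" t] by simp
      then show "norm (?\<theta> n t * \<gamma> t) \<le> norm (\<gamma> t)"
        unfolding real_norm_def abs_mult by (rule mult_left_le_one_le[OF abs_ge_zero abs_ge_zero])
    qed
    show "(\<lambda>t. indicator {a<..<b} t * \<gamma> t) \<in> borel_measurable (lebesgue_on {0<..<T})"
      by (rule borel_measurable_times[OF borel_measurable_lebesgue_onI borel_measurable_integrable[OF \<gamma>]]) simp
    show "(\<lambda>t. ?\<theta> n t * \<gamma> t) \<in> borel_measurable (lebesgue_on {0<..<T})" for n
      using \<gamma> by (intro borel_measurable_times test_measurable_lebesgue_on[OF test]) auto
  qed (use \<gamma> in auto)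
  ultimately have "m' a - m' b = - (LINT t|lebesgue_on {0<..<T}. indicator {a<..<b} t * \<gamma> t)"
    unfolding weak[OF test] by (rule LIMSEQ_unique)
  then show ?thesis using m'eq ab by simp
qed

section \<open>The energy identity\<close>

lemma nn_integral_lborel_translate:
  fixes f :: "'a::euclidean_space \<Rightarrow> ennreal"
  assumes "f \<in> borel_measurable borel"
  shows "(\<integral>\<^sup>+x. f (x + a) \<partial>lborel) = (\<integral>\<^sup>+x. f x \<partial>lborel)"
proof -
  have "(\<integral>\<^sup>+x. f x \<partial>lborel) = (\<integral>\<^sup>+x. f x \<partial>distr lborel borel ((+) a))"
    by (simp add: lborel_distr_plus)
  also have "\<dots> = (\<integral>\<^sup>+x. f (a + x) \<partial>lborel)"
    using assms by (subst nn_integral_distr) auto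
  finally show ?thesis by (simp add: add.commute)
qed

lemma AE_lborel_translate:
  fixes Z :: "real set"
  assumes "Z \<in> null_sets lborel" shows "AE t in lborel. t + h \<notin> Z"
proof -
  have m: "Z \<in> sets borel" using assms by (simp add: null_sets_def)
  have "AE t in distr lborel borel ((+) h). t \<notin> Z"
    unfolding lborel_distr_plus using assms by (rule AE_not_in)
  then have "AE t in lborel. h + t \<notin> Z"
    using m by (subst (asm) AE_distr_iff) auto
  then show ?thesis by (simp add: add.commute)
qed

text \<open>Averaging the increments \<open>c (t + h) - c t\<close> over \<open>t\<close> turns the bound by \<open>n\<close> into a bound by
  its $L^2$ modulus of continuity, which kills the increments faster than \<open>h\<close>.\<close>

lemma constant_of_increment_bound:
  fixes c D :: "real \<Rightarrow> real" and n :: "real \<Rightarrow> real \<Rightarrow> real"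
  assumes c: "continuous_on {0..T} c"
    and D: "D \<in> borel_measurable borel" "integrable lborel (\<lambda>t. (D t)\<^sup>2)"
    and n: "(\<lambda>p. n (fst p) (snd p)) \<in> borel_measurable (borel \<Otimes>\<^sub>M borel)"
    and i: "\<And>r. integrable lborel (\<lambda>t. (n (t + r) t)\<^sup>2)"
    and tr: "\<And>\<rho>. \<rho> \<longlonglongrightarrow> 0 \<Longrightarrow> (\<lambda>k. LINT t|lborel. (n (t + \<rho> k) t)\<^sup>2) \<longlonglongrightarrow> 0"
    and Z: "Z \<in> null_sets lborel"
    and inc: "\<And>t t'. t \<in> {0<..<T} - Z \<Longrightarrow> t' \<in> {0<..<T} - Z \<Longrightarrow> t < t' \<Longrightarrow>
      ennreal \<bar>c t' - c t\<bar> \<le> (\<integral>\<^sup>+r. indicator {t<..<t'} r * ennreal (D r * (n r t + n r t')) \<partial>lborel)"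
    and s: "0 < s" "s < T"
  shows "c s = c 0"
proof -
  note [measurable] = D(1) n
  have nm[measurable]: "(\<lambda>x. n (f x) (g x)) \<in> borel_measurable M"
    if "f \<in> borel_measurable M" "g \<in> borel_measurable M" for f g :: "'x \<Rightarrow> real" and M
    using measurable_compose[OF measurable_Pair[OF that] n] by simp
  define K where "K = (LINT t|lborel. (D t)\<^sup>2)"
  have K0: "0 \<le> K" by (simp add: K_def)
  \<comment> \<open>The integral of c (t + h) - c t over [0, s] is (C (s + h) - C s) - (C h - C 0),
    which behaves like h times c s - c 0 for small h. A bound of size h \<kappa> with arbitrary
    \<kappa> thus forces c s = c 0.\<close>
  define C where "C x = integral {0..x} c" for x
  have dC: "(C has_real_derivative c x) (at x within {0..T})" if "x \<in> {0..T}" for x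
    unfolding C_def by (rule integral_has_real_derivative[OF c that])
  have bound: "\<bar>c s - c 0\<bar> \<le> \<kappa> * (K + 1)" if \<kappa>: "\<kappa> > 0" for \<kappa>
  proof -
    \<comment> \<open>The modulus of continuity is known along sequences of shifts only; a uniform
      \<delta> is extracted by contradiction.\<close>
    have "\<exists>\<delta>>0. \<forall>r. \<bar>r\<bar> < \<delta> \<longrightarrow> (LINT t|lborel. (n (t + r) t)\<^sup>2) \<le> \<kappa>\<^sup>2"
    proof (rule ccontr)
      assume "\<not> ?thesis"
      then have "\<exists>r. \<bar>r\<bar> < inverse (real (Suc k)) \<and> (LINT t|lborel. (n (t + r) t)\<^sup>2) > \<kappa>\<^sup>2" for k
        by (metis inverse_positive_iff_positive not_le of_nat_0_less_iff zero_less_Suc)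
      then have "\<forall>k. \<exists>r. \<bar>r\<bar> < inverse (real (Suc k)) \<and> (LINT t|lborel. (n (t + r) t)\<^sup>2) > \<kappa>\<^sup>2" by simp
      from choice[OF this] obtain \<rho> where "\<forall>k. \<bar>\<rho> k\<bar> < inverse (real (Suc k)) \<and> (LINT t|lborel. (n (t + \<rho> k) t)\<^sup>2) > \<kappa>\<^sup>2" ..
      then have \<rho>: "\<And>k. \<bar>\<rho> k\<bar> < inverse (real (Suc k))" "\<And>k. (LINT t|lborel. (n (t + \<rho> k) t)\<^sup>2) > \<kappa>\<^sup>2"
        by simp_all
      have "(\<lambda>k. \<bar>\<rho> k\<bar>) \<longlonglongrightarrow> 0"
        by (rule squeeze_0[OF _ _ LIMSEQ_inverse_real_of_nat]) (use \<rho>(1) less_imp_le in auto)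
      then have "\<rho> \<longlonglongrightarrow> 0" by (simp add: tendsto_rabs_zero_iff)
      from order_tendstoD(2)[OF tr[OF this], of "\<kappa>\<^sup>2"] \<kappa> obtain k where "(LINT t|lborel. (n (t + \<rho> k) t)\<^sup>2) < \<kappa>\<^sup>2"
        by (auto simp: eventually_sequentially)
      with \<rho>(2)[of k] show False by simp
    qed
    then obtain \<delta> where \<delta>: "\<delta> > 0" "\<And>r. \<bar>r\<bar> < \<delta> \<Longrightarrow> (LINT t|lborel. (n (t + r) t)\<^sup>2) \<le> \<kappa>\<^sup>2" by blast
    have nn\<delta>: "(\<integral>\<^sup>+t. ennreal ((n (t + r) t)\<^sup>2) \<partial>lborel) \<le> ennreal (\<kappa>\<^sup>2)" if "\<bar>r\<bar> < \<delta>" for r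
      using \<delta>(2)[OF that] by (subst nn_integral_eq_integral[OF i]) auto
    have step: "\<bar>(C (s + h) - C s) - (C h - C 0)\<bar> \<le> h * (\<kappa> * (K + 1))" if h: "0 < h" "h < \<delta>" "h < T - s" for h
    proof -
      let ?f = "\<lambda>t. c (t + h) - c t"
      have cf: "continuous_on {0..s} ?f"
        by (intro continuous_intros continuous_on_compose2[OF c] continuous_on_subset[OF c]) (use h s in auto)
      have "has_bochner_integral lborel (\<lambda>t. indicator {0..s} t *\<^sub>R ?f t) ((C (s + h) - C s) - (C (0 + h) - C 0))"
      proof (rule has_bochner_integral_FTC_Icc[where F="\<lambda>t. C (t + h) - C t"])
        fix x assume x: "0 \<le> x" "x \<le> s"
        have "((\<lambda>t. C (t + h)) has_real_derivative c (x + h) * 1) (at x within {0..s})"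
        proof (rule DERIV_image_chain[where g="\<lambda>t. t + h", unfolded o_def])
          show "(C has_real_derivative c (x + h)) (at (x + h) within (\<lambda>t. t + h) ` {0..s})"
            by (rule has_field_derivative_subset[OF dC]) (use x h s in auto)
        qed (auto intro!: derivative_eq_intros)
        moreover have "(C has_real_derivative c x) (at x within {0..s})"
          by (rule has_field_derivative_subset[OF dC]) (use x h s in auto)
        ultimately show "((\<lambda>t. C (t + h) - C t) has_vector_derivative ?f x) (at x within {0..s})"
          by (simp add: has_real_derivative_iff_has_vector_derivative[symmetric] DERIV_diff)
      qed (use s cf in auto)
      then have int: "integrable lborel (\<lambda>t. indicator {0..s} t *\<^sub>R ?f t)"
        and eq: "(LINT t|lborel. indicator {0..s} t *\<^sub>R ?f t) = (C (s + h) - C s) - (C h - C 0)"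
        by (auto simp: has_bochner_integral_iff)
      \<comment> \<open>Young's inequality weighted by \<kappa>. After integration in t the first
        term gives at most \<kappa> K, and the two others at most \<kappa>^2 each before division by
        2 \<kappa>, so \<kappa> (K + 1) in total.\<close>
      let ?B = "\<lambda>t \<rho>. \<kappa> * (D (t + \<rho>))\<^sup>2 + ((n (t + \<rho>) t)\<^sup>2 + (n (t + \<rho>) (t + h))\<^sup>2) / (2 * \<kappa>)"
      have amgm: "x * (a + b) \<le> \<kappa> * x\<^sup>2 + (a\<^sup>2 + b\<^sup>2) / (2 * \<kappa>)" for x a b :: real
      proof -
        have "0 \<le> ((\<kappa> * x - a)\<^sup>2 + (\<kappa> * x - b)\<^sup>2) / (2 * \<kappa>)" using \<kappa> by simp
        also have "\<dots> = \<kappa> * x\<^sup>2 + (a\<^sup>2 + b\<^sup>2) / (2 * \<kappa>) - x * (a + b)"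
          using \<kappa> by (simp add: field_simps power2_eq_square)
        finally show ?thesis by simp
      qed
      have "ennreal \<bar>(C (s + h) - C s) - (C h - C 0)\<bar> = ennreal (norm (LINT t|lborel. indicator {0..s} t *\<^sub>R ?f t))"
        unfolding eq real_norm_def ..
      also have "\<dots> \<le> (\<integral>\<^sup>+t. ennreal (norm (indicator {0..s} t *\<^sub>R ?f t)) \<partial>lborel)"
        by (rule integral_norm_bound_ennreal[OF int])
      also have "\<dots> \<le> (\<integral>\<^sup>+t. \<integral>\<^sup>+\<rho>. indicator {0<..<h} \<rho> * ennreal (?B t \<rho>) \<partial>lborel \<partial>lborel)"
      proof (rule nn_integral_mono_AE)
        show "AE t in lborel. ennreal (norm (indicator {0..s} t *\<^sub>R ?f t)) \<le> (\<integral>\<^sup>+\<rho>. indicator {0<..<h} \<rho> * ennreal (?B t \<rho>) \<partial>lborel)"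
          using AE_not_in[OF Z] AE_lborel_translate[OF Z, of h] AE_lborel_singleton[of 0]
        proof eventually_elim
          case (elim t)
          show ?case
          proof (cases "t \<in> {0..s}")
            case True
            have tt: "t \<in> {0<..<T} - Z" "t + h \<in> {0<..<T} - Z" "t < t + h" using True elim h s by auto
            have "ennreal (norm (indicator {0..s} t *\<^sub>R ?f t)) = ennreal \<bar>c (t + h) - c t\<bar>" using True by simp
            also have "\<dots> \<le> (\<integral>\<^sup>+r. indicator {t<..<t + h} r * ennreal (D r * (n r t + n r (t + h))) \<partial>lborel)"
              by (rule inc[OF tt])
            also have "\<dots> = (\<integral>\<^sup>+\<rho>. indicator {t<..<t + h} (\<rho> + t) * ennreal (D (\<rho> + t) * (n (\<rho> + t) t + n (\<rho> + t) (t + h))) \<partial>lborel)"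
              by (rule nn_integral_lborel_translate[symmetric]) measurable
            also have "\<dots> \<le> (\<integral>\<^sup>+\<rho>. indicator {0<..<h} \<rho> * ennreal (?B t \<rho>) \<partial>lborel)"
              by (intro nn_integral_mono) (auto simp: indicator_def add.commute[of _ t] intro!: ennreal_leI amgm)
            finally show ?thesis .
          qed simp
        qed
      qed
      also have "\<dots> = (\<integral>\<^sup>+\<rho>. \<integral>\<^sup>+t. indicator {0<..<h} \<rho> * ennreal (?B t \<rho>) \<partial>lborel \<partial>lborel)"
        by (rule lborel_pair.Fubini'[symmetric]) measurable
      also have "\<dots> \<le> (\<integral>\<^sup>+\<rho>. indicator {0<..<h} \<rho> * ennreal (\<kappa> * (K + 1)) \<partial>lborel)"
      proof (intro nn_integral_mono)
        fix \<rho> :: real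
        show "(\<integral>\<^sup>+t. indicator {0<..<h} \<rho> * ennreal (?B t \<rho>) \<partial>lborel) \<le> indicator {0<..<h} \<rho> * ennreal (\<kappa> * (K + 1))"
        proof (cases "\<rho> \<in> {0<..<h}")
          case True
          have 1: "(\<integral>\<^sup>+t. ennreal ((D (t + \<rho>))\<^sup>2) \<partial>lborel) = ennreal K"
            unfolding K_def
            by (subst nn_integral_lborel_translate[where f="\<lambda>t. ennreal ((D t)\<^sup>2)"], measurable)
               (rule nn_integral_eq_integral[OF D(2)], simp)
          have 2: "(\<integral>\<^sup>+t. ennreal ((n (t + \<rho>) t)\<^sup>2) \<partial>lborel) \<le> ennreal (\<kappa>\<^sup>2)"
            by (rule nn\<delta>) (use True h in auto)
          \<comment> \<open>Seen from t + h, the time t + \<rho> is a shift by \<rho> - h. This is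
            negative but of absolute value below h, which is why \<delta> was chosen for shifts of
            both signs.\<close>
          have 3: "(\<integral>\<^sup>+t. ennreal ((n (t + \<rho>) (t + h))\<^sup>2) \<partial>lborel) \<le> ennreal (\<kappa>\<^sup>2)"
          proof -
            have "(\<integral>\<^sup>+t. ennreal ((n ((t + h) + (\<rho> - h)) (t + h))\<^sup>2) \<partial>lborel) = (\<integral>\<^sup>+t. ennreal ((n (t + (\<rho> - h)) t)\<^sup>2) \<partial>lborel)"
              by (rule nn_integral_lborel_translate[where f="\<lambda>t. ennreal ((n (t + (\<rho> - h)) t)\<^sup>2)"]) measurable
            also have "\<dots> \<le> ennreal (\<kappa>\<^sup>2)" by (rule nn\<delta>) (use True h in auto)
            finally show ?thesis by (simp add: add.assoc)
          qed
          have "(\<integral>\<^sup>+t. ennreal (?B t \<rho>) \<partial>lborel) = (\<integral>\<^sup>+t. ennreal \<kappa> * ennreal ((D (t + \<rho>))\<^sup>2)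
              + ennreal (1 / (2 * \<kappa>)) * (ennreal ((n (t + \<rho>) t)\<^sup>2) + ennreal ((n (t + \<rho>) (t + h))\<^sup>2)) \<partial>lborel)"
            using \<kappa> by (intro nn_integral_cong) (simp add: ennreal_mult[symmetric] ennreal_plus[symmetric] del: ennreal_plus)
          also have "\<dots> = ennreal \<kappa> * (\<integral>\<^sup>+t. ennreal ((D (t + \<rho>))\<^sup>2) \<partial>lborel)
              + ennreal (1 / (2 * \<kappa>)) * ((\<integral>\<^sup>+t. ennreal ((n (t + \<rho>) t)\<^sup>2) \<partial>lborel) + (\<integral>\<^sup>+t. ennreal ((n (t + \<rho>) (t + h))\<^sup>2) \<partial>lborel))"
            by (simp add: nn_integral_add nn_integral_cmult)
          also have "\<dots> \<le> ennreal \<kappa> * ennreal K + ennreal (1 / (2 * \<kappa>)) * (ennreal (\<kappa>\<^sup>2) + ennreal (\<kappa>\<^sup>2))"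
            unfolding 1 by (intro add_mono mult_left_mono 2 3 order_refl) auto
          also have "\<dots> = ennreal (\<kappa> * (K + 1))"
            using \<kappa> K0 by (simp add: ennreal_mult[symmetric] ennreal_plus[symmetric] power2_eq_square field_simps del: ennreal_plus)
          finally show ?thesis using True by simp
        qed simp
      qed
      also have "\<dots> = ennreal (h * (\<kappa> * (K + 1)))"
        using h \<kappa> K0 by (simp add: nn_integral_multc ennreal_mult[symmetric])
      finally show ?thesis using h \<kappa> K0 by (simp add: ennreal_le_iff)
    qed
    let ?h = "\<lambda>k. inverse (real (Suc k))"
    have lim: "(\<lambda>k. (C (x + ?h k) - C x) / ?h k) \<longlonglongrightarrow> c x" if x: "0 \<le> x" "x < T" for x
    proof -
      have 1: "((\<lambda>y. (C y - C x) / (y - x)) \<longlongrightarrow> c x) (at x within {0..T})"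
        using dC[of x] x by (simp add: has_field_derivative_iff)
      have "filterlim (\<lambda>k. x + ?h k) (at x within {0..T}) sequentially"
        unfolding filterlim_at
      proof
        have "\<forall>\<^sub>F k in sequentially. ?h k < T - x"
          using x by (intro order_tendstoD(2)[OF LIMSEQ_inverse_real_of_nat]) simp
        then show "\<forall>\<^sub>F k in sequentially. x + ?h k \<in> {0..T} \<and> x + ?h k \<noteq> x"
          by eventually_elim (use x in \<open>auto simp: add_nonneg_nonneg\<close>)
        show "(\<lambda>k. x + ?h k) \<longlonglongrightarrow> x"
          using tendsto_add[OF tendsto_const LIMSEQ_inverse_real_of_nat, of x] by simp
      qed
      from filterlim_compose[OF 1 this] show ?thesis by simp
    qed
    have "(\<lambda>k. \<bar>(C (s + ?h k) - C s) / ?h k - (C (0 + ?h k) - C 0) / ?h k\<bar>) \<longlonglongrightarrow> \<bar>c s - c 0\<bar>"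
      by (intro tendsto_intros lim) (use s in auto)
    moreover have "\<forall>\<^sub>F k in sequentially. ?h k < min \<delta> (T - s)"
      using \<delta>(1) s by (intro order_tendstoD(2)[OF LIMSEQ_inverse_real_of_nat]) simp
    then have "\<forall>\<^sub>F k in sequentially. \<bar>(C (s + ?h k) - C s) / ?h k - (C (0 + ?h k) - C 0) / ?h k\<bar> \<le> \<kappa> * (K + 1)"
    proof eventually_elim
      case (elim k)
      have h: "0 < ?h k" by simp
      have "\<bar>(C (s + ?h k) - C s) / ?h k - (C (0 + ?h k) - C 0) / ?h k\<bar> = \<bar>(C (s + ?h k) - C s) - (C (?h k) - C 0)\<bar> / ?h k"
        using h by (simp add: diff_divide_distrib[symmetric] abs_divide del: inverse_eq_divide of_nat_Suc)
      also have "\<dots> \<le> \<kappa> * (K + 1)"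
        using step[of "?h k"] elim h by (simp add: divide_le_eq mult.commute del: of_nat_Suc)
      finally show ?case .
    qed
    ultimately show ?thesis by (rule tendsto_upperbound) simp
  qed
  show "c s = c 0"
  proof (rule ccontr)
    assume "c s \<noteq> c 0"
    then have "\<bar>c s - c 0\<bar> > 0" by simp
    \<comment> \<open>With \<kappa> equal to |c s - c 0| / (2 (K + 1)) the bound is half of the
      quantity it bounds.\<close>
    then have le: "\<bar>c s - c 0\<bar> \<le> \<bar>c s - c 0\<bar> / (2 * (K + 1)) * (K + 1)"
      using \<open>\<bar>c s - c 0\<bar> > 0\<close> K0 by (intro bound) simp
    have "a / (2 * L) * L = a / 2" if "L > 0" for a L :: real using that by simp
    from this[of "K + 1"] K0 have "\<bar>c s - c 0\<bar> / (2 * (K + 1)) * (K + 1) = \<bar>c s - c 0\<bar> / 2" by simp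
    with le have "\<bar>c s - c 0\<bar> \<le> \<bar>c s - c 0\<bar> / 2" by (simp only:)
    moreover have "\<not> a \<le> a / 2" if "a > 0" for a :: real using that by simp
    ultimately show False using \<open>\<bar>c s - c 0\<bar> > 0\<close> by blast
  qed
qed

subsection \<open>Borel representatives of Bochner functions\<close>

text \<open>A Lebesgue set is a Borel set up to a Borel null set. There are only finitely many level
  sets, so one null set serves them all; on it, and outside (0, T), the value is reset to z.\<close>

lemma simple_on_borel:
  assumes s: "simple_on T X s" and z: "z \<in> X"
  obtains s' N where "borel_simple X s'" "N \<in> null_sets lborel" "\<forall>t \<in> {0<..<T} - N. s' t = s t"
proof -
  let ?I = "{0<..<T}"
  define E where "E = s ` ?I"
  have E: "finite E" "E \<subseteq> X" using s by (auto simp: simple_on_def E_def)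
  have "\<exists>B N. B \<in> sets borel \<and> N \<in> null_sets lborel \<and> B - N = {t \<in> ?I. s t = e} - N" for e
  proof -
    have "{t \<in> ?I. s t = e} \<in> sets lebesgue" using s by (simp add: simple_on_def)
    then obtain B N0 N where "{t \<in> ?I. s t = e} = B \<union> N0" "N0 \<subseteq> N" "N \<in> null_sets lborel" "B \<in> sets lborel"
      by (rule sets_completionE)
    moreover have "B - N = (B \<union> N0) - N" using \<open>N0 \<subseteq> N\<close> by blast
    ultimately show ?thesis by (metis sets_lborel)
  qed
  then have "\<forall>e. \<exists>p. fst p \<in> sets borel \<and> snd p \<in> null_sets lborel \<and> fst p - snd p = {t \<in> ?I. s t = e} - snd p"
    by simp
  from choice[OF this] obtain p where p: "\<forall>e. fst (p e) \<in> sets borel \<and> snd (p e) \<in> null_sets lborel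
      \<and> fst (p e) - snd (p e) = {t \<in> ?I. s t = e} - snd (p e)" ..
  define B N where "B e = fst (p e)" and "N e = snd (p e)" for e
  have BN: "\<And>e. B e \<in> sets borel" "\<And>e. N e \<in> null_sets lborel" "\<And>e. B e - N e = {t \<in> ?I. s t = e} - N e"
    using p by (simp_all add: B_def N_def)
  define N' where "N' = (\<Union>e\<in>E. N e)"
  have N': "N' \<in> null_sets lborel" unfolding N'_def using E BN by (intro null_sets_UN' countable_finite) auto
  then have N'b: "N' \<in> sets borel" by (simp add: null_sets_def)
  define s' where "s' t = (if t \<in> ?I - N' then s t else z)" for t
  have lev: "{t \<in> ?I. s t = e} - N' \<in> sets borel" for e
  proof (cases "e \<in> E")
    case True
    then have "N e \<subseteq> N'" by (auto simp: N'_def)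
    then have "{t \<in> ?I. s t = e} - N' = B e - N'" using BN(3)[of e] by blast
    then show ?thesis using BN(1) N'b by auto
  next
    case False
    then have "{t \<in> ?I. s t = e} - N' = {}" by (auto simp: E_def)
    then show ?thesis by (simp only: sets.empty_sets)
  qed
  have "borel_simple X s'"
    unfolding borel_simple_def
  proof (intro conjI allI)
    have r: "range s' \<subseteq> insert z E" by (auto simp: s'_def E_def)
    then show "finite (range s')" using E by (auto intro: finite_subset)
    show "range s' \<subseteq> X" using r E z by auto
    fix e
    have "s' -` {e} = ({t \<in> ?I. s t = e} - N') \<union> (if e = z then - (?I - N') else {})"
    proof (rule set_eqI)
      fix t
      show "t \<in> s' -` {e} \<longleftrightarrow> t \<in> ({t \<in> ?I. s t = e} - N') \<union> (if e = z then - (?I - N') else {})"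
        unfolding s'_def by (cases "t \<in> ?I - N'") auto
    qed
    moreover have "- (?I - N') \<in> sets borel" using N'b by auto
    ultimately show "s' -` {e} \<in> sets borel" using lev[of e] by auto
  qed
  then show thesis using N' by (rule that) (simp add: s'_def)
qed

text \<open>All exceptional times, those of u and those of the countably many simple functions, are
  collected in one Borel null set, on which everything is set to zero. Membership and convergence
  then hold at every time of the real line.\<close>

lemma bochner_borel_representative:
  fixes N :: "('z \<Rightarrow> 'c::real_normed_vector) \<Rightarrow> real"
  assumes u: "u \<in> bochner_L2 T X N" and z: "(\<lambda>_. 0) \<in> X" and N0: "N (\<lambda>_. 0) = 0"
  obtains u' s where "AE t in lebesgue_on {0<..<T}. u' t = u t" "\<And>t. u' t \<in> X" "\<And>t. t \<notin> {0<..<T} \<Longrightarrow> u' t = (\<lambda>_. 0)"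
    "\<And>n. borel_simple X (s n)" "\<And>t. (\<lambda>n. N (\<lambda>z. s n t z - u' t z)) \<longlonglongrightarrow> 0"
proof -
  let ?I = "{0<..<T}"
  obtain s0 where s0: "\<And>n. simple_on T X (s0 n)" and uX: "AE t in lebesgue_on ?I. u t \<in> X"
    and lim: "AE t in lebesgue_on ?I. (\<lambda>n. N (\<lambda>z. s0 n t z - u t z)) \<longlonglongrightarrow> 0"
    using u by (auto simp: bochner_L2_def)
  have "\<exists>s' Nn. borel_simple X s' \<and> Nn \<in> null_sets lborel \<and> (\<forall>t \<in> ?I - Nn. s' t = s0 n t)" for n
  proof -
    obtain s' Nn where "borel_simple X s'" "Nn \<in> null_sets lborel" "\<forall>t \<in> {0<..<T} - Nn. s' t = s0 n t"
      by (rule simple_on_borel[OF s0[of n] z])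
    then show ?thesis by (intro exI[of _ s'] exI[of _ Nn]) simp
  qed
  then have "\<forall>n. \<exists>p. borel_simple X (fst p) \<and> snd p \<in> null_sets lborel \<and> (\<forall>t \<in> ?I - snd p. fst p t = s0 n t)"
    by simp
  from choice[OF this] obtain p where p: "\<forall>n. borel_simple X (fst (p n)) \<and> snd (p n) \<in> null_sets lborel
      \<and> (\<forall>t \<in> ?I - snd (p n). fst (p n) t = s0 n t)" ..
  define s1 Nn where "s1 n = fst (p n)" and "Nn n = snd (p n)" for n
  have s1: "\<And>n. borel_simple X (s1 n)" "\<And>n. Nn n \<in> null_sets lborel" "\<And>n t. t \<in> ?I - Nn n \<Longrightarrow> s1 n t = s0 n t"
    using p by (simp_all add: s1_def Nn_def)
  have "AE t in lborel. t \<in> ?I \<longrightarrow> u t \<in> X \<and> (\<lambda>n. N (\<lambda>z. s0 n t z - u t z)) \<longlonglongrightarrow> 0"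
  proof -
    have "AE t in lebesgue_on ?I. u t \<in> X \<and> (\<lambda>n. N (\<lambda>z. s0 n t z - u t z)) \<longlonglongrightarrow> 0"
      using uX lim by eventually_elim simp
    then show ?thesis by (subst (asm) AE_lebesgue_on_iff) simp_all
  qed
  then obtain N0' where N0': "N0' \<in> null_sets lborel"
    "\<And>t. t \<in> ?I - N0' \<Longrightarrow> u t \<in> X \<and> (\<lambda>n. N (\<lambda>z. s0 n t z - u t z)) \<longlonglongrightarrow> 0"
    by (elim AE_E) (auto simp: null_sets_def)
  define P where "P = ?I - (N0' \<union> (\<Union>n. Nn n))"
  have null: "N0' \<union> (\<Union>n. Nn n) \<in> null_sets lborel" using N0'(1) s1(2) by (intro null_sets.Un null_sets_UN) auto
  then have P[measurable]: "P \<in> sets borel" by (auto simp: P_def null_sets_def)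
  define u' where "u' t = (if t \<in> P then u t else (\<lambda>_. 0))" for t
  define s where "s n t = (if t \<in> P then s1 n t else (\<lambda>_. 0))" for n t
  show thesis
  proof (rule that[of u' s])
    have "AE t in lborel. t \<in> ?I \<longrightarrow> u' t = u t"
      using AE_not_in[OF null] by eventually_elim (simp add: u'_def P_def)
    then show "AE t in lebesgue_on ?I. u' t = u t" by (simp add: AE_lebesgue_on_iff)
    show "u' t \<in> X" for t using N0'(2)[of t] z by (auto simp: u'_def P_def)
    show "u' t = (\<lambda>_. 0)" if "t \<notin> ?I" for t using that by (auto simp: u'_def P_def)
    show "borel_simple X (s n)" for n
      unfolding borel_simple_def
    proof (intro conjI allI)
      have r: "range (s n) \<subseteq> insert (\<lambda>_. 0) (range (s1 n))" by (auto simp: s_def)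
      then show "finite (range (s n))" using s1(1)[of n] by (auto simp: borel_simple_def intro: finite_subset)
      have "range (s1 n) \<subseteq> X" using s1(1)[of n] by (simp add: borel_simple_def)
      then show "range (s n) \<subseteq> X" using z by (intro order_trans[OF r]) simp
      fix e
      have "s n -` {e} = (s1 n -` {e} \<inter> P) \<union> (if e = (\<lambda>_. 0) then - P else {})"
      proof (rule set_eqI)
        fix t
        show "t \<in> s n -` {e} \<longleftrightarrow> t \<in> (s1 n -` {e} \<inter> P) \<union> (if e = (\<lambda>_. 0) then - P else {})"
          unfolding s_def by (cases "t \<in> P") auto
      qed
      moreover have "s1 n -` {e} \<in> sets borel" using s1(1)[of n] by (simp add: borel_simple_def)
      ultimately show "s n -` {e} \<in> sets borel" using P by auto
    qed
    show "(\<lambda>n. N (\<lambda>z. s n t z - u' t z)) \<longlonglongrightarrow> 0" for t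
    proof (cases "t \<in> P")
      case True
      then have "s n t = s0 n t" for n using s1(3)[of t n] by (auto simp: s_def P_def)
      then show ?thesis using True N0'(2)[of t] by (auto simp: u'_def P_def)
    qed (simp add: s_def u'_def N0)
  qed
qed

subsection \<open>Seminormed spaces of functions\<close>

lemma integrable_lborel_of_lebesgue_on:
  fixes f :: "'a::euclidean_space \<Rightarrow> real"
  assumes "f \<in> borel_measurable borel" "A \<in> sets lebesgue" "\<And>x. x \<notin> A \<Longrightarrow> f x = 0" "integrable (lebesgue_on A) f"
  shows "integrable lborel f"
proof -
  have "integrable lebesgue (\<lambda>x. indicator A x *\<^sub>R f x)"
    using assms(2,4) by (subst (asm) integrable_restrict_space) auto
  also have "(\<lambda>x. indicator A x *\<^sub>R f x) = f"
  proof
    show "indicator A x *\<^sub>R f x = f x" for x using assms(3)[of x] by (cases "x \<in> A") simp_all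
  qed
  finally show ?thesis using assms(1) by (subst (asm) integrable_completion) auto
qed

text \<open>To be instantiated with V and with V'. The axioms about the norm are relative to X
  because \<open>dual_norm\<close> is a supremum that is meaningful for bounded functionals
  only.\<close>

locale function_space =
  fixes X :: "('z \<Rightarrow> 'c::real_normed_vector) set" and N :: "('z \<Rightarrow> 'c) \<Rightarrow> real"
  assumes zero_mem: "(\<lambda>_. 0) \<in> X" and diff_mem: "\<And>x y. x \<in> X \<Longrightarrow> y \<in> X \<Longrightarrow> (\<lambda>z. x z - y z) \<in> X"
    and N_nonneg: "\<And>x. x \<in> X \<Longrightarrow> 0 \<le> N x" and N_zero: "N (\<lambda>_. 0) = 0"
    and N_commute: "\<And>x y. x \<in> X \<Longrightarrow> y \<in> X \<Longrightarrow> N (\<lambda>z. x z - y z) = N (\<lambda>z. y z - x z)"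
    and N_diff_le: "\<And>x y. x \<in> X \<Longrightarrow> y \<in> X \<Longrightarrow> N (\<lambda>z. x z - y z) \<le> N x + N y"
begin

text \<open>The default 0 outside X makes nonnegativity and symmetry unconditional, as
  \<open>pseudo_distance\<close> demands.\<close>

definition dN :: "('z \<Rightarrow> 'c) \<Rightarrow> ('z \<Rightarrow> 'c) \<Rightarrow> real" where
  "dN x y = (if x \<in> X \<and> y \<in> X then N (\<lambda>z. x z - y z) else 0)"

lemma dN_eq: "x \<in> X \<Longrightarrow> y \<in> X \<Longrightarrow> dN x y = N (\<lambda>z. x z - y z)"
  by (simp add: dN_def)

lemma dN_zero: "x \<in> X \<Longrightarrow> dN x (\<lambda>_. 0) = N x"
  by (simp add: dN_def zero_mem)

sublocale pseudo_distance X dN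
proof
  fix x y z :: "'z \<Rightarrow> 'c"
  show "0 \<le> dN x y" by (simp add: dN_def N_nonneg diff_mem)
  show "dN x x = 0" by (simp add: dN_def N_zero)
  show "dN x y = dN y x" by (auto simp: dN_def intro: N_commute)
  assume m: "x \<in> X" "y \<in> X" "z \<in> X"
  have "N (\<lambda>u. (x u - y u) - (z u - y u)) \<le> N (\<lambda>u. x u - y u) + N (\<lambda>u. z u - y u)"
    using m by (intro N_diff_le diff_mem)
  then show "dN x z \<le> dN x y + dN y z" using m N_commute[of y z] by (simp add: dN_def)
qed

lemma N_diff_diff_le:
  assumes "a \<in> X" "b \<in> X" "c \<in> X" "e \<in> X"
  shows "N (\<lambda>z. (a z - b z) - (c z - e z)) \<le> N (\<lambda>z. a z - c z) + N (\<lambda>z. b z - e z)"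
proof -
  have "(\<lambda>z. (a z - b z) - (c z - e z)) = (\<lambda>z. (a z - c z) - (b z - e z))" by (simp add: algebra_simps)
  then show ?thesis using N_diff_le[OF diff_mem[OF assms(1,3)] diff_mem[OF assms(2,4)]] by simp
qed

definition borel_rep :: "real \<Rightarrow> (real \<Rightarrow> 'z \<Rightarrow> 'c) \<Rightarrow> (nat \<Rightarrow> real \<Rightarrow> 'z \<Rightarrow> 'c) \<Rightarrow> bool" where
  "borel_rep T u s \<longleftrightarrow> range u \<subseteq> X \<and> (\<forall>t. t \<notin> {0<..<T} \<longrightarrow> u t = (\<lambda>_. 0)) \<and> (\<forall>n. borel_simple X (s n)) \<and>
     (\<forall>t. (\<lambda>n. dN (s n t) (u t)) \<longlonglongrightarrow> 0) \<and> integrable lborel (\<lambda>t. (N (u t))\<^sup>2)"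

lemma borel_repD:
  assumes "borel_rep T u s"
  shows "range u \<subseteq> X" "u t \<in> X" "t \<notin> {0<..<T} \<Longrightarrow> u t = (\<lambda>_. 0)" "borel_simple X (s n)" "s n t \<in> X"
    "(\<lambda>n. dN (s n t) (u t)) \<longlonglongrightarrow> 0" "integrable lborel (\<lambda>t. (N (u t))\<^sup>2)"
proof -
  have "range (s n) \<subseteq> X" using assms by (simp add: borel_rep_def borel_simple_def)
  then show "s n t \<in> X" by blast
qed (use assms in \<open>auto simp: borel_rep_def\<close>)

lemma borel_simple_zero: "borel_simple X (\<lambda>_. \<lambda>_. 0)"
  using zero_mem by (auto simp: borel_simple_def vimage_def)

lemma N_measurable:
  assumes "range u \<subseteq> X" "\<And>n. borel_simple X (s n)" "\<And>t. (\<lambda>n. dN (s n t) (u t)) \<longlonglongrightarrow> 0"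
  shows "(\<lambda>t. N (u t)) \<in> borel_measurable borel"
proof -
  have "(\<lambda>t. dN (u (id t)) (\<lambda>_. 0)) \<in> borel_measurable borel"
    by (rule d_measurable[where w'="\<lambda>_ _. 0" and s'="\<lambda>_ _ _. 0" and f'=id, OF assms(1) _ assms(2) borel_simple_zero assms(3)])
       (auto simp: zero_mem d_refl)
  moreover have "u t \<in> X" for t using assms(1) by auto
  ultimately show ?thesis by (simp add: dN_zero)
qed

lemma bochner_borel_rep:
  assumes u: "u \<in> bochner_L2 T X N"
  obtains u' s where "borel_rep T u' s" "AE t in lebesgue_on {0<..<T}. u' t = u t"
proof -
  obtain u' s where r: "AE t in lebesgue_on {0<..<T}. u' t = u t" "\<And>t. u' t \<in> X" "\<And>t. t \<notin> {0<..<T} \<Longrightarrow> u' t = (\<lambda>_. 0)"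
    "\<And>n. borel_simple X (s n)" "\<And>t. (\<lambda>n. N (\<lambda>z. s n t z - u' t z)) \<longlonglongrightarrow> 0"
    by (rule bochner_borel_representative[OF u zero_mem N_zero]) blast
  have sX: "s n t \<in> X" for n t using r(4)[of n] by (auto simp: borel_simple_def)
  have lim: "(\<lambda>n. dN (s n t) (u' t)) \<longlonglongrightarrow> 0" for t using r(5)[of t] by (simp add: dN_eq sX r(2))
  have m: "(\<lambda>t. N (u' t)) \<in> borel_measurable borel"
    by (rule N_measurable[OF _ r(4) lim]) (use r(2) in auto)
  have iu: "integrable (lebesgue_on {0<..<T}) (\<lambda>t. (N (u t))\<^sup>2)" using u by (simp add: bochner_L2_def)
  have m': "(\<lambda>t. (N (u' t))\<^sup>2) \<in> borel_measurable (lebesgue_on {0<..<T})"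
    using m by (intro borel_measurable_lebesgue_onI) auto
  have "AE t in lebesgue_on {0<..<T}. (N (u t))\<^sup>2 = (N (u' t))\<^sup>2" using r(1) by eventually_elim simp
  then have "integrable (lebesgue_on {0<..<T}) (\<lambda>t. (N (u' t))\<^sup>2)"
    using iu integrable_cong_AE[OF borel_measurable_integrable[OF iu] m'] by simp
  then have "integrable lborel (\<lambda>t. (N (u' t))\<^sup>2)"
    using m r(3) by (intro integrable_lborel_of_lebesgue_on[of _ "{0<..<T}"]) (auto simp: N_zero)
  then have "borel_rep T u' s" using r lim by (auto simp: borel_rep_def)
  then show thesis using r(1) by (rule that)
qed

lemma simple_on_map2:
  assumes s: "simple_on T X s" and s': "simple_on T Y s'" and m: "\<And>x y. x \<in> X \<Longrightarrow> y \<in> Y \<Longrightarrow> f x y \<in> Z"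
  shows "simple_on T Z (\<lambda>t. f (s t) (s' t))"
  unfolding simple_on_def
proof (intro conjI allI)
  let ?I = "{0<..<T}"
  have sub: "(\<lambda>t. f (s t) (s' t)) ` ?I \<subseteq> (\<lambda>(x, y). f x y) ` (s ` ?I \<times> s' ` ?I)" by auto
  have fin: "finite (s ` ?I \<times> s' ` ?I)" using s s' by (simp add: simple_on_def)
  then show "finite ((\<lambda>t. f (s t) (s' t)) ` ?I)" by (intro finite_subset[OF sub] finite_imageI)
  show "(\<lambda>t. f (s t) (s' t)) ` ?I \<subseteq> Z"
  proof (rule image_subsetI)
    fix t assume "t \<in> ?I"
    moreover have "s ` ?I \<subseteq> X" "s' ` ?I \<subseteq> Y" using s s' by (simp_all only: simple_on_def)
    ultimately show "f (s t) (s' t) \<in> Z" by (intro m) auto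
  qed
  fix e
  have "{t \<in> ?I. f (s t) (s' t) = e} = (\<Union>p\<in>{p \<in> s ` ?I \<times> s' ` ?I. f (fst p) (snd p) = e}. {t \<in> ?I. s t = fst p} \<inter> {t \<in> ?I. s' t = snd p})"
    (is "?L = ?R")
  proof (intro set_eqI iffI)
    fix t assume "t \<in> ?L"
    then show "t \<in> ?R" by (intro UN_I[of "(s t, s' t)"]) auto
  qed auto
  moreover have "{t \<in> ?I. s t = a} \<inter> {t \<in> ?I. s' t = b} \<in> sets lebesgue" for a b
    using s s' by (intro sets.Int) (auto simp: simple_on_def)
  ultimately show "{t \<in> ?I. f (s t) (s' t) = e} \<in> sets lebesgue"
    using fin by (simp only:) (intro sets.finite_UN, auto)
qed

text \<open>The delicate point is measurability in time of the norm of the difference. It comes from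
  the Borel representatives, for which this norm is a pointwise limit of distances between simple
  functions.\<close>

lemma bochner_L2_diff:
  assumes u: "u \<in> bochner_L2 T X N" and v: "v \<in> bochner_L2 T X N"
  shows "(\<lambda>t z. u t z - v t z) \<in> bochner_L2 T X N"
proof -
  let ?I = "lebesgue_on {0<..<T}"
  obtain s where s: "\<And>n. simple_on T X (s n)" "AE t in ?I. (\<lambda>n. N (\<lambda>z. s n t z - u t z)) \<longlonglongrightarrow> 0"
    and uX: "AE t in ?I. u t \<in> X" and iu: "integrable ?I (\<lambda>t. (N (u t))\<^sup>2)"
    using u by (auto simp: bochner_L2_def)
  obtain r where r: "\<And>n. simple_on T X (r n)" "AE t in ?I. (\<lambda>n. N (\<lambda>z. r n t z - v t z)) \<longlonglongrightarrow> 0"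
    and vX: "AE t in ?I. v t \<in> X" and iv: "integrable ?I (\<lambda>t. (N (v t))\<^sup>2)"
    using v by (auto simp: bochner_L2_def)
  have I: "AE t in ?I. t \<in> {0<..<T}" by (rule AE_I2) simp
  have sX: "s n t \<in> X" "r n t \<in> X" if "t \<in> {0<..<T}" for n t
    using s(1)[of n] r(1)[of n] that by (auto simp: simple_on_def)
  have lim: "AE t in ?I. (\<lambda>n. N (\<lambda>z. (s n t z - r n t z) - (u t z - v t z))) \<longlonglongrightarrow> 0"
    using s(2) r(2) uX vX I
  proof eventually_elim
    case (elim t)
    have "(\<lambda>n. N (\<lambda>z. s n t z - u t z) + N (\<lambda>z. r n t z - v t z)) \<longlonglongrightarrow> 0 + 0"
      using elim by (intro tendsto_add)
    then have 0: "(\<lambda>n. N (\<lambda>z. s n t z - u t z) + N (\<lambda>z. r n t z - v t z)) \<longlonglongrightarrow> 0" by simp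
    show ?case
      by (rule squeeze_0[OF _ _ 0]) (use sX elim in \<open>auto intro!: N_nonneg N_diff_diff_le diff_mem\<close>)
  qed
  obtain u' us where u': "borel_rep T u' us" "AE t in ?I. u' t = u t" by (rule bochner_borel_rep[OF u])
  obtain v' vs where v': "borel_rep T v' vs" "AE t in ?I. v' t = v t" by (rule bochner_borel_rep[OF v])
  note U = borel_repD[OF u'(1)] and V = borel_repD[OF v'(1)]
  have m: "(\<lambda>t. dN (u' (id t)) (v' (id t))) \<in> borel_measurable borel"
    by (rule d_measurable[OF U(1) V(1) U(4) V(4) U(6) V(6)]) auto
  have i': "integrable lborel (\<lambda>t. (dN (u' (id t)) (v' (id t)))\<^sup>2)"
  proof (rule Bochner_Integration.integrable_bound[where f="\<lambda>t. 2 * (N (u' t))\<^sup>2 + 2 * (N (v' t))\<^sup>2"])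
    show "integrable lborel (\<lambda>t. 2 * (N (u' t))\<^sup>2 + 2 * (N (v' t))\<^sup>2)" using U(7) V(7) by simp
    show "AE t in lborel. norm ((dN (u' (id t)) (v' (id t)))\<^sup>2) \<le> norm (2 * (N (u' t))\<^sup>2 + 2 * (N (v' t))\<^sup>2)"
    proof (intro AE_I2)
      fix t
      have "(dN (u' t) (v' t))\<^sup>2 \<le> (N (u' t) + N (v' t))\<^sup>2"
        using N_diff_le[OF U(2) V(2)] by (intro power_mono d_nonneg) (simp add: dN_eq U V)
      also have "\<dots> \<le> 2 * (N (u' t))\<^sup>2 + 2 * (N (v' t))\<^sup>2"
        using sum_squares_bound[of "N (u' t)" "N (v' t)"] by (simp add: power2_sum)
      finally show "norm ((dN (u' (id t)) (v' (id t)))\<^sup>2) \<le> norm (2 * (N (u' t))\<^sup>2 + 2 * (N (v' t))\<^sup>2)" by simp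
    qed
  qed (use m in auto)
  have i2: "integrable ?I (\<lambda>t. (dN (u' (id t)) (v' (id t)))\<^sup>2)"
  proof (rule integral_lebesgue_on_eq_lborel(2)[OF _ _ _ i'])
    show "(\<lambda>t. (dN (u' (id t)) (v' (id t)))\<^sup>2) \<in> borel_measurable borel" using m by simp
    show "(dN (u' (id t)) (v' (id t)))\<^sup>2 = 0" if "t \<notin> {0<..<T}" for t
      using U(3)[OF that] V(3)[OF that] by (simp add: d_refl)
  qed simp
  have ae: "AE t in ?I. (dN (u' (id t)) (v' (id t)))\<^sup>2 = (N (\<lambda>z. u t z - v t z))\<^sup>2"
    using u'(2) v'(2) by eventually_elim (use U(2) V(2) in \<open>simp add: dN_def, metis\<close>)
  have "integrable ?I (\<lambda>t. (N (\<lambda>z. u t z - v t z))\<^sup>2)"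
    using i2 integrable_cong_AE[OF borel_measurable_integrable[OF i2]
        borel_measurable_lebesgue_on_AE[OF borel_measurable_integrable[OF i2] _ ae] ae] by simp
  moreover have "AE t in ?I. (\<lambda>z. u t z - v t z) \<in> X"
    using uX vX by eventually_elim (rule diff_mem)
  moreover have "simple_on T X (\<lambda>t z. s n t z - r n t z)" for n
    by (rule simple_on_map2[OF s(1) r(1), where f="\<lambda>a b z. a z - b z"]) (rule diff_mem)
  then have "\<exists>s. (\<forall>n::nat. simple_on T X (s n)) \<and> (AE t in ?I. (\<lambda>n. N (\<lambda>z. s n t z - (u t z - v t z))) \<longlonglongrightarrow> 0)"
    using lim by (rule_tac x="\<lambda>n t z. s n t z - r n t z" in exI) (intro conjI allI)
  ultimately show ?thesis
    unfolding bochner_L2_def mem_Collect_eq by (intro conjI)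
qed

lemma bochner_L2_cutoff:
  assumes u: "u \<in> bochner_L2 T X N"
  shows "(\<lambda>t z. if t < b then u t z else 0) \<in> bochner_L2 T X N"
proof -
  let ?I = "lebesgue_on {0<..<T}"
  obtain s where s: "\<And>n. simple_on T X (s n)" "AE t in ?I. (\<lambda>n. N (\<lambda>z. s n t z - u t z)) \<longlonglongrightarrow> 0"
    and uX: "AE t in ?I. u t \<in> X" and iu: "integrable ?I (\<lambda>t. (N (u t))\<^sup>2)"
    using u by (auto simp: bochner_L2_def)
  have eq: "(\<lambda>z. if t < b then v t z else 0) = (if t < b then v t else (\<lambda>_. 0))" for v :: "real \<Rightarrow> 'z \<Rightarrow> 'c" and t
    by auto
  have "simple_on T X (\<lambda>t. if t < b then s n t else (\<lambda>_. 0))" for n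
    unfolding simple_on_def
  proof (intro conjI allI)
    have sub: "(\<lambda>t. if t < b then s n t else (\<lambda>_. 0)) ` {0<..<T} \<subseteq> insert (\<lambda>_. 0) (s n ` {0<..<T})" by auto
    have 1: "finite (s n ` {0<..<T})" "s n ` {0<..<T} \<subseteq> X" using s(1)[of n] by (simp_all add: simple_on_def)
    show "finite ((\<lambda>t. if t < b then s n t else (\<lambda>_. 0)) ` {0<..<T})" by (rule finite_subset[OF sub]) (use 1 in simp)
    show "(\<lambda>t. if t < b then s n t else (\<lambda>_. 0)) ` {0<..<T} \<subseteq> X" by (rule order_trans[OF sub]) (use 1 zero_mem in simp)
    fix e
    have eqn: "{t \<in> {0<..<T}. (if t < b then s n t else (\<lambda>_. 0)) = e}
      = ({t \<in> {0<..<T}. s n t = e} \<inter> {..<b}) \<union> (if e = (\<lambda>_. 0) then {0<..<T} \<inter> {b..} else {})"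
      by (auto split: if_splits)
    have "{t \<in> {0<..<T}. s n t = e} \<in> sets lebesgue" using s(1)[of n] by (simp only: simple_on_def)
    then have 2: "{t \<in> {0<..<T}. s n t = e} \<inter> {..<b} \<in> sets lebesgue" by (intro sets.Int) simp_all
    have 3: "(if e = (\<lambda>_. 0) then {0<..<T} \<inter> {b..} else {}) \<in> sets lebesgue" by simp
    show "{t \<in> {0<..<T}. (if t < b then s n t else (\<lambda>_. 0)) = e} \<in> sets lebesgue"
      unfolding eqn by (rule sets.Un[OF 2 3])
  qed
  moreover have "AE t in ?I. (\<lambda>n. N (\<lambda>z. (if t < b then s n t else (\<lambda>_. 0)) z - (if t < b then u t else (\<lambda>_. 0)) z)) \<longlonglongrightarrow> 0"
    using s(2) by eventually_elim (simp add: N_zero)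
  ultimately have "\<exists>s. (\<forall>n::nat. simple_on T X (s n)) \<and>
      (AE t in ?I. (\<lambda>n. N (\<lambda>z. s n t z - (if t < b then u t else (\<lambda>_. 0)) z)) \<longlonglongrightarrow> 0)"
    by (rule_tac x="\<lambda>n t. if t < b then s n t else (\<lambda>_. 0)" in exI) (intro conjI allI)
  moreover have "AE t in ?I. (if t < b then u t else (\<lambda>_. 0)) \<in> X"
    using uX by eventually_elim (simp add: zero_mem)
  moreover have "integrable ?I (\<lambda>t. (N (if t < b then u t else (\<lambda>_. 0)))\<^sup>2)"
  proof -
    have "integrable ?I (\<lambda>t. indicator {..<b} t * (N (u t))\<^sup>2)"
      by (rule Bochner_Integration.integrable_bound[OF iu
            borel_measurable_times[OF borel_measurable_lebesgue_onI borel_measurable_integrable[OF iu]]])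
         (auto simp: indicator_def)
    also have "(\<lambda>t. indicator {..<b} t * (N (u t))\<^sup>2) = (\<lambda>t. (N (if t < b then u t else (\<lambda>_. 0)))\<^sup>2)"
      by (auto simp: fun_eq_iff N_zero)
    finally show ?thesis .
  qed
  ultimately show ?thesis
    unfolding bochner_L2_def eq mem_Collect_eq by (intro conjI)
qed

lemma bochner_L2_const:
  assumes "x \<in> X" shows "(\<lambda>_. x) \<in> bochner_L2 T X N"
proof -
  have "simple_on T X (\<lambda>_. x)"
    using assms by (auto simp: simple_on_def intro: finite_subset[of _ "{x}"])
  moreover have "finite_measure (lebesgue_on {0<..<T})"
    by (rule finite_measureI) (use emeasure_bounded_finite[of "{0<..<T}"] in \<open>auto simp: emeasure_restrict_space\<close>)
  ultimately show ?thesis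
    using assms finite_measure.integrable_const
    by (auto simp: bochner_L2_def N_zero intro!: exI[of _ "\<lambda>_ _. x"])
qed

end

subsection \<open>$V$ and its dual\<close>

context bounded_open
begin

lemma V_lincomb: "v \<in> space_V \<Omega> \<Longrightarrow> w \<in> space_V \<Omega> \<Longrightarrow> (\<lambda>x. a *\<^sub>R v x + b *\<^sub>R w x) \<in> space_V \<Omega>"
  using has_gradD(1)[OF has_grad_lincomb[OF has_grad_jacobian has_grad_jacobian]] by blast

lemma Vnorm_scaleR: 
  assumes "v \<in> space_V \<Omega>" shows "Vnorm \<Omega> (\<lambda>x. a *\<^sub>R v x) = \<bar>a\<bar> * Vnorm \<Omega> v"
proof -
  have "has_grad (\<lambda>x. a *\<^sub>R v x) (\<lambda>x. a *\<^sub>R jacobian_weak \<Omega> v x)"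
    using has_grad_lincomb[OF has_grad_jacobian[OF assms] has_grad_zero, of a 0] by simp
  then show ?thesis
    using Vnorm_eq[of "\<lambda>x. a *\<^sub>R v x"] Vnorm_eq[OF has_grad_jacobian[OF assms]] by (simp add: L2norm_scaleR)
qed

sublocale V: function_space "space_V \<Omega>" "Vnorm \<Omega>"
proof
  show "(\<lambda>_. 0) \<in> space_V \<Omega>" by (rule has_gradD(1)[OF has_grad_zero])
  show "Vnorm \<Omega> (\<lambda>_. 0) = 0" by (simp add: Vnorm_eq[OF has_grad_zero] L2norm_def)
  show "0 \<le> Vnorm \<Omega> x" for x by (simp add: Vnorm_def L2norm_nonneg)
  fix x y assume m: "x \<in> space_V \<Omega>" "y \<in> space_V \<Omega>"
  note gx = has_grad_jacobian[OF m(1)] and gy = has_grad_jacobian[OF m(2)]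
  show "(\<lambda>z. x z - y z) \<in> space_V \<Omega>" by (rule has_gradD(1)[OF has_grad_diff[OF gx gy]])
  show "Vnorm \<Omega> (\<lambda>z. x z - y z) = Vnorm \<Omega> (\<lambda>z. y z - x z)"
    unfolding Vnorm_eq[OF has_grad_diff[OF gx gy]] Vnorm_eq[OF has_grad_diff[OF gy gx]] by (rule L2norm_minus_commute)
  show "Vnorm \<Omega> (\<lambda>z. x z - y z) \<le> Vnorm \<Omega> x + Vnorm \<Omega> y"
    by (simp add: Vnorm_eq[OF has_grad_diff[OF gx gy]] Vnorm_eq[OF gx] Vnorm_eq[OF gy]
        L2norm_diff_triangle has_grad_L2(2)[OF gx] has_grad_L2(2)[OF gy])
qed

lemma dual_lincomb:
  assumes "l \<in> dual_V \<Omega>" "v \<in> space_V \<Omega>" "w \<in> space_V \<Omega>"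
  shows "l (\<lambda>x. a *\<^sub>R v x + b *\<^sub>R w x) = a * l v + b * l w"
  using assms by (simp add: dual_V_def)

lemma dual_diff_arg: "l \<in> dual_V \<Omega> \<Longrightarrow> v \<in> space_V \<Omega> \<Longrightarrow> w \<in> space_V \<Omega> \<Longrightarrow> l (\<lambda>x. v x - w x) = l v - l w"
  using dual_lincomb[of l v w 1 "-1"] by simp

lemma dual_add_arg: "l \<in> dual_V \<Omega> \<Longrightarrow> v \<in> space_V \<Omega> \<Longrightarrow> w \<in> space_V \<Omega> \<Longrightarrow> l (\<lambda>x. v x + w x) = l v + l w"
  using dual_lincomb[of l v w 1 1] by simp

lemma dual_zero_arg: "l \<in> dual_V \<Omega> \<Longrightarrow> l (\<lambda>_. 0) = 0"
  using dual_lincomb[of l "\<lambda>_. 0" "\<lambda>_. 0" 0 0] V.zero_mem by simp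

lemma dual_bdd: "l \<in> dual_V \<Omega> \<Longrightarrow> bdd_above ((\<lambda>v. \<bar>l v\<bar>) ` {v \<in> space_V \<Omega>. Vnorm \<Omega> v \<le> 1})"
proof -
  assume "l \<in> dual_V \<Omega>"
  then obtain C where C: "\<forall>v \<in> space_V \<Omega>. \<bar>l v\<bar> \<le> C * Vnorm \<Omega> v" unfolding dual_V_def by blast
  show ?thesis
  proof (rule bdd_aboveI2[where M="\<bar>C\<bar>"])
    fix v assume v: "v \<in> {v \<in> space_V \<Omega>. Vnorm \<Omega> v \<le> 1}"
    have "C * Vnorm \<Omega> v \<le> \<bar>C\<bar> * Vnorm \<Omega> v" using V.N_nonneg v by (intro mult_right_mono) auto
    also have "\<dots> \<le> \<bar>C\<bar> * 1" using v by (intro mult_left_mono) auto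
    finally have "C * Vnorm \<Omega> v \<le> \<bar>C\<bar>" by simp
    then show "\<bar>l v\<bar> \<le> \<bar>C\<bar>" using bspec[OF C, of v] v by simp
  qed
qed

lemma dual_norm_nonneg: "l \<in> dual_V \<Omega> \<Longrightarrow> 0 \<le> dual_norm \<Omega> l"
  unfolding dual_norm_def
  by (rule cSUP_upper2[OF dual_bdd, of _ "\<lambda>_. 0"]) (auto simp: V.zero_mem V.N_zero)

lemma dual_norm_bound:
  assumes l: "l \<in> dual_V \<Omega>" and v: "v \<in> space_V \<Omega>"
  shows "\<bar>l v\<bar> \<le> dual_norm \<Omega> l * Vnorm \<Omega> v"
proof (cases "Vnorm \<Omega> v = 0")
  \<comment> \<open>Normalising v is impossible here, but boundedness of the functional with some
    constant already gives l v = 0.\<close>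
  case True
  then show ?thesis using l v by (fastforce simp: dual_V_def)
next
  case False
  then have p: "Vnorm \<Omega> v > 0" using V.N_nonneg[OF v] by simp
  let ?v = "\<lambda>x. (1 / Vnorm \<Omega> v) *\<^sub>R v x"
  have vV: "?v \<in> space_V \<Omega>" using V_lincomb[OF v v, of "1 / Vnorm \<Omega> v" 0] by simp
  have "\<bar>l ?v\<bar> \<le> dual_norm \<Omega> l"
    unfolding dual_norm_def by (rule cSUP_upper[OF _ dual_bdd[OF l]]) (use vV p in \<open>simp add: Vnorm_scaleR[OF v]\<close>)
  moreover have "l ?v = l v / Vnorm \<Omega> v" using dual_lincomb[OF l v v, of "1 / Vnorm \<Omega> v" 0] by simp
  ultimately show ?thesis using p by (simp add: abs_divide divide_le_eq)
qed

sublocale D: function_space "dual_V \<Omega>" "dual_norm \<Omega>"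
proof
  show "(\<lambda>_. 0) \<in> dual_V \<Omega>" by (auto simp: dual_V_def intro!: exI[of _ 0])
  have ne: "{v \<in> space_V \<Omega>. Vnorm \<Omega> v \<le> 1} \<noteq> {}" using V.zero_mem V.N_zero by force
  show "dual_norm \<Omega> (\<lambda>_. 0) = 0" unfolding dual_norm_def using ne by simp
  show "0 \<le> dual_norm \<Omega> x" if "x \<in> dual_V \<Omega>" for x using that by (rule dual_norm_nonneg)
  fix x y assume m: "x \<in> dual_V \<Omega>" "y \<in> dual_V \<Omega>"
  show d: "(\<lambda>z. x z - y z) \<in> dual_V \<Omega>"
  proof -
    have "\<bar>x v - y v\<bar> \<le> (dual_norm \<Omega> x + dual_norm \<Omega> y) * Vnorm \<Omega> v" if "v \<in> space_V \<Omega>" for v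
      using dual_norm_bound[OF m(1) that] dual_norm_bound[OF m(2) that] by (simp add: distrib_right)
    then have "\<exists>C. \<forall>v\<in>space_V \<Omega>. \<bar>x v - y v\<bar> \<le> C * Vnorm \<Omega> v" by blast
    then show ?thesis using m by (simp add: dual_V_def right_diff_distrib)
  qed
  show "dual_norm \<Omega> (\<lambda>z. x z - y z) = dual_norm \<Omega> (\<lambda>z. y z - x z)"
    by (simp add: dual_norm_def abs_minus_commute)
  show "dual_norm \<Omega> (\<lambda>z. x z - y z) \<le> dual_norm \<Omega> x + dual_norm \<Omega> y"
    unfolding dual_norm_def[of \<Omega> "\<lambda>z. x z - y z"]
  proof (rule cSUP_least[OF ne])
    fix v assume v: "v \<in> {v \<in> space_V \<Omega>. Vnorm \<Omega> v \<le> 1}"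
    have "\<bar>x v\<bar> \<le> dual_norm \<Omega> x" "\<bar>y v\<bar> \<le> dual_norm \<Omega> y"
      unfolding dual_norm_def by (rule cSUP_upper[OF v dual_bdd[OF m(1)]], rule cSUP_upper[OF v dual_bdd[OF m(2)]])
    then show "\<bar>x v - y v\<bar> \<le> dual_norm \<Omega> x + dual_norm \<Omega> y" by linarith
  qed
qed

text \<open>The two times are independent because the energy argument pairs the derivative at one
  time with w at another. The pairing is the pointwise limit of the pairings of simple functions, by
  boundedness of functionals.\<close>

lemma pairing_measurable:
  assumes g: "D.borel_rep T g gs" and w: "V.borel_rep T w ws"
    and f: "f \<in> measurable N borel" "f' \<in> measurable N borel"
  shows "(\<lambda>p. g (f p) (w (f' p))) \<in> borel_measurable N"
proof (rule borel_measurable_LIMSEQ_real)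
  note G = D.borel_repD[OF g] and W = V.borel_repD[OF w]
  show "(\<lambda>p. gs n (f p) (ws n (f' p))) \<in> borel_measurable N" for n
    by (rule borel_simple_apply2[OF G(4) W(4) f])
  fix p
  let ?r = "f p" and ?t = "f' p"
  have le: "norm (gs n ?r (ws n ?t) - g ?r (w ?t)) \<le> D.dN (gs n ?r) (g ?r) * (V.dN (ws n ?t) (w ?t) + Vnorm \<Omega> (w ?t))
      + dual_norm \<Omega> (g ?r) * V.dN (ws n ?t) (w ?t)" for n
  proof -
    have "gs n ?r (ws n ?t) - g ?r (w ?t) = (gs n ?r (ws n ?t) - g ?r (ws n ?t)) + g ?r (\<lambda>x. ws n ?t x - w ?t x)"
      by (simp add: dual_diff_arg G W)
    moreover have "\<bar>gs n ?r (ws n ?t) - g ?r (ws n ?t)\<bar> \<le> D.dN (gs n ?r) (g ?r) * Vnorm \<Omega> (ws n ?t)"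
      using dual_norm_bound[OF D.diff_mem[OF G(5) G(2)] W(5)] by (simp add: D.dN_eq G)
    moreover have "Vnorm \<Omega> (ws n ?t) \<le> V.dN (ws n ?t) (w ?t) + Vnorm \<Omega> (w ?t)"
      using V.d_triangle[OF W(5) W(2) V.zero_mem] by (simp add: V.dN_zero W)
    then have "D.dN (gs n ?r) (g ?r) * Vnorm \<Omega> (ws n ?t) \<le> D.dN (gs n ?r) (g ?r) * (V.dN (ws n ?t) (w ?t) + Vnorm \<Omega> (w ?t))"
      by (intro mult_left_mono D.d_nonneg)
    moreover have "\<bar>g ?r (\<lambda>x. ws n ?t x - w ?t x)\<bar> \<le> dual_norm \<Omega> (g ?r) * V.dN (ws n ?t) (w ?t)"
      using dual_norm_bound[OF G(2) V.diff_mem[OF W(5) W(2)]] by (simp add: V.dN_eq W)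
    ultimately show ?thesis unfolding real_norm_def by linarith
  qed
  have "(\<lambda>n. D.dN (gs n ?r) (g ?r) * (V.dN (ws n ?t) (w ?t) + Vnorm \<Omega> (w ?t))
      + dual_norm \<Omega> (g ?r) * V.dN (ws n ?t) (w ?t)) \<longlonglongrightarrow> 0 * (0 + Vnorm \<Omega> (w ?t)) + dual_norm \<Omega> (g ?r) * 0"
    by (intro tendsto_intros G W)
  then have lim: "(\<lambda>n. D.dN (gs n ?r) (g ?r) * (V.dN (ws n ?t) (w ?t) + Vnorm \<Omega> (w ?t))
      + dual_norm \<Omega> (g ?r) * V.dN (ws n ?t) (w ?t)) \<longlonglongrightarrow> 0" by simp
  have "(\<lambda>n. gs n ?r (ws n ?t) - g ?r (w ?t)) \<longlonglongrightarrow> 0"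
    by (rule Lim_null_comparison[OF always_eventually lim]) (intro allI le)
  then show "(\<lambda>n. gs n ?r (ws n ?t)) \<longlonglongrightarrow> g ?r (w ?t)" by (rule LIM_zero_cancel)
qed

lemma pairing_integrable_rep:
  assumes g: "D.borel_rep T g gs" and w: "V.borel_rep T w ws"
  shows "integrable lborel (\<lambda>t. g t (w t))"
proof (rule Bochner_Integration.integrable_bound[where f="\<lambda>t. (dual_norm \<Omega> (g t))\<^sup>2 + (Vnorm \<Omega> (w t))\<^sup>2"])
  note G = D.borel_repD[OF g] and W = V.borel_repD[OF w]
  show "integrable lborel (\<lambda>t. (dual_norm \<Omega> (g t))\<^sup>2 + (Vnorm \<Omega> (w t))\<^sup>2)" using G(7) W(7) by simp
  show "AE t in lborel. norm (g t (w t)) \<le> norm ((dual_norm \<Omega> (g t))\<^sup>2 + (Vnorm \<Omega> (w t))\<^sup>2)"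
  proof (intro AE_I2)
    fix t
    have "\<bar>g t (w t)\<bar> \<le> dual_norm \<Omega> (g t) * Vnorm \<Omega> (w t)" by (rule dual_norm_bound[OF G(2) W(2)])
    moreover have "2 * (dual_norm \<Omega> (g t) * Vnorm \<Omega> (w t)) \<le> (dual_norm \<Omega> (g t))\<^sup>2 + (Vnorm \<Omega> (w t))\<^sup>2"
      using sum_squares_bound[of "dual_norm \<Omega> (g t)" "Vnorm \<Omega> (w t)"] by simp
    moreover have "0 \<le> dual_norm \<Omega> (g t) * Vnorm \<Omega> (w t)" using D.N_nonneg[OF G(2)] V.N_nonneg[OF W(2)] by simp
    ultimately show "norm (g t (w t)) \<le> norm ((dual_norm \<Omega> (g t))\<^sup>2 + (Vnorm \<Omega> (w t))\<^sup>2)"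
      unfolding real_norm_def by linarith
  qed
qed (use pairing_measurable[OF g w, of id borel id] in simp)

lemma pairing_integrable:
  assumes g: "g \<in> bochner_L2 T (dual_V \<Omega>) (dual_norm \<Omega>)" and w: "w \<in> bochner_L2 T (space_V \<Omega>) (Vnorm \<Omega>)"
  shows "integrable (It T) (\<lambda>t. g t (w t))"
proof -
  obtain g' gs where g': "D.borel_rep T g' gs" "AE t in It T. g' t = g t" by (rule D.bochner_borel_rep[OF g])
  obtain w' ws where w': "V.borel_rep T w' ws" "AE t in It T. w' t = w t" by (rule V.bochner_borel_rep[OF w])
  note i = pairing_integrable_rep[OF g'(1) w'(1)]
  have z: "g' t (w' t) = 0" if "t \<notin> {0<..<T}" for t
    using D.borel_repD(3)[OF g'(1) that] by simp
  have i2: "integrable (It T) (\<lambda>t. g' t (w' t))"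
    using borel_measurable_integrable[OF i] z by (intro integral_lebesgue_on_eq_lborel(2)[OF _ _ _ i]) auto
  have ae: "AE t in It T. g' t (w' t) = g t (w t)" using g'(2) w'(2) by eventually_elim simp
  show ?thesis
    using i2 integrable_cong_AE[OF borel_measurable_integrable[OF i2]
        borel_measurable_lebesgue_on_AE[OF borel_measurable_integrable[OF i2] _ ae] ae] by simp
qed

end

lemma integrable_lebesgue_on_cong_AE:
  fixes f g :: "'a::euclidean_space \<Rightarrow> real"
  assumes "integrable (lebesgue_on A) f" "A \<in> sets lebesgue" "AE x in lebesgue_on A. f x = g x"
  shows "integrable (lebesgue_on A) g" "integral\<^sup>L (lebesgue_on A) f = integral\<^sup>L (lebesgue_on A) g"
proof -
  note m = borel_measurable_integrable[OF assms(1)]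
  note m' = borel_measurable_lebesgue_on_AE[OF m assms(2,3)]
  show "integrable (lebesgue_on A) g" using integrable_cong_AE[OF m m' assms(3)] assms(1) by simp
  show "integral\<^sup>L (lebesgue_on A) f = integral\<^sup>L (lebesgue_on A) g" by (rule integral_cong_AE[OF m m' assms(3)])
qed

text \<open>Dominated convergence; the indicators of the intervals converge at every point other
  than the limiting endpoint.\<close>

lemma continuous_on_indefinite_integral:
  assumes "integrable lborel (b :: real \<Rightarrow> real)"
  shows "continuous_on S (\<lambda>x. LINT r|lborel. indicator {0<..<x} r * b r)"
  unfolding continuous_on_sequentially o_def
proof (intro allI ballI impI)
  fix x a assume "(\<forall>n. x n \<in> S) \<and> x \<longlonglongrightarrow> a"
  then have x: "x \<longlonglongrightarrow> a" by simp
  have [measurable]: "b \<in> borel_measurable borel" using borel_measurable_integrable[OF assms] by simp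
  show "(\<lambda>n. LINT r|lborel. indicator {0<..<x n} r * b r) \<longlonglongrightarrow> (LINT r|lborel. indicator {0<..<a} r * b r)"
  proof (rule integral_dominated_convergence[where w="\<lambda>r. norm (b r)"])
    show "AE r in lborel. (\<lambda>n. indicator {0<..<x n} r * b r) \<longlonglongrightarrow> indicator {0<..<a} r * b r"
      using AE_lborel_singleton[of a]
    proof eventually_elim
      case (elim r)
      have "\<forall>\<^sub>F n in sequentially. indicator {0<..<x n} r * b r = indicator {0<..<a} r * b r"
      proof (cases "r < a")
        case True
        show ?thesis using order_tendstoD(1)[OF x True] by eventually_elim (use True in \<open>simp add: indicator_def\<close>)
      next
        case False
        then have "a < r" using elim by simp
        from order_tendstoD(2)[OF x this] show ?thesis by eventually_elim (use False in \<open>simp add: indicator_def\<close>)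
      qed
      then show ?case by (rule tendsto_eventually)
    qed
  qed (use assms in \<open>auto simp: indicator_def\<close>)
qed

section \<open>Continuous curves in L^2 and their energy\<close>

context bounded_open
begin

definition continuous_L2 :: "real \<Rightarrow> (real \<Rightarrow> real^2 \<Rightarrow> real^2) \<Rightarrow> bool" where
  "continuous_L2 T U \<longleftrightarrow> (\<forall>t \<in> {0..T}. square_integrable M (U t)) \<and>
     (\<forall>s \<in> {0..T}. ((\<lambda>t. L2norm M (\<lambda>x. U t x - U s x)) \<longlongrightarrow> 0) (at s within {0..T}))"

lemma continuous_into_H_L2: "continuous_into_H \<Omega> T U \<Longrightarrow> continuous_L2 T U"
  by (simp add: continuous_into_H_def continuous_L2_def space_H_def)

lemma continuous_L2D: "continuous_L2 T U \<Longrightarrow> t \<in> {0..T} \<Longrightarrow> square_integrable M (U t)"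
  by (simp add: continuous_L2_def)

lemma continuous_L2_diff:
  assumes "continuous_L2 T U" "continuous_L2 T V"
  shows "continuous_L2 T (\<lambda>t x. U t x - V t x)"
  unfolding continuous_L2_def
proof (intro conjI ballI)
  note U = continuous_L2D[OF assms(1)] and V = continuous_L2D[OF assms(2)]
  show "square_integrable M (\<lambda>x. U t x - V t x)" if "t \<in> {0..T}" for t by (intro L2_diff U V that)
  fix s assume s: "s \<in> {0..T}"
  have "((\<lambda>t. L2norm M (\<lambda>x. U t x - U s x) + L2norm M (\<lambda>x. V t x - V s x)) \<longlongrightarrow> 0 + 0) (at s within {0..T})"
    using assms s by (intro tendsto_add) (simp_all add: continuous_L2_def)
  then have lim: "((\<lambda>t. L2norm M (\<lambda>x. U t x - U s x) + L2norm M (\<lambda>x. V t x - V s x)) \<longlongrightarrow> 0) (at s within {0..T})" by simp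
  have le: "norm (L2norm M (\<lambda>x. (U t x - V t x) - (U s x - V s x))) \<le> L2norm M (\<lambda>x. U t x - U s x) + L2norm M (\<lambda>x. V t x - V s x)"
    if t: "t \<in> {0..T}" for t
  proof -
    have "(\<lambda>x. (U t x - V t x) - (U s x - V s x)) = (\<lambda>x. (U t x - U s x) - (V t x - V s x))" by (simp add: algebra_simps)
    then show ?thesis
      using L2norm_diff_triangle[OF L2_diff[OF U[OF t] U[OF s]] L2_diff[OF V[OF t] V[OF s]]] by (simp add: L2norm_nonneg)
  qed
  show "((\<lambda>t. L2norm M (\<lambda>x. (U t x - V t x) - (U s x - V s x))) \<longlongrightarrow> 0) (at s within {0..T})"
    by (rule Lim_null_comparison[OF _ lim]) (use le in \<open>auto simp: eventually_at_filter\<close>)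
qed

lemma continuous_L2_lipschitz:
  assumes U: "continuous_L2 T U" and f: "\<And>s t. s \<in> {0..T} \<Longrightarrow> t \<in> {0..T} \<Longrightarrow> \<bar>f t - f s\<bar> \<le> K * L2norm M (\<lambda>x. U t x - U s x)"
  shows "continuous_on {0..T} (f :: real \<Rightarrow> real)"
  unfolding continuous_on_def
proof
  fix s assume s: "s \<in> {0..T}"
  have "((\<lambda>t. K * L2norm M (\<lambda>x. U t x - U s x)) \<longlongrightarrow> K * 0) (at s within {0..T})"
    using U s by (intro tendsto_intros) (simp add: continuous_L2_def)
  then have lim: "((\<lambda>t. K * L2norm M (\<lambda>x. U t x - U s x)) \<longlongrightarrow> 0) (at s within {0..T})" by simp
  have "((\<lambda>t. f t - f s) \<longlongrightarrow> 0) (at s within {0..T})"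
    by (rule Lim_null_comparison[OF _ lim]) (use f s in \<open>auto simp: eventually_at_filter\<close>)
  then show "(f \<longlongrightarrow> f s) (at s within {0..T})" by (rule LIM_zero_cancel)
qed

lemma continuous_L2norm: "continuous_L2 T U \<Longrightarrow> continuous_on {0..T} (\<lambda>t. L2norm M (U t))"
  by (rule continuous_L2_lipschitz[where K=1]) (auto intro!: L2norm_diff_abs continuous_L2D)

lemma continuous_L2_inner:
  assumes U: "continuous_L2 T U" and v: "square_integrable M v"
  shows "continuous_on {0..T} (\<lambda>t. LINT x|M. U t x \<bullet> v x)"
proof (rule continuous_L2_lipschitz[OF U, where K="L2norm M v"])
  fix s t assume s: "s \<in> {0..T}" and t: "t \<in> {0..T}"
  note Us = continuous_L2D[OF U s] and Ut = continuous_L2D[OF U t]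
  have "(LINT x|M. U t x \<bullet> v x) - (LINT x|M. U s x \<bullet> v x) = (LINT x|M. (U t x - U s x) \<bullet> v x)"
    using Us Ut v by (simp add: inner_diff_left L2_inner)
  then show "\<bar>(LINT x|M. U t x \<bullet> v x) - (LINT x|M. U s x \<bullet> v x)\<bar> \<le> L2norm M v * L2norm M (\<lambda>x. U t x - U s x)"
    using L2_inner(2)[OF L2_diff[OF Ut Us] v] by (simp add: mult.commute)
qed

lemma V_L2: "v \<in> space_V \<Omega> \<Longrightarrow> square_integrable M v"
  by (rule has_grad_L2(1)[OF has_grad_jacobian])

text \<open>Paired with a fixed v, the curve U becomes a continuous scalar function. It agrees
  almost everywhere with the pairing of u, so the definition of \<open>time_derivative\<close> makes
  t -> g t v its weak derivative, and \<open>weak_derivative_1d\<close> applies.\<close>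

lemma weak_increment:
  assumes d: "time_derivative \<Omega> T u g" and U: "continuous_L2 T U"
    and eq: "AE t in It T. AE x in M. U t x = u t x"
    and u: "u \<in> bochner_L2 T (space_V \<Omega>) (Vnorm \<Omega>)" and v: "v \<in> space_V \<Omega>"
    and ab: "0 < a" "a < b" "b < T"
  shows "(LINT x|M. U b x \<bullet> v x) - (LINT x|M. U a x \<bullet> v x) = (LINT t|It T. indicator {a<..<b} t * g t v)"
proof (rule weak_derivative_1d[OF continuous_L2_inner[OF U V_L2[OF v]] _ _ ab])
  have g: "g \<in> bochner_L2 T (dual_V \<Omega>) (dual_norm \<Omega>)" using d by (simp add: time_derivative_def L2V'_def)
  show "integrable (It T) (\<lambda>t. g t v)" by (rule pairing_integrable[OF g V.bochner_L2_const[OF v]])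
  fix \<theta> assume \<theta>: "\<theta> \<in> test_functions {0<..<T}"
  have uV: "AE t in It T. u t \<in> space_V \<Omega>" using u by (simp add: bochner_L2_def)
  have I: "AE t in It T. t \<in> {0<..<T}" by (rule AE_I2) simp
  have ae: "AE t in It T. deriv \<theta> t * (LINT x|M. U t x \<bullet> v x) = deriv \<theta> t * (LINT x|M. u t x \<bullet> v x)"
    using eq uV I
  proof eventually_elim
    case (elim t)
    have "(LINT x|M. U t x \<bullet> v x) = (LINT x|M. u t x \<bullet> v x)"
    proof (rule integral_cong_AE)
      show "(\<lambda>x. U t x \<bullet> v x) \<in> borel_measurable M"
        using elim(3) by (intro borel_measurable_integrable L2_inner(1) continuous_L2D[OF U] V_L2[OF v]) auto
      show "(\<lambda>x. u t x \<bullet> v x) \<in> borel_measurable M"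
        by (intro borel_measurable_integrable L2_inner(1) V_L2 elim(2) v)
      show "AE x in M. U t x \<bullet> v x = u t x \<bullet> v x" using elim(1) by eventually_elim simp
    qed
    then show ?case by simp
  qed
  have der: "deriv \<theta> t = dird \<theta> 1 t" for t
    using DERIV_test_line[OF \<theta>, of 0 1 t] by (intro DERIV_imp_deriv) simp
  have m: "(\<lambda>t. deriv \<theta> t * (LINT x|M. U t x \<bullet> v x)) \<in> borel_measurable (It T)"
  proof (rule borel_measurable_times)
    show "(\<lambda>t. deriv \<theta> t) \<in> borel_measurable (It T)"
      unfolding der by (rule test_measurable_lebesgue_on[OF test_dird[OF \<theta>]])
    have "continuous_on {0<..<T} (\<lambda>t. LINT x|M. U t x \<bullet> v x)"
      by (rule continuous_on_subset[OF continuous_L2_inner[OF U V_L2[OF v]]]) auto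
    then show "(\<lambda>t. LINT x|M. U t x \<bullet> v x) \<in> borel_measurable (It T)"
      by (rule continuous_imp_measurable_on_sets_lebesgue) simp
  qed
  have "(LINT t|It T. deriv \<theta> t * (LINT x|M. U t x \<bullet> v x)) = (LINT t|It T. deriv \<theta> t * (LINT x|M. u t x \<bullet> v x))"
    by (rule integral_cong_AE[OF m borel_measurable_lebesgue_on_AE[OF m _ ae] ae]) simp
  also have "\<dots> = - (LINT t|It T. \<theta> t * g t v)"
    using d \<theta> v by (simp add: time_derivative_def)
  finally show "(LINT t|It T. deriv \<theta> t * (LINT x|M. U t x \<bullet> v x)) = - (LINT t|It T. \<theta> t * g t v)" .
qed

text \<open>Increments of W are known against fixed v only, so the time-dependent w cannot be
  inserted directly. The increments of the defect of the identity are instead bounded by the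
  distances between values of w at nearby times, and \<open>constant_of_increment_bound\<close>
  shows that the defect is constant.\<close>

lemma energy_identity:
  assumes w: "w \<in> bochner_L2 T (space_V \<Omega>) (Vnorm \<Omega>)" and g: "g \<in> bochner_L2 T (dual_V \<Omega>) (dual_norm \<Omega>)"
    and W: "continuous_L2 T W" and eq: "AE t in It T. AE x in M. W t x = w t x"
    and incr: "\<And>v a b. v \<in> space_V \<Omega> \<Longrightarrow> 0 < a \<Longrightarrow> a < b \<Longrightarrow> b < T \<Longrightarrow>
      (LINT x|M. W b x \<bullet> v x) - (LINT x|M. W a x \<bullet> v x) = (LINT t|It T. indicator {a<..<b} t * g t v)"
    and s: "0 < s" "s < T"
  shows "(L2norm M (W s))\<^sup>2 / 2 - (L2norm M (W 0))\<^sup>2 / 2 = (LINT t|It T. indicator {0<..<s} t * g t (w t))"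
proof -
  obtain g' gs where g': "D.borel_rep T g' gs" "AE t in It T. g' t = g t" by (rule D.bochner_borel_rep[OF g])
  obtain w' ws where w': "V.borel_rep T w' ws" "AE t in It T. w' t = w t" by (rule V.bochner_borel_rep[OF w])
  note G = D.borel_repD[OF g'(1)] and V = V.borel_repD[OF w'(1)]
  define b where "b t = g' t (w' t)" for t
  have ib: "integrable lborel b" unfolding b_def[abs_def] by (rule pairing_integrable_rep[OF g'(1) w'(1)])
  have z: "g' t v = 0" if "t \<notin> {0<..<T}" for t v using G(3)[OF that] by simp
  have bz: "b r = 0" if "r \<notin> {0<..<T}" for r using z[OF that] by (simp add: b_def)
  \<comment> \<open>The defect of the identity as a function of the final time. At time 0 the
    integral is over an empty interval, so the claim is c s = c 0.\<close>
  define c where "c t = (L2norm M (W t))\<^sup>2 / 2 - (LINT r|lborel. indicator {0<..<t} r * b r)" for t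
  have cc: "continuous_on {0..T} c"
    unfolding c_def by (intro continuous_intros continuous_L2norm W continuous_on_indefinite_integral ib) simp
  have gm: "(\<lambda>t. dual_norm \<Omega> (g' t)) \<in> borel_measurable borel" by (rule D.N_measurable[OF G(1) G(4) G(6)])
  have nm: "(\<lambda>p. V.dN (w' (f p)) (w' (f' p))) \<in> borel_measurable N"
    if "f \<in> borel_measurable N" "f' \<in> borel_measurable N" for f f' :: "'q \<Rightarrow> real" and N
    by (rule V.d_measurable[OF V(1) V(1) V(4) V(4) V(6) V(6) that])
  have ni: "integrable lborel (\<lambda>t. (V.dN (w' (t + r)) (w' t))\<^sup>2)" for r
  proof (rule Bochner_Integration.integrable_bound[where f="\<lambda>t. 2 * (Vnorm \<Omega> (w' (t + r)))\<^sup>2 + 2 * (Vnorm \<Omega> (w' t))\<^sup>2"])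
    show "integrable lborel (\<lambda>t. 2 * (Vnorm \<Omega> (w' (t + r)))\<^sup>2 + 2 * (Vnorm \<Omega> (w' t))\<^sup>2)"
      using V(7) integrable_lborel_translate[OF V(7), of r] by simp
    show "AE t in lborel. norm ((V.dN (w' (t + r)) (w' t))\<^sup>2) \<le> norm (2 * (Vnorm \<Omega> (w' (t + r)))\<^sup>2 + 2 * (Vnorm \<Omega> (w' t))\<^sup>2)"
    proof (intro AE_I2)
      fix t
      have "(V.dN (w' (t + r)) (w' t))\<^sup>2 \<le> (Vnorm \<Omega> (w' (t + r)) + Vnorm \<Omega> (w' t))\<^sup>2"
        using V.N_diff_le[OF V(2) V(2)] by (intro power_mono V.d_nonneg) (simp add: V.dN_eq V(2))
      also have "\<dots> \<le> 2 * (Vnorm \<Omega> (w' (t + r)))\<^sup>2 + 2 * (Vnorm \<Omega> (w' t))\<^sup>2"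
        using sum_squares_bound[of "Vnorm \<Omega> (w' (t + r))" "Vnorm \<Omega> (w' t)"] by (simp add: power2_sum)
      finally show "norm ((V.dN (w' (t + r)) (w' t))\<^sup>2) \<le> norm (2 * (Vnorm \<Omega> (w' (t + r)))\<^sup>2 + 2 * (Vnorm \<Omega> (w' t))\<^sup>2)"
        by simp
    qed
    have "(\<lambda>t. V.dN (w' (t + r)) (w' t)) \<in> borel_measurable lborel" by (rule nm) auto
    then show "(\<lambda>t. (V.dN (w' (t + r)) (w' t))\<^sup>2) \<in> borel_measurable lborel" by simp
  qed
  \<comment> \<open>For fixed t the pairing does not decay in r through w' t; it is integrable
    because g' vanishes outside (0, T), hence the indicator in the dominating function.\<close>
  have sl: "integrable lborel (\<lambda>r. g' r (w' t))" for t
  proof (rule Bochner_Integration.integrable_bound[where f="\<lambda>r. (dual_norm \<Omega> (g' r))\<^sup>2 + (Vnorm \<Omega> (w' t))\<^sup>2 * indicator {0<..<T} r"])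
    show "integrable lborel (\<lambda>r. (dual_norm \<Omega> (g' r))\<^sup>2 + (Vnorm \<Omega> (w' t))\<^sup>2 * indicator {0<..<T} r)"
      using G(7) emeasure_bounded_finite[of "{0<..<T}"]
      by (intro Bochner_Integration.integrable_add integrable_mult_right integrable_real_indicator) auto
    show "(\<lambda>r. g' r (w' t)) \<in> borel_measurable lborel"
      using pairing_measurable[OF g'(1) w'(1), of id borel "\<lambda>_. t"] by simp
    show "AE r in lborel. norm (g' r (w' t)) \<le> norm ((dual_norm \<Omega> (g' r))\<^sup>2 + (Vnorm \<Omega> (w' t))\<^sup>2 * indicator {0<..<T} r)"
    proof (intro AE_I2)
      fix r
      show "norm (g' r (w' t)) \<le> norm ((dual_norm \<Omega> (g' r))\<^sup>2 + (Vnorm \<Omega> (w' t))\<^sup>2 * indicator {0<..<T} r)"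
      proof (cases "r \<in> {0<..<T}")
        case True
        have "\<bar>g' r (w' t)\<bar> \<le> dual_norm \<Omega> (g' r) * Vnorm \<Omega> (w' t)" by (rule dual_norm_bound[OF G(2) V(2)])
        moreover have "2 * (dual_norm \<Omega> (g' r) * Vnorm \<Omega> (w' t)) \<le> (dual_norm \<Omega> (g' r))\<^sup>2 + (Vnorm \<Omega> (w' t))\<^sup>2"
          using sum_squares_bound[of "dual_norm \<Omega> (g' r)" "Vnorm \<Omega> (w' t)"] by simp
        moreover have "0 \<le> dual_norm \<Omega> (g' r) * Vnorm \<Omega> (w' t)" using D.N_nonneg[OF G(2)] V.N_nonneg[OF V(2)] by simp
        ultimately have "\<bar>g' r (w' t)\<bar> \<le> \<bar>(dual_norm \<Omega> (g' r))\<^sup>2 + (Vnorm \<Omega> (w' t))\<^sup>2\<bar>" by linarith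
        then show ?thesis using True by simp
      qed (simp add: z)
    qed
  qed
  have "AE t in It T. AE x in M. W t x = w' t x" using eq w'(2)
    by eventually_elim simp
  then have "AE t in lborel. t \<in> {0<..<T} \<longrightarrow> (AE x in M. W t x = w' t x)" by (simp add: AE_lebesgue_on_iff)
  then obtain Z where Z: "Z \<in> null_sets lborel" "{t. \<not> (t \<in> {0<..<T} \<longrightarrow> (AE x in M. W t x = w' t x))} \<subseteq> Z"
    by (elim AE_E) (auto simp: null_sets_def)
  have WZ: "AE x in M. W t x = w' t x" if "t \<in> {0<..<T} - Z" for t using Z(2) that by blast
  have inc: "ennreal \<bar>c t' - c t\<bar> \<le> (\<integral>\<^sup>+r. indicator {t<..<t'} r * ennreal (dual_norm \<Omega> (g' r) * (V.dN (w' r) (w' t) + V.dN (w' r) (w' t'))) \<partial>lborel)"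
    if t: "t \<in> {0<..<T} - Z" and t': "t' \<in> {0<..<T} - Z" and tt: "t < t'" for t t'
  proof -
    \<comment> \<open>Up to null sets v is W t' + W t, so (W t' - W t).v = |W t'|^2 - |W t|^2. This
      is why t and t' have to avoid Z: only there is the curve W known to agree with the V-valued
      w'.\<close>
    define v where "v x = w' t' x + w' t x" for x
    have v: "v \<in> space_V \<Omega>" using V_lincomb[OF V(2)[of t'] V(2)[of t], of 1 1] by (simp add: v_def[abs_def])
    have ind: "integrable lborel (\<lambda>r. indicator {p<..<q} r * f r)" if "integrable lborel f" for f :: "real \<Rightarrow> real" and p q
      using integrable_real_mult_indicator[OF _ that, of "{p<..<q}"] by (simp add: mult.commute)
    have g'v: "g' r v = g' r (w' t') + g' r (w' t)" for r
      using dual_add_arg[OF G(2) V(2)[of t'] V(2)[of t]] by (simp add: v_def[abs_def])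
    have iv: "integrable lborel (\<lambda>r. g' r v)" unfolding g'v by (intro Bochner_Integration.integrable_add sl)
    have Lt: "square_integrable M (W t)" and Lt': "square_integrable M (W t')"
      using continuous_L2D[OF W] t t' by auto
    have "(L2norm M (W t'))\<^sup>2 - (L2norm M (W t))\<^sup>2 = (LINT x|M. (norm (W t' x))\<^sup>2 - (norm (W t x))\<^sup>2)"
      using Lt Lt' by (simp add: L2norm_sq L2_integrable)
    also have "\<dots> = (LINT x|M. W t' x \<bullet> v x - W t x \<bullet> v x)"
    proof (rule integral_cong_AE)
      show "AE x in M. (norm (W t' x))\<^sup>2 - (norm (W t x))\<^sup>2 = W t' x \<bullet> v x - W t x \<bullet> v x"
        using WZ[OF t] WZ[OF t']
        by eventually_elim (simp add: v_def power2_norm_eq_inner inner_add_right inner_commute)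
    qed (intro borel_measurable_integrable Bochner_Integration.integrable_diff L2_integrable L2_inner(1) Lt Lt' V_L2[OF v])+
    also have "\<dots> = (LINT x|M. W t' x \<bullet> v x) - (LINT x|M. W t x \<bullet> v x)"
      by (intro Bochner_Integration.integral_diff L2_inner(1) Lt Lt' V_L2[OF v])
    also have "\<dots> = (LINT r|It T. indicator {t<..<t'} r * g r v)"
      using t t' tt by (intro incr v) auto
    also have "\<dots> = (LINT r|lborel. indicator {t<..<t'} r * g' r v)"
    proof -
      note iv2 = ind[OF iv, of t t']
      have i3: "integrable (It T) (\<lambda>r. indicator {t<..<t'} r * g' r v)"
        by (rule integral_lebesgue_on_eq_lborel(2)[OF _ _ _ iv2]) (use borel_measurable_integrable[OF iv2] z in auto)
      have "AE r in It T. indicator {t<..<t'} r * g' r v = indicator {t<..<t'} r * g r v"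
        using g'(2) by eventually_elim simp
      from integrable_lebesgue_on_cong_AE(2)[OF i3 _ this]
      have "(LINT r|It T. indicator {t<..<t'} r * g r v) = (LINT r|It T. indicator {t<..<t'} r * g' r v)" by simp
      also have "\<dots> = (LINT r|lborel. indicator {t<..<t'} r * g' r v)"
        by (rule integral_lebesgue_on_eq_lborel(1)) (use borel_measurable_integrable[OF iv2] z in auto)
      finally show ?thesis .
    qed
    finally have e: "(L2norm M (W t'))\<^sup>2 - (L2norm M (W t))\<^sup>2 = (LINT r|lborel. indicator {t<..<t'} r * g' r v)" .
    have "(LINT r|lborel. indicator {0<..<t'} r * b r) - (LINT r|lborel. indicator {0<..<t} r * b r)
        = (LINT r|lborel. indicator {0<..<t'} r * b r - indicator {0<..<t} r * b r)"
      by (rule Bochner_Integration.integral_diff[symmetric]) (intro ind ib)+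
    also have "\<dots> = (LINT r|lborel. indicator {t<..<t'} r * b r)"
    proof (rule integral_cong_AE)
      show "AE r in lborel. indicator {0<..<t'} r * b r - indicator {0<..<t} r * b r = indicator {t<..<t'} r * b r"
        using AE_lborel_singleton[of t] by eventually_elim (use t t' tt in \<open>auto simp: indicator_def\<close>)
    qed (intro borel_measurable_integrable Bochner_Integration.integrable_diff ind ib)+
    finally have "c t' - c t = (LINT r|lborel. indicator {t<..<t'} r * g' r v) / 2 - (LINT r|lborel. indicator {t<..<t'} r * b r)"
      using e by (simp add: c_def field_simps)
    also have "\<dots> = (LINT r|lborel. indicator {t<..<t'} r * g' r v / 2 - indicator {t<..<t'} r * b r)"
      using ind[OF iv, of t t'] ind[OF ib, of t t'] by simp
    finally have ce: "c t' - c t = (LINT r|lborel. indicator {t<..<t'} r * g' r v / 2 - indicator {t<..<t'} r * b r)" .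
    have ii: "integrable lborel (\<lambda>r. indicator {t<..<t'} r * g' r v / 2 - indicator {t<..<t'} r * b r)"
      using ind[OF iv, of t t'] ind[OF ib, of t t'] by simp
    \<comment> \<open>Half of v is the mean of w' t and w' t', and each of these differs from w' r
      by the distance on the right.\<close>
    have pt: "\<bar>g' r v / 2 - b r\<bar> \<le> dual_norm \<Omega> (g' r) * (V.dN (w' r) (w' t) + V.dN (w' r) (w' t'))" for r
    proof -
      have d: "\<bar>g' r (w' q) - g' r (w' r)\<bar> \<le> dual_norm \<Omega> (g' r) * V.dN (w' r) (w' q)" for q
        using dual_norm_bound[OF G(2) V.diff_mem[OF V(2)[of q] V(2)[of r]], of r] V.d_sym[of "w' r" "w' q"]
        by (simp add: dual_diff_arg G V V.dN_eq)
      have "g' r v / 2 - b r = ((g' r (w' t') - g' r (w' r)) + (g' r (w' t) - g' r (w' r))) / 2"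
        by (simp add: g'v b_def field_simps)
      moreover have "0 \<le> dual_norm \<Omega> (g' r) * V.dN (w' r) (w' q)" for q
        using D.N_nonneg[OF G(2)] V.d_nonneg by simp
      ultimately show ?thesis using d[of t] d[of t'] by (simp add: distrib_left abs_le_iff)
    qed
    have "ennreal \<bar>c t' - c t\<bar> = ennreal (norm (LINT r|lborel. indicator {t<..<t'} r * g' r v / 2 - indicator {t<..<t'} r * b r))"
      unfolding ce real_norm_def ..
    also have "\<dots> \<le> (\<integral>\<^sup>+r. ennreal (norm (indicator {t<..<t'} r * g' r v / 2 - indicator {t<..<t'} r * b r)) \<partial>lborel)"
      by (rule integral_norm_bound_ennreal[OF ii])
    also have "\<dots> \<le> (\<integral>\<^sup>+r. indicator {t<..<t'} r * ennreal (dual_norm \<Omega> (g' r) * (V.dN (w' r) (w' t) + V.dN (w' r) (w' t'))) \<partial>lborel)"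
      using pt by (intro nn_integral_mono) (auto simp: indicator_def intro!: ennreal_leI)
    finally show ?thesis .
  qed
  have "c s = c 0"
  proof (rule constant_of_increment_bound[where n="\<lambda>r t. V.dN (w' r) (w' t)", OF cc gm G(7) _ ni _ Z(1) inc s])
    show "(\<lambda>p. V.dN (w' (fst p)) (w' (snd p))) \<in> borel_measurable (borel \<Otimes>\<^sub>M borel)"
      by (rule nm) auto
    show "(\<lambda>k. LINT t|lborel. (V.dN (w' (t + \<rho> k)) (w' t))\<^sup>2) \<longlonglongrightarrow> 0" if "\<rho> \<longlonglongrightarrow> 0" for \<rho>
      by (rule V.translation_tendsto[OF V(1) V(4) V(6) V.zero_mem V(3) _ that]) (use V(2,7) in \<open>auto simp: V.dN_zero\<close>)
  qed
  then have "(L2norm M (W s))\<^sup>2 / 2 - (L2norm M (W 0))\<^sup>2 / 2 = (LINT r|lborel. indicator {0<..<s} r * b r)"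
    by (simp add: c_def)
  also have "\<dots> = (LINT r|It T. indicator {0<..<s} r * b r)"
    by (rule integral_lebesgue_on_eq_lborel(1)[symmetric]) (use borel_measurable_integrable[OF ib] bz in auto)
  also have "\<dots> = (LINT t|It T. indicator {0<..<s} t * g t (w t))"
  proof (rule integrable_lebesgue_on_cong_AE(2))
    have i1: "integrable lborel (\<lambda>r. indicator {0<..<s} r * b r)"
      using integrable_real_mult_indicator[OF _ ib, of "{0<..<s}"] by (simp add: mult.commute)
    show "integrable (It T) (\<lambda>r. indicator {0<..<s} r * b r)"
      by (rule integral_lebesgue_on_eq_lborel(2)[OF _ _ _ i1]) (use borel_measurable_integrable[OF i1] bz in auto)
    show "AE t in It T. indicator {0<..<s} t * b t = indicator {0<..<s} t * g t (w t)"
      using g'(2) w'(2) by eventually_elim (simp add: b_def)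
  qed simp
  finally show ?thesis .
qed

end

section \<open>Uniqueness of weak solutions\<close>

lemma sym_part_diff: "sym_part (A - B) = sym_part A - sym_part B"
  by (simp add: vec_eq_iff sym_part_def transpose_def field_simps)

lemma sym_part_zero: "sym_part 0 = 0"
  by (simp add: sym_part_def transpose_def vec_eq_iff)

lemma spacetime_borel_measurableI:
  "f \<in> borel_measurable borel \<Longrightarrow> f \<in> borel_measurable (spacetime \<Omega> T)"
  unfolding spacetime_def by (rule borel_measurable_lebesgue_onI)

lemma borel_measurable_time_cutoff:
  fixes F :: "(real^2) \<times> real \<Rightarrow> 'b::euclidean_space"
  assumes "F \<in> borel_measurable (spacetime \<Omega> T)"
  shows "(\<lambda>z. if snd z < s then F z else 0) \<in> borel_measurable (spacetime \<Omega> T)"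
proof -
  have "(\<lambda>z::(real^2) \<times> real. indicator {z. snd z < s} z :: real) \<in> borel_measurable borel"
    by (intro borel_measurable_indicator borel_open open_Collect_less continuous_intros)
  then have "(\<lambda>z. indicator {z. snd z < s} z *\<^sub>R F z) \<in> borel_measurable (spacetime \<Omega> T)"
    by (intro borel_measurable_scaleR assms spacetime_borel_measurableI)
  also have "(\<lambda>z. indicator {z. snd z < s} z *\<^sub>R F z) = (\<lambda>z. if snd z < s then F z else 0)"
    by (auto simp: fun_eq_iff indicator_def)
  finally show ?thesis .
qed

section \<open>The difference of two weak solutions\<close>

context bounded_open
begin

text \<open>Both L^4 norms cost the square root of a gradient norm times R, so the whole form is at
  most quadratic in the gradients. Along curves bounded in L^2 it is therefore integrable in
  time.\<close>

lemma conv_growth: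
  assumes u: "has_grad u G" "L2norm M u \<le> R" and w: "has_grad w H" "L2norm M w \<le> R"
  shows "\<bar>conv G u w\<bar> \<le> 4 * R * ((L2norm M G)\<^sup>2 + (L2norm M H)\<^sup>2)"
proof -
  let ?a = "L2norm M G" and ?p = "L2norm M H"
  have a: "0 \<le> ?a" and p: "0 \<le> ?p" by (simp_all add: L2norm_nonneg)
  have R: "0 \<le> R" using u(2) L2norm_nonneg[of M u] by linarith
  have "N4 M u \<le> 4 * R * ?a"
    using ladyzhenskaya_vec(2)[OF u(1)] mult_right_mono[OF u(2) a] by linarith
  moreover have "N4 M w \<le> 4 * R * ?p"
    using ladyzhenskaya_vec(2)[OF w(1)] mult_right_mono[OF w(2) p] by linarith
  ultimately have "N4 M u * N4 M w \<le> (4 * R * ?a) * (4 * R * ?p)"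
    using R a p by (intro mult_mono) (auto simp: N4_nonneg)
  also have "\<dots> \<le> (4 * R * ((?a + ?p) / 2))\<^sup>2"
  proof -
    have "?a * ?p \<le> ((?a + ?p) / 2)\<^sup>2"
      using zero_le_power2[of "?a - ?p"] by (simp add: power2_eq_square field_simps)
    then have "(4 * R)\<^sup>2 * (?a * ?p) \<le> (4 * R)\<^sup>2 * ((?a + ?p) / 2)\<^sup>2" by (intro mult_left_mono) auto
    moreover have "(4 * R * ?a) * (4 * R * ?p) = (4 * R)\<^sup>2 * (?a * ?p)" by (simp add: power2_eq_square)
    ultimately show ?thesis by (simp only: power_mult_distrib[of "4 * R"])
  qed
  finally have "sqrt (N4 M u * N4 M w) \<le> 4 * R * ((?a + ?p) / 2)"
    using R a p by (intro real_le_lsqrt) auto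
  then have "\<bar>conv G u w\<bar> \<le> ?a * (4 * R * ((?a + ?p) / 2))"
    using conv_bound(2)[OF has_grad_L2(2)[OF u(1)] ladyzhenskaya_vec(1)[OF u(1)] ladyzhenskaya_vec(1)[OF w(1)]]
      mult_left_mono[OF _ a] by fastforce
  also have "\<dots> = 4 * R * (?a * (?a + ?p) / 2)" by simp
  also have "\<dots> \<le> 4 * R * (?a\<^sup>2 + ?p\<^sup>2)"
  proof (intro mult_left_mono)
    have "2 * (?a * ?p) \<le> ?a\<^sup>2 + ?p\<^sup>2" using sum_squares_bound[of ?a ?p] by simp
    moreover have "?a * (?a + ?p) = ?a\<^sup>2 + ?a * ?p" by (simp add: distrib_left power2_eq_square)
    ultimately show "?a * (?a + ?p) / 2 \<le> ?a\<^sup>2 + ?p\<^sup>2"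
      using zero_le_power2[of ?a] zero_le_power2[of ?p] by linarith
  qed (use R in simp)
  finally show ?thesis .
qed

lemma continuous_L2_bounded:
  assumes "continuous_L2 T U"
  obtains R where "0 \<le> R" "\<forall>t\<in>{0..T}. L2norm M (U t) \<le> R"
proof -
  have "bounded ((\<lambda>t. L2norm M (U t)) ` {0..T})"
    by (intro compact_imp_bounded compact_continuous_image continuous_L2norm assms compact_Icc)
  then obtain B where B: "\<forall>y\<in>(\<lambda>t. L2norm M (U t)) ` {0..T}. norm y \<le> B" unfolding bounded_iff by blast
  show thesis
  proof (rule that[of "max B 0"])
    show "\<forall>t\<in>{0..T}. L2norm M (U t) \<le> max B 0" using B by (auto simp: le_max_iff_disj)
  qed simp
qed

text \<open>The integral of a nonintegrable function is 0 by convention, so integrability of each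
  term must be known before two weak formulations are subtracted under the integral sign. The bound
  R holds for the test function used later because it is a cut-off of a curve continuous into
  L^2.\<close>

lemma tested_terms_integrable:
  assumes u: "u \<in> L2V \<Omega> T" and g: "g \<in> L2V' \<Omega> T" and G: "space_gradient \<Omega> T u G"
    and U: "continuous_L2 T U" "AE t in It T. AE x in M. U t x = u t x"
    and \<phi>: "\<phi> \<in> L2V \<Omega> T" "space_gradient \<Omega> T \<phi> \<Phi>"
    and R: "AE t in It T. L2norm M (\<phi> t) \<le> R"
  shows "integrable (It T) (\<lambda>t. g t (\<phi> t))" "integrable (It T) (\<lambda>t. conv (G t) (u t) (\<phi> t))"
proof -
  have b: "u \<in> bochner_L2 T (space_V \<Omega>) (Vnorm \<Omega>)" "\<phi> \<in> bochner_L2 T (space_V \<Omega>) (Vnorm \<Omega>)"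
    using u \<phi>(1) by (simp_all add: L2V_def)
  show "integrable (It T) (\<lambda>t. g t (\<phi> t))"
    by (rule pairing_integrable[OF _ b(2)]) (use g in \<open>simp add: L2V'_def\<close>)
  have hu: "AE t in It T. has_grad (u t) (G t)" "AE t in It T. has_grad (\<phi> t) (\<Phi> t)"
    using b G \<phi>(2) by (auto simp: bochner_L2_def space_gradient_def has_grad_def)
  obtain R' where R': "\<forall>t\<in>{0..T}. L2norm M (U t) \<le> R'" by (rule continuous_L2_bounded[OF U(1)]) blast
  have I: "AE t in It T. t \<in> {0<..<T}" by (rule AE_I2) simp
  show "integrable (It T) (\<lambda>t. conv (G t) (u t) (\<phi> t))"
  proof (rule Bochner_Integration.integrable_bound)
    show "integrable (It T) (\<lambda>t. 4 * max R R' * ((Vnorm \<Omega> (u t))\<^sup>2 + (Vnorm \<Omega> (\<phi> t))\<^sup>2))"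
      using b by (auto simp: bochner_L2_def)
    have m: "(\<lambda>z. (G (snd z) (fst z) *v u (snd z) (fst z)) \<bullet> \<phi> (snd z) (fst z)) \<in> borel_measurable (spacetime \<Omega> T)"
      using u G \<phi>(1) by (intro borel_measurable_inner borel_measurable_matrix_vector)
        (simp_all add: L2V_def space_gradient_def case_prod_beta')
    show "(\<lambda>t. conv (G t) (u t) (\<phi> t)) \<in> borel_measurable (It T)"
      using spacetime_integral_slice(1)[OF m] by (simp add: conv_def)
    show "AE t in It T. norm (conv (G t) (u t) (\<phi> t)) \<le> norm (4 * max R R' * ((Vnorm \<Omega> (u t))\<^sup>2 + (Vnorm \<Omega> (\<phi> t))\<^sup>2))"
      using hu R U(2) I
    proof eventually_elim
      case (elim t)
      have "L2norm M (u t) = L2norm M (U t)"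
        using elim(4,5) has_grad_L2(1)[OF elim(1)] continuous_L2D[OF U(1), of t]
        by (intro L2norm_cong_AE) (auto dest: L2_measurable elim: eventually_mono)
      then have 1: "L2norm M (u t) \<le> max R R'" using R' elim(5) by (auto simp: le_max_iff_disj)
      have 2: "L2norm M (\<phi> t) \<le> max R R'" using elim(3) by simp
      have "\<bar>conv (G t) (u t) (\<phi> t)\<bar> \<le> 4 * max R R' * ((Vnorm \<Omega> (u t))\<^sup>2 + (Vnorm \<Omega> (\<phi> t))\<^sup>2)"
        using conv_growth[OF elim(1) 1 elim(2) 2] by (simp add: Vnorm_eq[OF elim(1)] Vnorm_eq[OF elim(2)])
      then show ?case by simp
    qed
  qed
qed

text \<open>\<open>A\<close> evaluates the time derivatives, \<open>B\<close> bounds the stresses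
  from below and \<open>C\<close> the convective terms from above. The dissipation gained in
  \<open>B\<close> is exactly what \<open>C\<close> spends, so no gradient of the difference
  remains.\<close>

lemma energy_inequality:
  assumes \<mu>: "\<mu> > 0" and \<tau>y: "\<tau>y > 0"
    and u: "u1 \<in> L2V \<Omega> T" "u2 \<in> L2V \<Omega> T"
    and \<tau>: "square_integrable (spacetime \<Omega> T) (\<lambda>(x, t). \<tau>1 t x)" "square_integrable (spacetime \<Omega> T) (\<lambda>(x, t). \<tau>2 t x)"
    and g: "time_derivative \<Omega> T u1 g1" "time_derivative \<Omega> T u2 g2"
    and G: "space_gradient \<Omega> T u1 G1" "space_gradient \<Omega> T u2 G2"
    and law: "bingham_law \<Omega> T \<mu> \<tau>y G1 \<tau>1" "bingham_law \<Omega> T \<mu> \<tau>y G2 \<tau>2"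
    and weak: "\<And>\<phi> \<Phi>. \<phi> \<in> L2V \<Omega> T \<Longrightarrow> space_gradient \<Omega> T \<phi> \<Phi> \<Longrightarrow>
           (LINT t|It T. g1 t (\<phi> t))
           + (LINT z|spacetime \<Omega> T. \<tau>1 (snd z) (fst z) \<bullet> sym_part (\<Phi> (snd z) (fst z)))
           + (LINT t|It T. conv (G1 t) (u1 t) (\<phi> t))
           = (LINT t|It T. g2 t (\<phi> t))
           + (LINT z|spacetime \<Omega> T. \<tau>2 (snd z) (fst z) \<bullet> sym_part (\<Phi> (snd z) (fst z)))
           + (LINT t|It T. conv (G2 t) (u2 t) (\<phi> t))"
    and U: "continuous_L2 T U1" "continuous_L2 T U2"
      "AE t in It T. AE x in M. U1 t x = u1 t x" "AE t in It T. AE x in M. U2 t x = u2 t x"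
    and s: "0 < s" "s < T"
  defines "W \<equiv> \<lambda>t x. U1 t x - U2 t x"
  shows "(L2norm M (W s))\<^sup>2 / 2 - (L2norm M (W 0))\<^sup>2 / 2
     \<le> (LINT t|It T. indicator {0<..<s} t * (4 / \<mu> * (Vnorm \<Omega> (u1 t))\<^sup>2 * (L2norm M (W t))\<^sup>2))"
proof -
  define w where "w t x = u1 t x - u2 t x" for t x
  define H where "H t x = G1 t x - G2 t x" for t x
  define \<phi> where "\<phi> t x = (if t < s then w t x else 0)" for t x
  define \<Phi> where "\<Phi> t x = (if t < s then H t x else 0)" for t x
  have b: "u1 \<in> bochner_L2 T (space_V \<Omega>) (Vnorm \<Omega>)" "u2 \<in> bochner_L2 T (space_V \<Omega>) (Vnorm \<Omega>)"
    using u by (simp_all add: L2V_def)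
  have bw: "w \<in> bochner_L2 T (space_V \<Omega>) (Vnorm \<Omega>)" unfolding w_def[abs_def] by (rule V.bochner_L2_diff[OF b])
  have b\<phi>: "\<phi> \<in> bochner_L2 T (space_V \<Omega>) (Vnorm \<Omega>)" unfolding \<phi>_def[abs_def] by (rule V.bochner_L2_cutoff[OF bw])
  have gL: "g1 \<in> L2V' \<Omega> T" "g2 \<in> L2V' \<Omega> T" using g by (simp_all add: time_derivative_def)
  have bg: "(\<lambda>t v. g1 t v - g2 t v) \<in> bochner_L2 T (dual_V \<Omega>) (dual_norm \<Omega>)"
    using gL unfolding L2V'_def by (rule D.bochner_L2_diff)
  have mu: "(\<lambda>z. u1 (snd z) (fst z)) \<in> borel_measurable (spacetime \<Omega> T)" "(\<lambda>z. u2 (snd z) (fst z)) \<in> borel_measurable (spacetime \<Omega> T)"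
    using u by (simp_all add: L2V_def case_prod_beta')
  have mG: "(\<lambda>z. G1 (snd z) (fst z)) \<in> borel_measurable (spacetime \<Omega> T)" "(\<lambda>z. G2 (snd z) (fst z)) \<in> borel_measurable (spacetime \<Omega> T)"
    using G by (simp_all add: space_gradient_def case_prod_beta')
  have m\<phi>: "(\<lambda>z. \<phi> (snd z) (fst z)) \<in> borel_measurable (spacetime \<Omega> T)"
    unfolding \<phi>_def w_def by (intro borel_measurable_time_cutoff borel_measurable_diff mu)
  have m\<Phi>: "(\<lambda>z. \<Phi> (snd z) (fst z)) \<in> borel_measurable (spacetime \<Omega> T)"
    unfolding \<Phi>_def H_def by (intro borel_measurable_time_cutoff borel_measurable_diff mG)
  have \<phi>L: "\<phi> \<in> L2V \<Omega> T" using b\<phi> m\<phi> by (simp add: L2V_def case_prod_beta')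
  have hu: "AE t in It T. has_grad (u1 t) (G1 t)" "AE t in It T. has_grad (u2 t) (G2 t)"
    using b G by (auto simp: bochner_L2_def space_gradient_def has_grad_def)
  have h\<phi>: "AE t in It T. has_grad (\<phi> t) (\<Phi> t)"
    using hu
  proof eventually_elim
    case (elim t)
    show ?case
      using has_grad_diff[OF elim] has_grad_zero by (cases "t < s") (simp_all add: \<phi>_def[abs_def] \<Phi>_def[abs_def] w_def H_def)
  qed
  have sg: "space_gradient \<Omega> T \<phi> \<Phi>"
    using m\<Phi> h\<phi> by (auto simp: space_gradient_def case_prod_beta' has_grad_def elim: eventually_mono)
  have W: "continuous_L2 T W" unfolding W_def by (rule continuous_L2_diff[OF U(1,2)])
  have Ww: "AE t in It T. AE x in M. W t x = w t x"
    using U(3,4)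
  proof eventually_elim
    case (elim t)
    then show ?case by eventually_elim (simp add: W_def w_def)
  qed
  have I: "AE t in It T. t \<in> {0<..<T}" by (rule AE_I2) simp
  have hw: "AE t in It T. has_grad (w t) (H t)"
    using hu by eventually_elim (use has_grad_diff in \<open>simp add: w_def[abs_def] H_def[abs_def]\<close>)
  have nw: "AE t in It T. L2norm M (w t) = L2norm M (W t)"
    using hw Ww I
  proof eventually_elim
    case (elim t)
    then show ?case
      using has_grad_L2(1)[OF elim(1)] continuous_L2D[OF W, of t]
      by (intro L2norm_cong_AE) (auto dest: L2_measurable elim: eventually_mono)
  qed
  obtain R where R: "0 \<le> R" "\<forall>t\<in>{0..T}. L2norm M (W t) \<le> R" by (rule continuous_L2_bounded[OF W])
  have \<phi>0: "\<phi> t = (\<lambda>_. 0)" if "\<not> t < s" for t using that by (simp add: \<phi>_def[abs_def])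
  have \<phi>w: "\<phi> t = w t" if "t < s" for t using that by (simp add: \<phi>_def[abs_def])
  have R\<phi>: "AE t in It T. L2norm M (\<phi> t) \<le> R"
    using nw I
  proof eventually_elim
    case (elim t)
    then show ?case using R by (cases "t < s") (auto simp: \<phi>w \<phi>0 L2norm_def[of M "\<lambda>_. 0"])
  qed
  note i1 = tested_terms_integrable[OF u(1) gL(1) G(1) U(1,3) \<phi>L sg R\<phi>]
    and i2 = tested_terms_integrable[OF u(2) gL(2) G(2) U(2,4) \<phi>L sg R\<phi>]
  note eqn = weak[OF \<phi>L sg]
  have incr: "(LINT x|M. W q x \<bullet> v x) - (LINT x|M. W p x \<bullet> v x) = (LINT t|It T. indicator {p<..<q} t * (g1 t v - g2 t v))"
    if v: "v \<in> space_V \<Omega>" and pq: "0 < p" "p < q" "q < T" for v p q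
  proof -
    have L: "square_integrable M (U1 r)" "square_integrable M (U2 r)" if "r \<in> {0..T}" for r
      using continuous_L2D U that by auto
    have split: "(LINT x|M. W r x \<bullet> v x) = (LINT x|M. U1 r x \<bullet> v x) - (LINT x|M. U2 r x \<bullet> v x)" if "r \<in> {0..T}" for r
      using L[OF that] V_L2[OF v] by (simp add: W_def inner_diff_left L2_inner)
    have ig: "integrable (It T) (\<lambda>t. indicator {p<..<q} t * g t v)" if "g \<in> L2V' \<Omega> T" for g
    proof -
      have i: "integrable (It T) (\<lambda>t. g t v)"
        by (rule pairing_integrable[OF _ V.bochner_L2_const[OF v]]) (use that in \<open>simp add: L2V'_def\<close>)
      show ?thesis
        by (rule Bochner_Integration.integrable_bound[OF i
              borel_measurable_times[OF borel_measurable_lebesgue_onI borel_measurable_integrable[OF i]]])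
           (auto simp: indicator_def)
    qed
    have "(LINT x|M. W q x \<bullet> v x) - (LINT x|M. W p x \<bullet> v x)
        = (LINT t|It T. indicator {p<..<q} t * g1 t v) - (LINT t|It T. indicator {p<..<q} t * g2 t v)"
      using weak_increment[OF g(1) U(1,3) b(1) v pq] weak_increment[OF g(2) U(2,4) b(2) v pq] split[of p] split[of q] pq
      by simp
    then show ?thesis using ig[OF gL(1)] ig[OF gL(2)] by (simp add: right_diff_distrib)
  qed
  have "(LINT t|It T. g1 t (\<phi> t)) - (LINT t|It T. g2 t (\<phi> t)) = (LINT t|It T. g1 t (\<phi> t) - g2 t (\<phi> t))"
    using i1(1) i2(1) by simp
  also have "\<dots> = (LINT t|It T. indicator {0<..<s} t * (g1 t (w t) - g2 t (w t)))"
  proof (rule integrable_lebesgue_on_cong_AE(2))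
    show "integrable (It T) (\<lambda>t. g1 t (\<phi> t) - g2 t (\<phi> t))" using i1(1) i2(1) by simp
    have "AE t in It T. (\<lambda>v. g1 t v - g2 t v) \<in> dual_V \<Omega>" using bg by (simp add: bochner_L2_def)
    then show "AE t in It T. g1 t (\<phi> t) - g2 t (\<phi> t) = indicator {0<..<s} t * (g1 t (w t) - g2 t (w t))"
      using I
    proof eventually_elim
      case (elim t)
      then show ?case using dual_zero_arg[OF elim(1)] by (cases "t < s") (simp_all add: \<phi>w \<phi>0)
    qed
  qed simp
  also have "\<dots> = (L2norm M (W s))\<^sup>2 / 2 - (L2norm M (W 0))\<^sup>2 / 2"
    by (rule energy_identity[OF bw bg W Ww incr s, symmetric])
  finally have A: "(LINT t|It T. g1 t (\<phi> t)) - (LINT t|It T. g2 t (\<phi> t)) = (L2norm M (W s))\<^sup>2 / 2 - (L2norm M (W 0))\<^sup>2 / 2" .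
  have iV: "integrable (It T) (\<lambda>t. (Vnorm \<Omega> (\<phi> t))\<^sup>2)" using b\<phi> by (simp add: bochner_L2_def)
  have VeL: "AE t in It T. (Vnorm \<Omega> (\<phi> t))\<^sup>2 = (L2norm M (\<lambda>x. \<Phi> t x))\<^sup>2"
    using h\<phi> by eventually_elim (simp add: Vnorm_eq)
  have L\<Phi>: "square_integrable (spacetime \<Omega> T) (\<lambda>z. \<Phi> (snd z) (fst z))"
  proof (rule spacetime_L2[OF m\<Phi>])
    show "AE t in It T. square_integrable M (\<lambda>x. \<Phi> (snd (x, t)) (fst (x, t)))"
      using h\<phi> by eventually_elim (simp add: has_grad_L2)
    show "integrable (It T) (\<lambda>t. (L2norm M (\<lambda>x. \<Phi> (snd (x, t)) (fst (x, t))))\<^sup>2)"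
      using integrable_lebesgue_on_cong_AE(1)[OF iV _ VeL] by simp
  qed
  have LD: "square_integrable (spacetime \<Omega> T) (\<lambda>z. sym_part (\<Phi> (snd z) (fst z)))"
    by (rule L2_bound[OF L\<Phi>, where C=1]) (use m\<Phi> norm_sym_part_le in auto)
  have L\<tau>: "square_integrable (spacetime \<Omega> T) (\<lambda>z. \<tau>1 (snd z) (fst z))" "square_integrable (spacetime \<Omega> T) (\<lambda>z. \<tau>2 (snd z) (fst z))"
    using \<tau> by (simp_all add: case_prod_beta')
  note j1 = L2_inner(1)[OF L\<tau>(1) LD] and j2 = L2_inner(1)[OF L\<tau>(2) LD]
  have iD: "integrable (spacetime \<Omega> T) (\<lambda>z. (norm (sym_part (\<Phi> (snd z) (fst z))))\<^sup>2)" by (rule L2_integrable[OF LD])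
  \<comment> \<open>Korn's identity on each slice costs a factor 1/2, which reduces the monotonicity
    constant 2 \<mu> to \<mu>.\<close>
  have "\<mu> * (LINT t|It T. (Vnorm \<Omega> (\<phi> t))\<^sup>2) = 2 * \<mu> * (LINT z|spacetime \<Omega> T. (norm (sym_part (\<Phi> (snd z) (fst z))))\<^sup>2)"
  proof -
    have "(LINT z|spacetime \<Omega> T. (norm (sym_part (\<Phi> (snd z) (fst z))))\<^sup>2) = (LINT t|It T. LINT x|M. (norm (sym_part (\<Phi> t x)))\<^sup>2)"
      using spacetime_integral_slice(3)[OF borel_measurable_integrable[OF iD] iD] by simp
    also have "\<dots> = (LINT t|It T. (Vnorm \<Omega> (\<phi> t))\<^sup>2 / 2)"
    proof (rule integrable_lebesgue_on_cong_AE(2)[symmetric])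
      show "AE t in It T. (Vnorm \<Omega> (\<phi> t))\<^sup>2 / 2 = (LINT x|M. (norm (sym_part (\<Phi> t x)))\<^sup>2)"
        using h\<phi> by eventually_elim (simp add: Vnorm_eq korn_identity)
    qed (use iV in auto)
    finally show ?thesis by simp
  qed
  also have "\<dots> = (LINT z|spacetime \<Omega> T. 2 * \<mu> * (norm (sym_part (\<Phi> (snd z) (fst z))))\<^sup>2)" by simp
  also have "\<dots> \<le> (LINT z|spacetime \<Omega> T. \<tau>1 (snd z) (fst z) \<bullet> sym_part (\<Phi> (snd z) (fst z)) - \<tau>2 (snd z) (fst z) \<bullet> sym_part (\<Phi> (snd z) (fst z)))"
  proof (rule integral_mono_AE)
    have l1: "AE z in spacetime \<Omega> T. bingham_rel \<mu> \<tau>y (sym_part (G1 (snd z) (fst z))) (\<tau>1 (snd z) (fst z))"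
      using law(1) unfolding bingham_law_def bingham_rel_def by (simp add: case_prod_beta')
    have l2: "AE z in spacetime \<Omega> T. bingham_rel \<mu> \<tau>y (sym_part (G2 (snd z) (fst z))) (\<tau>2 (snd z) (fst z))"
      using law(2) unfolding bingham_law_def bingham_rel_def by (simp add: case_prod_beta')
    show "AE z in spacetime \<Omega> T. 2 * \<mu> * (norm (sym_part (\<Phi> (snd z) (fst z))))\<^sup>2
        \<le> \<tau>1 (snd z) (fst z) \<bullet> sym_part (\<Phi> (snd z) (fst z)) - \<tau>2 (snd z) (fst z) \<bullet> sym_part (\<Phi> (snd z) (fst z))"
      using l1 l2
    proof eventually_elim
      case (elim z)
      show ?case
        using bingham_rel_monotone[OF elim \<tau>y]
        by (cases "snd z < s") (simp_all add: \<Phi>_def H_def sym_part_diff sym_part_zero inner_diff_left)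
    qed
  qed (use iD j1 j2 in auto)
  also have "\<dots> = (LINT z|spacetime \<Omega> T. \<tau>1 (snd z) (fst z) \<bullet> sym_part (\<Phi> (snd z) (fst z)))
      - (LINT z|spacetime \<Omega> T. \<tau>2 (snd z) (fst z) \<bullet> sym_part (\<Phi> (snd z) (fst z)))"
    using j1 j2 by simp
  finally have B: "\<mu> * (LINT t|It T. (Vnorm \<Omega> (\<phi> t))\<^sup>2) \<le> (LINT z|spacetime \<Omega> T. \<tau>1 (snd z) (fst z) \<bullet> sym_part (\<Phi> (snd z) (fst z)))
      - (LINT z|spacetime \<Omega> T. \<tau>2 (snd z) (fst z) \<bullet> sym_part (\<Phi> (snd z) (fst z)))" .
  \<comment> \<open>The remainder of Young's inequality 4 a y p \<le> \<mu> p^2 + (4/\<mu>) a^2 y^2,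
    that is, of expanding (\<mu> p - 2 a y)^2 / \<mu>.\<close>
  let ?Q = "\<lambda>t. indicator {0<..<s} t * (4 / \<mu> * (Vnorm \<Omega> (u1 t))\<^sup>2 * (L2norm M (W t))\<^sup>2)"
  have iu1: "integrable (It T) (\<lambda>t. (Vnorm \<Omega> (u1 t))\<^sup>2)" using b(1) by (simp add: bochner_L2_def)
  have iQ: "integrable (It T) ?Q"
  proof (rule Bochner_Integration.integrable_bound[where f="\<lambda>t. 4 / \<mu> * R\<^sup>2 * (Vnorm \<Omega> (u1 t))\<^sup>2"])
    show "integrable (It T) (\<lambda>t. 4 / \<mu> * R\<^sup>2 * (Vnorm \<Omega> (u1 t))\<^sup>2)" using iu1 by simp
    have mW: "(\<lambda>t. L2norm M (W t)) \<in> borel_measurable (It T)"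
      by (rule continuous_imp_measurable_on_sets_lebesgue[OF continuous_on_subset[OF continuous_L2norm[OF W]]]) auto
    have mi: "(\<lambda>t. indicator {0<..<s} t :: real) \<in> borel_measurable (It T)"
      by (rule borel_measurable_lebesgue_onI) simp
    show "?Q \<in> borel_measurable (It T)"
      by (rule borel_measurable_times[OF mi borel_measurable_times[OF borel_measurable_times[OF borel_measurable_const
            borel_measurable_integrable[OF iu1]] borel_measurable_power[OF mW]]])
    show "AE t in It T. norm (?Q t) \<le> norm (4 / \<mu> * R\<^sup>2 * (Vnorm \<Omega> (u1 t))\<^sup>2)"
      using I
    proof eventually_elim
      case (elim t)
      have "(L2norm M (W t))\<^sup>2 \<le> R\<^sup>2" using R(2) elim by (intro power_mono) (auto simp: L2norm_nonneg)
      then have "4 / \<mu> * (Vnorm \<Omega> (u1 t))\<^sup>2 * (L2norm M (W t))\<^sup>2 \<le> 4 / \<mu> * (Vnorm \<Omega> (u1 t))\<^sup>2 * R\<^sup>2"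
        using \<mu> by (intro mult_left_mono) auto
      then show ?case using \<mu> by (auto simp: indicator_def abs_mult mult_ac)
    qed
  qed
  have "(LINT t|It T. conv (G2 t) (u2 t) (\<phi> t)) - (LINT t|It T. conv (G1 t) (u1 t) (\<phi> t))
      = (LINT t|It T. conv (G2 t) (u2 t) (\<phi> t) - conv (G1 t) (u1 t) (\<phi> t))"
    using i1(2) i2(2) by simp
  also have "\<dots> \<le> (LINT t|It T. \<mu> * (Vnorm \<Omega> (\<phi> t))\<^sup>2 + ?Q t)"
  proof (rule integral_mono_AE)
    show "AE t in It T. conv (G2 t) (u2 t) (\<phi> t) - conv (G1 t) (u1 t) (\<phi> t) \<le> \<mu> * (Vnorm \<Omega> (\<phi> t))\<^sup>2 + ?Q t"
      using hu hw nw I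
    proof eventually_elim
      case (elim t)
      show ?case
      proof (cases "t < s")
        case True
        let ?a = "L2norm M (G1 t)" and ?p = "L2norm M (H t)" and ?y = "L2norm M (W t)"
        have "\<bar>conv (G1 t) (u1 t) (w t) - conv (G2 t) (u2 t) (w t)\<bar> \<le> 4 * ?a * ?y * ?p"
          using conv_difference[OF elim(1,2)] elim(4) by (simp add: w_def[abs_def] H_def[abs_def])
        also have "\<dots> \<le> \<mu> * ?p\<^sup>2 + 4 / \<mu> * ?a\<^sup>2 * ?y\<^sup>2"
        proof -
          have "0 \<le> (\<mu> * ?p - 2 * ?a * ?y)\<^sup>2 / \<mu>" using \<mu> by simp
          also have "\<dots> = \<mu> * ?p\<^sup>2 + 4 / \<mu> * ?a\<^sup>2 * ?y\<^sup>2 - 4 * ?a * ?y * ?p"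
            using \<mu> by (simp add: field_simps power2_eq_square)
          finally show ?thesis by simp
        qed
        finally show ?thesis
          using True elim(5) by (simp add: \<phi>w Vnorm_eq[OF elim(1)] Vnorm_eq[OF elim(3)])
      next
        case False
        then show ?thesis by (simp add: \<phi>0 conv_def V.N_zero)
      qed
    qed
  qed (use i1(2) i2(2) iV iQ in auto)
  also have "\<dots> = \<mu> * (LINT t|It T. (Vnorm \<Omega> (\<phi> t))\<^sup>2) + (LINT t|It T. ?Q t)"
    using iV iQ by simp
  finally have C: "(LINT t|It T. conv (G2 t) (u2 t) (\<phi> t)) - (LINT t|It T. conv (G1 t) (u1 t) (\<phi> t))
      \<le> \<mu> * (LINT t|It T. (Vnorm \<Omega> (\<phi> t))\<^sup>2) + (LINT t|It T. ?Q t)" .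
  show ?thesis using eqn A B C by linarith
qed

lemma weak_solutions_unique:
  assumes \<mu>: "\<mu> > 0" and \<tau>y: "\<tau>y > 0"
    and sol: "weak_solution \<Omega> T \<mu> \<tau>y f u0 u1 \<tau>1" "weak_solution \<Omega> T \<mu> \<tau>y f u0 u2 \<tau>2"
  shows "AE (x, t) in spacetime \<Omega> T. u1 t x = u2 t x"
proof -
  obtain g1 G1 where 1: "time_derivative \<Omega> T u1 g1" "space_gradient \<Omega> T u1 G1" "bingham_law \<Omega> T \<mu> \<tau>y G1 \<tau>1"
    and w1: "\<And>\<phi> \<Phi>. \<phi> \<in> L2V \<Omega> T \<and> space_gradient \<Omega> T \<phi> \<Phi> \<Longrightarrow>
           (LINT t|It T. g1 t (\<phi> t)) + (LINT z|spacetime \<Omega> T. \<tau>1 (snd z) (fst z) \<bullet> sym_part (\<Phi> (snd z) (fst z)))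
           + (LINT t|It T. conv (G1 t) (u1 t) (\<phi> t)) = (LINT t|It T. f t (\<phi> t))"
    using sol(1) unfolding weak_solution_def conv_def by blast
  obtain g2 G2 where 2: "time_derivative \<Omega> T u2 g2" "space_gradient \<Omega> T u2 G2" "bingham_law \<Omega> T \<mu> \<tau>y G2 \<tau>2"
    and w2: "\<And>\<phi> \<Phi>. \<phi> \<in> L2V \<Omega> T \<and> space_gradient \<Omega> T \<phi> \<Phi> \<Longrightarrow>
           (LINT t|It T. g2 t (\<phi> t)) + (LINT z|spacetime \<Omega> T. \<tau>2 (snd z) (fst z) \<bullet> sym_part (\<Phi> (snd z) (fst z)))
           + (LINT t|It T. conv (G2 t) (u2 t) (\<phi> t)) = (LINT t|It T. f t (\<phi> t))"
    using sol(2) unfolding weak_solution_def conv_def by blast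
  have u: "u1 \<in> L2V \<Omega> T" "u2 \<in> L2V \<Omega> T"
    and \<tau>: "square_integrable (spacetime \<Omega> T) (\<lambda>(x, t). \<tau>1 t x)" "square_integrable (spacetime \<Omega> T) (\<lambda>(x, t). \<tau>2 t x)"
    and iv: "initial_value \<Omega> T u1 u0" "initial_value \<Omega> T u2 u0"
    using sol by (auto simp: weak_solution_def E22_def)
  obtain U1 where U1: "continuous_L2 T U1" "AE t in It T. AE x in M. U1 t x = u1 t x" "AE x in M. U1 0 x = u0 x"
    using iv(1) continuous_into_H_L2 unfolding initial_value_def by blast
  obtain U2 where U2: "continuous_L2 T U2" "AE t in It T. AE x in M. U2 t x = u2 t x" "AE x in M. U2 0 x = u0 x"
    using iv(2) continuous_into_H_L2 unfolding initial_value_def by blast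
  define W where "W t x = U1 t x - U2 t x" for t x
  have W: "continuous_L2 T W" unfolding W_def[abs_def] by (rule continuous_L2_diff[OF U1(1) U2(1)])
  define y where "y t = (L2norm M (W t))\<^sup>2" for t
  have y0: "y 0 = 0"
  proof -
    have "AE x in M. W 0 x = 0" using U1(3) U2(3) by eventually_elim (simp add: W_def)
    then show ?thesis by (simp add: y_def L2norm_AE_0)
  qed
  have b1: "u1 \<in> bochner_L2 T (space_V \<Omega>) (Vnorm \<Omega>)" using u(1) by (simp add: L2V_def)
  obtain u1' s1 where u1': "V.borel_rep T u1' s1" "AE t in It T. u1' t = u1 t" by (rule V.bochner_borel_rep[OF b1])
  note V1 = V.borel_repD[OF u1'(1)]
  \<comment> \<open>The constant 4/\<mu> is doubled because the energy inequality controls y / 2.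
    The Borel representative extends the coefficient by zero to an integrable function on the line,
    as \<open>gronwall_zero\<close> requires.\<close>
  define a where "a t = 8 / \<mu> * (Vnorm \<Omega> (u1' t))\<^sup>2" for t
  have ia: "integrable lborel a" unfolding a_def[abs_def] using V1(7) by simp
  have yc: "continuous_on {0..T} y" unfolding y_def[abs_def] by (intro continuous_intros continuous_L2norm W)
  have yzero: "y s = 0" if s: "s \<in> {0..<T}" for s
  proof (rule gronwall_zero[OF yc _ ia _ _ s])
    show "0 \<le> y t" for t by (simp add: y_def)
    show "0 \<le> a t" for t using \<mu> by (simp add: a_def)
    fix s assume s: "s \<in> {0..<T}"
    show "y s \<le> (LINT t|lborel. indicator {0<..<s} t * (a t * y t))"
    proof (cases "s = 0")
      case False
      then have s0: "0 < s" "s < T" using s by auto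
      have e: "y s / 2 \<le> (LINT t|It T. indicator {0<..<s} t * (4 / \<mu> * (Vnorm \<Omega> (u1 t))\<^sup>2 * y t))"
        using energy_inequality[OF \<mu> \<tau>y u \<tau> 1(1) 2(1) 1(2) 2(2) 1(3) 2(3) _ U1(1) U2(1) U1(2) U2(2) s0] w1 w2 y0
        by (simp add: y_def W_def[abs_def])
      have m: "(\<lambda>t. indicator {0<..<s} t * (a t * y t)) \<in> borel_measurable borel"
      proof -
        have "(\<lambda>t. indicator {0<..<s} t *\<^sub>R y t) \<in> borel_measurable borel"
          by (intro borel_measurable_continuous_on_indicator continuous_on_subset[OF yc]) (use s in auto)
        then have "(\<lambda>t. a t * (indicator {0<..<s} t *\<^sub>R y t)) \<in> borel_measurable borel"
          using borel_measurable_integrable[OF ia] by (intro borel_measurable_times) auto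
        then show ?thesis by (simp add: mult_ac)
      qed
      have "y s \<le> 2 * (LINT t|It T. indicator {0<..<s} t * (4 / \<mu> * (Vnorm \<Omega> (u1 t))\<^sup>2 * y t))" using e by linarith
      also have "\<dots> = (LINT t|It T. 2 * (indicator {0<..<s} t * (4 / \<mu> * (Vnorm \<Omega> (u1 t))\<^sup>2 * y t)))"
        by (rule integral_mult_right_zero[symmetric])
      also have "\<dots> = (LINT t|It T. indicator {0<..<s} t * (a t * y t))"
      proof -
        note mI = borel_measurable_lebesgue_onI[OF m, of "{0<..<T}"]
        have ae: "AE t in It T. indicator {0<..<s} t * (a t * y t) = 2 * (indicator {0<..<s} t * (4 / \<mu> * (Vnorm \<Omega> (u1 t))\<^sup>2 * y t))"
          using u1'(2) by eventually_elim (simp add: a_def)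
        show ?thesis by (rule integral_cong_AE[OF mI borel_measurable_lebesgue_on_AE[OF mI _ ae] ae, symmetric]) simp
      qed
      also have "\<dots> = (LINT t|lborel. indicator {0<..<s} t * (a t * y t))"
        by (rule integral_lebesgue_on_eq_lborel(1)[OF m]) (use s in auto)
      finally show ?thesis .
    qed (simp add: y0)
  qed
  have bu: "AE t in It T. u1 t \<in> space_V \<Omega>" "AE t in It T. u2 t \<in> space_V \<Omega>"
    using u by (auto simp: L2V_def bochner_L2_def)
  have I: "AE t in It T. t \<in> {0<..<T}" by (rule AE_I2) simp
  have mu: "(\<lambda>z. norm (u1 (snd z) (fst z) - u2 (snd z) (fst z))) \<in> borel_measurable (spacetime \<Omega> T)"
    using u by (intro measurable_compose[OF _ borel_measurable_norm] borel_measurable_diff) (simp_all add: L2V_def case_prod_beta')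
  \<comment> \<open>So far equality is known on almost every time slice; joint measurability of the
    difference turns this into equality almost everywhere on the cylinder.\<close>
  have "AE z in spacetime \<Omega> T. norm (u1 (snd z) (fst z) - u2 (snd z) (fst z)) = 0"
  proof (rule spacetime_AE_zero[OF mu])
    show "AE t in It T. AE x in M. norm (u1 (snd (x, t)) (fst (x, t)) - u2 (snd (x, t)) (fst (x, t))) = 0"
      using U1(2) U2(2) I
    proof eventually_elim
      case (elim t)
      have "L2norm M (W t) = 0" using yzero[of t] elim(3) by (simp add: y_def)
      then have "AE x in M. W t x = 0" using elim(3) by (intro L2norm_eq_0 continuous_L2D[OF W]) auto
      then show ?case using elim(1,2) by eventually_elim (simp add: W_def)
    qed
  qed
  then show ?thesis by eventually_elim (simp add: case_prod_beta')
qed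

end

theorem mainTheorem3:
  fixes \<Omega> :: "(real^2) set" and T \<mu> \<tau>y :: real
    and f :: "real \<Rightarrow> (real^2 \<Rightarrow> real^2) \<Rightarrow> real"
    and u0 :: "real^2 \<Rightarrow> real^2"
    and u1 u2 :: "real \<Rightarrow> real^2 \<Rightarrow> real^2"
    and \<tau>1 \<tau>2 :: "real \<Rightarrow> real^2 \<Rightarrow> real^2^2"
  assumes "lipschitz_domain \<Omega>" and "T > 0" and "\<mu> > 0" and "\<tau>y > 0"
    and "f \<in> L2V' \<Omega> T" and "u0 \<in> space_H \<Omega>"
    and "weak_solution \<Omega> T \<mu> \<tau>y f u0 u1 \<tau>1"
    and "weak_solution \<Omega> T \<mu> \<tau>y f u0 u2 \<tau>2"
  shows "AE (x, t) in spacetime \<Omega> T. u1 t x = u2 t x"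
proof -
  interpret bounded_open \<Omega>
    using assms(1) by unfold_locales (simp_all add: lipschitz_domain_def)
  show ?thesis by (rule weak_solutions_unique[OF assms(3,4,7,8)])
qed

end
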